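(* Let $U\subset\mathbb{C}_\tau$ and $\Omega\subset\mathbb{C}^n_z$ be bounded domains and $\varphi\colon U\times\Omega\to\mathbb{R}$ a function that is smooth on $\overline{U\times\Omega}$. Define $\Phi\colon U\to\mathbb{R}$ by $e^{-\Phi(\tau)}=\int_{z\in\Omega}e^{-\varphi(\tau,z)}$. Let $g\colon U\to\mathbb{R}_{\geq0}$ be non-negative and $\omega=\sqrt{-1}\,\mathrm{d}\tau\wedge\mathrm{d}\bar\tau$. Then the following are equivalent: (1) $\sqrt{-1}\partial\overline{\partial}\Phi\geq g\,\omega$ on $U$; (2) for every $a\in U$ and every $\varepsilon>0$ there exists $r_\varepsilon\in(0,\delta(a))$ such that $L_\Phi(a,r)\leq e^{-\max\{\frac{g(a)-\varepsilon}{2},0\}r^2}$ for all $r\in(0,r_\varepsilon)$.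
   Context: $\Delta(a;r)=\{\tau\in\mathbb{C}\mid|\tau-a|<r\}$; $\delta(a)=\sup\{r>0\mid\Delta(a;r)\subset U\}$. For $0<r<\delta(a)$, $L_\Phi(a,r)=\inf\{\int_{\Delta(a;r)}|f|^2e^{-\Phi}/(\pi r^2e^{-\Phi(a)})\mid f\text{ holomorphic on }\Delta(a;r),\ \int_{\Delta(a;r)}|f|^2e^{-\Phi}<\infty,\ f(a)=1\}$. *)

theory Defs
  imports "HOL-Analysis.Analysis"
begin

text \<open>C^k functions on a set S (used for open S): k-fold iterated Frechet
  differentiability, expressed via directional derivatives, with continuous
  k-th derivatives.\<close>
fun Ck_on :: "nat \<Rightarrow> ('a::real_normed_vector \<Rightarrow> 'b::real_normed_vector) \<Rightarrow> 'a set \<Rightarrow> bool" where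
  "Ck_on 0 f S = continuous_on S f"
| "Ck_on (Suc k) f S =
     (\<exists>f'. (\<forall>x\<in>S. (f has_derivative f' x) (at x)) \<and> (\<forall>v. Ck_on k (\<lambda>x. f' x v) S))"

definition smooth_on :: "('a::real_normed_vector \<Rightarrow> 'b::real_normed_vector) \<Rightarrow> 'a set \<Rightarrow> bool" where
  "smooth_on f S \<longleftrightarrow> (\<forall>k. Ck_on k f S)"

definition smooth_on_closure :: "('a::real_normed_vector \<Rightarrow> 'b::real_normed_vector) \<Rightarrow> 'a set \<Rightarrow> bool" where
  "smooth_on_closure f A \<longleftrightarrow>
     (\<exists>W \<psi>. open W \<and> closure A \<subseteq> W \<and> smooth_on \<psi> W \<and> (\<forall>x\<in>A. \<psi> x = f x))"

text \<open>Coefficient of i dtau /\ dtaubar in i ddbar Phi: d^2 Phi / dtau dtaubar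
  = (1/4)(Phi_xx + Phi_yy), tau = x + i y.\<close>
definition ddbar_coeff :: "(complex \<Rightarrow> real) \<Rightarrow> complex \<Rightarrow> real" where
  "ddbar_coeff \<Phi> \<tau> = (1/4) *
     (deriv (\<lambda>s. deriv (\<lambda>t. \<Phi> (Complex t (Im \<tau>))) s) (Re \<tau>)
      + deriv (\<lambda>s. deriv (\<lambda>t. \<Phi> (Complex (Re \<tau>) t)) s) (Im \<tau>))"

definition delta :: "complex set \<Rightarrow> complex \<Rightarrow> real" where
  "delta U a = Sup {r. r > 0 \<and> ball a r \<subseteq> U}"

definition L_Phi :: "(complex \<Rightarrow> real) \<Rightarrow> complex \<Rightarrow> real \<Rightarrow> real" where
  "L_Phi \<Phi> a r = Inf {integral (ball a r) (\<lambda>\<tau>. (cmod (f \<tau>))\<^sup>2 * exp (- \<Phi> \<tau>))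
                          / (pi * r\<^sup>2 * exp (- \<Phi> a)) | f.
        f holomorphic_on ball a r \<and>
        (\<lambda>\<tau>. (cmod (f \<tau>))\<^sup>2 * exp (- \<Phi> \<tau>)) integrable_on ball a r \<and>
        f a = 1}"

end

theory Submission
  imports Defs "HOL-Complex_Analysis.Complex_Analysis"
begin

unbundle no fps_syntax

text \<open>
  Write c for the coefficient of i ddbar Phi at a. Taylor expansion gives
  Phi(a + h) = Phi(a) + Re P(h) + c |h|^2 + o(|h|^2) with P a holomorphic polynomial. Testing with
  exp(P/2), and comparing any competitor f with f exp(-P/2) through the mean value property, yields
  L(a,r) = 1 - c r^2 / 2 + o(r^2). This settles (2) => (1), and (1) => (2) whenever eps < g(a).

  If eps >= g(a), the exact bound L(a,r) <= 1 is needed, although c may vanish at a to infinite order.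
  Rescale to the unit disc D and subtract a harmonic function, so that the weight becomes a
  superposition of logarithmic poles against a positive measure, whose mass is at most 1/2 once r is
  small. For the single pole (1/2) log |b|^2, with b the Blaschke factor at zeta, the zero-free
  function (1 + s - 2 cnj(zeta) z) / ((1 + s)(1 - cnj(zeta) z)), s = |zeta|^2, is the extremal one and
  obeys the bound. Because it has no zeros, logarithms of these functions can be averaged against the
  measure, and Jensen's inequality carries the bound over to the superposition.
\<close>

section \<open>Change of variables and radial integrals in the plane\<close>

text \<open>For a subharmonic weight on a disc, L \<le> 1 is the sharp Ohsawa-Takegoshi extension
  theorem for one point. Condition (2) concerns small radii, and there an elementary argument is
  available; smallness enters through the bound on the mass. The poles carry the factor 1/2 because
  exp(-log |b|^2) = 1/|b|^2 is not integrable, whereas 1/|b| is. Splitting each log |b|^2 into two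
  halves doubles the density, so mass 1/2 becomes total weight 1, the most that Jensen's inequality
  tolerates. The extremal function of one pole is found by moving the pole to the origin. In the
  Bergman space with weight 1/|w| the monomials are orthogonal with squared norms 2 pi / (2k + 1),
  so the reproducing kernel is a multiple of sum (2k + 1) y^k = (1 + y) / (1 - y)^2. Its only zero
  is y = -1, on the unit circle; this is why the extremal function has a holomorphic logarithm on
  the disc. A Taylor test function alone cannot give L \<le> 1 when c = 0: its error o(r^2) has no
  controlled sign.\<close>

text \<open>Boxes determine Lebesgue measure, and coordinates carry boxes to boxes. The
  identification transports the change-of-variables theorem from \<open>real^2\<close> to
  \<open>complex\<close>.\<close>

lemma distr_Complex_lborel:
  "distr lborel borel (\<lambda>v::real^2. Complex (v$1) (v$2)) = lborel"
proof (rule sym, rule lborel_eqI)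
  fix l u :: complex
  assume le: "\<And>b. b \<in> Basis \<Longrightarrow> l \<bullet> b \<le> u \<bullet> b"
  have vm: "(\<lambda>v::real^2. Complex (v$1) (v$2)) -` box l u = box (vector [Re l, Im l]) (vector [Re u, Im u])"
    by (auto simp: mem_box_cart in_box_complex_iff forall_2)
  have m: "(\<lambda>v::real^2. Complex (v$1) (v$2)) \<in> borel_measurable borel"
    by (intro borel_measurable_continuous_onI) (auto simp: Complex_eq intro!: continuous_intros)
  have b: "Re l \<le> Re u" "Im l \<le> Im u" using le[of 1] le[of \<i>] by (auto simp: Basis_complex_def)
  have "emeasure (distr lborel borel (\<lambda>v::real^2. Complex (v$1) (v$2))) (box l u)
     = emeasure lborel (box (vector [Re l, Im l]) (vector [Re u, Im u] :: real^2))"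
    using m vm by (simp add: emeasure_distr)
  also have "\<dots> = ennreal (prod (\<lambda>b. (vector [Re u, Im u] - vector [Re l, Im l] :: real^2) \<bullet> b) Basis)"
    using b by (subst emeasure_lborel_box_eq) 
       (auto simp: Basis_vec_def UNIV_2 inner_axis axis_eq_axis)
  also have "prod (\<lambda>b. (vector [Re u, Im u] - vector [Re l, Im l] :: real^2) \<bullet> b) Basis = (\<Prod>b\<in>Basis. (u - l) \<bullet> b)"
    by (auto simp: Basis_vec_def UNIV_2 inner_axis axis_eq_axis Basis_complex_def)
  finally show "emeasure (distr lborel borel (\<lambda>v::real^2. Complex (v$1) (v$2))) (box l u) = (\<Prod>b\<in>Basis. (u - l) \<bullet> b)" .
qed simp

lemma nn_integral_complex_cart:
  assumes [measurable]: "h \<in> borel_measurable borel"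
  shows "(\<integral>\<^sup>+z. h z \<partial>lborel) = (\<integral>\<^sup>+v. h (Complex (v$1) (v$2)) \<partial>(lborel :: (real^2) measure))"
proof -
  have [measurable]: "(\<lambda>v::real^2. Complex (v$1) (v$2)) \<in> borel_measurable borel"
    by (intro borel_measurable_continuous_onI) (auto simp: Complex_eq intro!: continuous_intros)
  show ?thesis
    by (subst distr_Complex_lborel[symmetric], subst nn_integral_distr) auto
qed

text \<open>The real Jacobian determinant of a holomorphic map is |g'|^2. The pulled-back integral
  is assumed to be a finite \<open>b\<close>, so that the argument can pass through absolutely
  integrable functions on \<open>real^2\<close> and return to \<open>nn_integral\<close> at the
  end.\<close>

lemma nn_integral_holomorphic_change_of_variables:
  fixes g g' :: "complex \<Rightarrow> complex" and h :: "complex \<Rightarrow> real"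
  assumes S: "open S" "open (g ` S)" and inj: "inj_on g S"
    and g: "\<And>z. z \<in> S \<Longrightarrow> (g has_field_derivative g' z) (at z)"
    and g': "continuous_on S g'"
    and h [measurable]: "h \<in> borel_measurable borel" and h0: "\<And>z. 0 \<le> h z"
    and b: "(\<integral>\<^sup>+z. ennreal ((cmod (g' z))\<^sup>2 * h (g z)) * indicator S z \<partial>lborel) = ennreal b" "0 \<le> b"
  shows "(\<integral>\<^sup>+z. ennreal (h z) * indicator (g ` S) z \<partial>lborel) = ennreal b"
proof -
  define \<phi> where "\<phi> = (\<lambda>v::real^2. Complex (v$1) (v$2))"
  define \<psi> where "\<psi> = (\<lambda>z. vector [Re z, Im z] :: real^2)"
  have \<phi>\<psi>: "\<phi> (\<psi> z) = z" for z by (simp add: \<phi>_def \<psi>_def complex_eq_iff)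
  have \<psi>\<phi>: "\<psi> (\<phi> v) = v" for v by (simp add: \<phi>_def \<psi>_def vec_eq_iff forall_2)
  have lin\<phi>: "bounded_linear \<phi>" 
    unfolding \<phi>_def by (rule linear_conv_bounded_linear[THEN iffD1], rule linearI) (auto simp: complex_eq_iff)
  have lin\<psi>: "bounded_linear \<psi>" 
    unfolding \<psi>_def by (rule linear_conv_bounded_linear[THEN iffD1], rule linearI) (auto simp: vec_eq_iff forall_2)
  note d\<phi> = bounded_linear.has_derivative[OF lin\<phi>] and d\<psi> = bounded_linear.has_derivative[OF lin\<psi>]
  have cont\<phi>: "continuous_on UNIV \<phi>" by (rule linear_continuous_on[OF lin\<phi>])
  hence [measurable]: "\<phi> \<in> borel_measurable borel" by (rule borel_measurable_continuous_onI)
  define S' where "S' = \<phi> -` S"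
  have "open S'" unfolding S'_def using cont\<phi> S(1) by (simp add: continuous_on_open_vimage)
  have S'l: "S' \<in> sets lebesgue" using \<open>open S'\<close> by (simp add: borel_open sets_completionI_sets)
  define G where "G = (\<lambda>v. \<psi> (g (\<phi> v)))"
  define G' where "G' = (\<lambda>v w. \<psi> (g' (\<phi> v) * \<phi> w))"
  have der: "(G has_derivative G' v) (at v within S')" if "v \<in> S'" for v
  proof -
    have "(g has_derivative (\<lambda>w. g' (\<phi> v) * w)) (at (\<phi> v))"
      using g[of "\<phi> v"] that by (simp add: S'_def has_field_derivative_def)
    from has_derivative_compose[OF bounded_linear_imp_has_derivative[OF lin\<phi>] this]
    have "((\<lambda>v. g (\<phi> v)) has_derivative (\<lambda>w. g' (\<phi> v) * \<phi> w)) (at v within S')" .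
    from d\<psi>[OF this] show ?thesis unfolding G_def G'_def .
  qed
  have injG: "inj_on G S'"
    by (smt (verit, best) G_def S'_def \<phi>\<psi> \<psi>\<phi> inj inj_on_def vimage_eq)
  \<comment> \<open>Cauchy-Riemann: multiplication by p + q i has the matrix with rows (p, -q) and
    (q, p), of determinant p^2 + q^2.\<close>
  have det: "det (matrix (G' v)) = (cmod (g' (\<phi> v)))\<^sup>2" for v
    unfolding cmod_power2 by (simp add: det_2 matrix_def G'_def \<psi>_def \<phi>_def axis_def power2_eq_square)
  have im: "G ` S' = \<phi> -` (g ` S)"
  proof (intro equalityI subsetI)
    fix x assume "x \<in> \<phi> -` g ` S"
    then obtain z where z: "z \<in> S" "\<phi> x = g z" by auto
    then have "x = G (\<psi> z)" by (metis G_def \<phi>\<psi> \<psi>\<phi>)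
    then show "x \<in> G ` S'" using z by (auto simp: S'_def \<phi>\<psi>)
  qed (auto simp: G_def S'_def \<phi>\<psi>)
  have mS [measurable]: "S \<in> sets borel" "g ` S \<in> sets borel" using S by auto
  have mg: "(\<lambda>z. (cmod (g' z))\<^sup>2 * h (g z) * indicator S z) \<in> borel_measurable borel"
  proof -
    have "continuous_on S g" using g by (meson DERIV_isCont continuous_at_imp_continuous_on)
    then have "g \<in> borel_measurable (restrict_space borel S)" "g' \<in> borel_measurable (restrict_space borel S)"
      using g' by (auto intro: borel_measurable_continuous_on_restrict)
    then have "(\<lambda>z. (cmod (g' z))\<^sup>2 * h (g z)) \<in> borel_measurable (restrict_space borel S)"
      by measurable
    then show ?thesis
      by (subst (asm) borel_measurable_restrict_space_iff) (auto simp: mult.commute)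
  qed
  have conv: "ennreal x * indicator A y = ennreal (x * indicator A y)" for x :: real and A and y :: complex
    by (auto simp: indicator_def)
  let ?k = "\<lambda>v. (cmod (g' (\<phi> v)))\<^sup>2 * h (g (\<phi> v))"
  have "(\<integral>\<^sup>+v. ennreal (?k v * indicator S (\<phi> v)) \<partial>lborel) = ennreal b"
    using b(1) unfolding conv \<phi>_def
    by (subst (asm) nn_integral_complex_cart) (use mg in simp_all)
  moreover have mk: "(\<lambda>v. ?k v * indicator S (\<phi> v)) \<in> borel_measurable borel"
    using measurable_compose[OF \<open>\<phi> \<in> borel_measurable borel\<close> mg] by simp
  ultimately have "((\<lambda>v. ?k v * indicator S (\<phi> v)) has_integral b) UNIV"
    by (intro nn_integral_has_integral) (use mk h0 b(2) in \<open>auto simp: mult_nonneg_nonneg\<close>)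
  moreover have "(\<lambda>v. ?k v * indicator S (\<phi> v)) = (\<lambda>v. if v \<in> S' then ?k v else 0)"
    by (auto simp: S'_def)
  ultimately have hi: "(?k has_integral b) S'"
    by (simp add: has_integral_restrict_UNIV)
  then have ai: "?k absolutely_integrable_on S'"
    by (intro nonnegative_absolutely_integrable_1) (auto simp: h0)
  \<comment> \<open>The change-of-variables theorem is about vector-valued integrands, so the real
    integrand is viewed in \<open>real^1\<close>.\<close>
  define f where "f = (\<lambda>v. vec (h (\<phi> v)) :: real^1)"
  have eq: "(\<lambda>x. \<bar>det (matrix (G' x))\<bar> *\<^sub>R f (G x)) = (\<lambda>x. vec (?k x))"
    by (auto simp: det f_def G_def \<phi>\<psi> vec_eq_iff)
  have "(\<lambda>x. \<bar>det (matrix (G' x))\<bar> *\<^sub>R f (G x)) absolutely_integrable_on S' \<and>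
     integral S' (\<lambda>x. \<bar>det (matrix (G' x))\<bar> *\<^sub>R f (G x)) = vec b"
    unfolding eq absolutely_integrable_on_1_iff integral_on_1_eq using ai hi by (simp add: integral_unique)
  then have "f absolutely_integrable_on (G ` S') \<and> integral (G ` S') f = vec b"
    using has_absolute_integral_change_of_variables[OF S'l der injG, of f "vec b"] by (rule iffD1[rotated])
  then have "(\<lambda>v. h (\<phi> v)) absolutely_integrable_on (G ` S')" "integral (G ` S') (\<lambda>v. h (\<phi> v)) = b"
    unfolding absolutely_integrable_on_1_iff integral_on_1_eq f_def by (simp_all add: vec_eq_iff)
  then have "((\<lambda>v. h (\<phi> v)) has_integral b) (G ` S')"
    using absolutely_integrable_on_def by (metis integrable_integral)
  then have "((\<lambda>v. h (\<phi> v) * indicator (g ` S) (\<phi> v)) has_integral b) UNIV"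
  proof -
    have "(\<lambda>v. h (\<phi> v) * indicator (g ` S) (\<phi> v)) = (\<lambda>v. if v \<in> G ` S' then h (\<phi> v) else 0)"
      unfolding im by auto
    then show ?thesis using \<open>((\<lambda>v. h (\<phi> v)) has_integral b) (G ` S')\<close>
      by (simp add: has_integral_restrict_UNIV)
  qed
  then have "(\<integral>\<^sup>+v. ennreal (h (\<phi> v) * indicator (g ` S) (\<phi> v)) \<partial>lborel) = ennreal b"
    by (intro nn_integral_has_integral_lborel) (auto simp: h0)
  then show ?thesis
    unfolding conv \<phi>_def by (subst nn_integral_complex_cart) auto
qed

text \<open>The measures are compared on half-lines \<open>{x<..}\<close>, where they must be
  finite. The minus sign turns these half-lines into balls; for \<open>cmod\<close> itself they
  would be complements of discs, of infinite measure.\<close>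

lemma distr_neg_cmod_lborel:
  "distr lborel borel (\<lambda>z::complex. - cmod z) = density lborel (\<lambda>t. ennreal (2 * pi * max 0 (- t)))"
proof (rule measure_eqI_lessThan)
  fix x :: real
  have L: "emeasure (distr lborel borel (\<lambda>z::complex. - cmod z)) {x<..} = ennreal (pi * (max 0 (- x))\<^sup>2)"
  proof -
    have "(\<lambda>z::complex. - cmod z) -` {x<..} = ball 0 (- x)" by auto
    then have "emeasure (distr lborel borel (\<lambda>z::complex. - cmod z)) {x<..} = emeasure lborel (ball (0::complex) (- x))"
      by (simp add: emeasure_distr)
    also have "\<dots> = ennreal (pi * (max 0 (- x))\<^sup>2)"
      by (cases "x \<le> 0") (simp_all add: emeasure_ball unit_ball_vol_2 max_def ball_empty)
    finally show ?thesis .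
  qed
  have R: "emeasure (density lborel (\<lambda>t. ennreal (2 * pi * max 0 (- t)))) {x<..} = ennreal (pi * (max 0 (- x))\<^sup>2)"
  proof (cases "x \<le> 0")
    case True
    have "(\<integral>\<^sup>+t. ennreal (2 * pi * max 0 (- t)) * indicator {x<..} t \<partial>lborel)
       = (\<integral>\<^sup>+t. ennreal (2 * pi * (- t)) * indicator {x..0} t \<partial>lborel)"
    proof (rule nn_integral_cong_AE)
      show "AE t in lborel. ennreal (2 * pi * max 0 (- t)) * indicator {x<..} t = ennreal (2 * pi * (- t)) * indicator {x..0} t"
        using AE_lborel_singleton[of x] by eventually_elim (auto simp: indicator_def max_def)
    qed
    also have "\<dots> = ennreal (- pi * 0\<^sup>2 - (- pi * x\<^sup>2))"
      by (rule nn_integral_FTC_Icc[where F = "\<lambda>t. - pi * t\<^sup>2"])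
        (use True in \<open>auto intro!: derivative_eq_intros simp: mult_nonneg_nonpos\<close>)
    finally show ?thesis using True by (simp add: emeasure_density max_def)
  next
    case False
    have "(\<integral>\<^sup>+t. ennreal (2 * pi * max 0 (- t)) * indicator {x<..} t \<partial>lborel) = (\<integral>\<^sup>+t. 0 \<partial>(lborel::real measure))"
      using False by (intro nn_integral_cong) (auto simp: indicator_def)
    then show ?thesis using False by (simp add: emeasure_density)
  qed
  show "emeasure (distr lborel borel (\<lambda>z::complex. - cmod z)) {x<..} = 
    emeasure (density lborel (\<lambda>t. ennreal (2 * pi * max 0 (- t)))) {x<..}"
    unfolding L R ..
  show "emeasure (distr lborel borel (\<lambda>z::complex. - cmod z)) {x<..} < \<infinity>"
    unfolding L by simp
qed simp_all

lemma nn_integral_radial: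
  assumes [measurable]: "h \<in> borel_measurable borel"
  shows "(\<integral>\<^sup>+z. h (cmod z) \<partial>lborel) = (\<integral>\<^sup>+t. ennreal (2 * pi * t) * h t * indicator {0..} t \<partial>lborel)"
proof -
  have "(\<integral>\<^sup>+z. h (cmod z) \<partial>lborel) = (\<integral>\<^sup>+t. h (- t) \<partial>distr lborel borel (\<lambda>z::complex. - cmod z))"
    by (subst nn_integral_distr) auto
  also have "\<dots> = (\<integral>\<^sup>+t. ennreal (2 * pi * max 0 (- t)) * h (- t) \<partial>lborel)"
    unfolding distr_neg_cmod_lborel by (subst nn_integral_density) auto
  also have "\<dots> = (\<integral>\<^sup>+t. ennreal (2 * pi * t) * h t * indicator {0..} t \<partial>lborel)"
    by (subst nn_integral_real_affine[where c="-1" and t=0])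
      (auto intro!: nn_integral_cong simp: indicator_def mult.commute)
  finally show ?thesis .
qed

text \<open>The integrand is a power with exponent n - 1, written so that \<open>n = 0\<close>
  covers the singular weight 1/|z| left behind by a pole of strength 1/2. The value at the origin,
  where division yields 0, does not matter.\<close>

lemma nn_integral_disc_power:
  assumes "0 \<le> r"
  shows "(\<integral>\<^sup>+z. ennreal (cmod z ^ n / cmod z) * indicator (ball 0 r) z \<partial>lborel) = ennreal (2 * pi * r ^ (n + 1) / (n + 1))"
proof -
  have "(\<integral>\<^sup>+z. ennreal (cmod z ^ n / cmod z) * indicator (ball 0 r) z \<partial>lborel)
     = (\<integral>\<^sup>+z. (\<lambda>t. ennreal (t ^ n / t) * indicator {..<r} t) (cmod z) \<partial>lborel)"
    by (intro nn_integral_cong) (auto simp: indicator_def)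
  also have "\<dots> = (\<integral>\<^sup>+t. ennreal (2 * pi * t) * (ennreal (t ^ n / t) * indicator {..<r} t) * indicator {0..} t \<partial>lborel)"
    by (rule nn_integral_radial[of "\<lambda>t. ennreal (t ^ n / t) * indicator {..<r} t"]) simp
  also have "\<dots> = (\<integral>\<^sup>+t. ennreal (2 * pi * t ^ n) * indicator {0..r} t \<partial>lborel)"
  proof (rule nn_integral_cong_AE)
    show "AE t in lborel. ennreal (2 * pi * t) * (ennreal (t ^ n / t) * indicator {..<r} t) * indicator {0..} t
        = ennreal (2 * pi * t ^ n) * indicator {0..r} t"
      using AE_lborel_singleton[of r] AE_lborel_singleton[of 0]
    proof eventually_elim
      case (elim t)
      then show ?case by (cases "0 \<le> t") (auto simp: indicator_def ennreal_mult'[symmetric])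
    qed
  qed
  also have "\<dots> = ennreal (2 * pi / (n + 1) * r ^ (n + 1) - 2 * pi / (n + 1) * 0 ^ (n + 1))"
  proof (rule nn_integral_FTC_Icc[where F = "\<lambda>t. 2 * pi / (n + 1) * t ^ (n + 1)"])
    fix t :: real assume t: "t \<in> {0..r}"
    have "((\<lambda>t. 2 * pi / (n + 1) * t ^ (n + 1)) has_real_derivative 2 * pi / (n + 1) * (real (n + 1) * t ^ n)) (at t)"
      by (rule DERIV_cmult) (use DERIV_pow[of "n + 1" t] in simp)
    then show "((\<lambda>t. 2 * pi / (n + 1) * t ^ (n + 1)) has_real_derivative 2 * pi * t ^ n) (at t)"
      by (rule DERIV_cong) (simp add: add.commute)
  qed (use assms in auto)
  finally show ?thesis by simp
qed

text \<open>Normalises an approximate identity: 4 / (1 + |z|^2)^2 is the Laplacian of log (1 +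
  |z|^2), so its total mass is 4 pi.\<close>

lemma nn_integral_inverse_square_one_plus:
  "(\<integral>\<^sup>+z. ennreal (1 / (1 + (cmod z)\<^sup>2)\<^sup>2) \<partial>lborel) = ennreal pi"
proof -
  have "(\<integral>\<^sup>+z. ennreal (1 / (1 + (cmod z)\<^sup>2)\<^sup>2) \<partial>lborel)
    = (\<integral>\<^sup>+t. ennreal (2 * pi * t) * ennreal (1 / (1 + t\<^sup>2)\<^sup>2) * indicator {0..} t \<partial>lborel)"
    by (rule nn_integral_radial[of "\<lambda>t. ennreal (1 / (1 + t\<^sup>2)\<^sup>2)"]) simp
  also have "\<dots> = (\<integral>\<^sup>+t. ennreal (2 * pi * t / (1 + t\<^sup>2)\<^sup>2) * indicator {0..} t \<partial>lborel)"
    by (intro nn_integral_cong) (auto simp: indicator_def ennreal_mult[symmetric])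
  also have "\<dots> = ennreal (0 - (- pi / (1 + 0\<^sup>2)))"
  proof (rule nn_integral_FTC_atLeast[where F = "\<lambda>t. - pi / (1 + t\<^sup>2)"])
    show "((\<lambda>t::real. - pi / (1 + t\<^sup>2)) \<longlongrightarrow> 0) at_top"
    proof (rule tendsto_divide_0[OF tendsto_const], rule filterlim_at_top_imp_at_infinity)
      show "filterlim (\<lambda>t::real. 1 + t\<^sup>2) at_top at_top"
        by (intro filterlim_tendsto_add_at_top[OF tendsto_const] filterlim_pow_at_top filterlim_ident) simp
    qed
    fix t :: real
    have "0 < 1 + t\<^sup>2" by (simp add: add_pos_nonneg)
    then have "1 + t\<^sup>2 \<noteq> 0" by linarith
    have "((\<lambda>t. 1 + t\<^sup>2) has_real_derivative 2 * t) (at t)"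
      by (auto intro!: derivative_eq_intros)
    from DERIV_divide[OF DERIV_const[of "- pi"] this \<open>1 + t\<^sup>2 \<noteq> 0\<close>]
    show "((\<lambda>t. - pi / (1 + t\<^sup>2)) has_real_derivative 2 * pi * t / (1 + t\<^sup>2)\<^sup>2) (at t)"
      by (rule DERIV_cong) (simp add: power2_eq_square)
  qed auto
  finally show ?thesis by simp
qed

section \<open>Differentiation under the integral sign\<close>

text \<open>By the mean value inequality on the convex set \<open>S\<close>, the bound on the
  derivative makes the integrand Lipschitz in the parameter with constant \<open>B z\<close>.
  Difference quotients are then dominated, and dominated convergence applies.\<close>

lemma has_derivative_integral_parameter:
  fixes f :: "'a::{real_normed_vector,perfect_space} \<Rightarrow> 'm \<Rightarrow> 'b::{banach, second_countable_topology}"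
  assumes S: "open S" "convex S" "x \<in> S"
    and der: "\<And>y z. y \<in> S \<Longrightarrow> z \<in> space M \<Longrightarrow> ((\<lambda>y. f y z) has_derivative f' y z) (at y)"
    and bnd: "\<And>y z h. y \<in> S \<Longrightarrow> z \<in> space M \<Longrightarrow> norm (f' y z h) \<le> B z * norm h"
    and int: "\<And>y. y \<in> S \<Longrightarrow> integrable M (f y)"
    and B: "integrable M B"
  shows "integrable M (\<lambda>z. f' x z h)"
    and "((\<lambda>y. \<integral>z. f y z \<partial>M) has_derivative (\<lambda>h. \<integral>z. f' x z h \<partial>M)) (at x)"
proof -
  \<comment> \<open>Measurability of the derivative in z comes from writing it as a pointwise limit
    of difference quotients. The constant c is chosen with c * norm h < e, so that all the points x
    + t n h stay in \<open>S\<close>.\<close>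
  have meas: "(\<lambda>z. f' x z h) \<in> borel_measurable M" for h
  proof -
    obtain e where e: "e > 0" "ball x e \<subseteq> S" using S by (meson open_contains_ball)
    define c where "c = e / (norm h + 1)"
    have c: "c > 0" using e by (simp add: c_def add_nonneg_pos)
    have "norm h < norm h + 1" by simp
    hence ch: "c * norm h < e" using e by (simp add: c_def divide_simps add_nonneg_pos) 
    define t where "t = (\<lambda>n. c / real (Suc n))"
    have t0: "t n > 0" "t n \<le> c" for n using c by (auto simp: t_def divide_simps)
    have tn: "t n \<noteq> 0" for n using t0(1)[of n] by simp
    have xS: "x + t n *\<^sub>R h \<in> S" for n
    proof -
      have "t n * norm h \<le> c * norm h" using t0 by (intro mult_right_mono) auto
      then have "x + t n *\<^sub>R h \<in> ball x e" using ch t0[of n] by (simp add: dist_norm)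
      then show ?thesis using e by blast
    qed
    have tl: "t \<longlonglongrightarrow> 0" unfolding t_def
      using tendsto_mult_right_zero[OF LIMSEQ_inverse_real_of_nat, of c] by (simp add: divide_inverse)
    show ?thesis
    proof (rule borel_measurable_LIMSEQ_metric)
      show "(\<lambda>z. (1 / t n) *\<^sub>R (f (x + t n *\<^sub>R h) z - f x z)) \<in> borel_measurable M" for n
        using int[OF xS[of n]] int[OF S(3)] by (auto dest: borel_measurable_integrable)
      fix z assume z: "z \<in> space M"
      have "((\<lambda>s. f (x + s *\<^sub>R h) z) has_vector_derivative f' x z h) (at 0)"
      proof -
        have 1: "((\<lambda>s. x + s *\<^sub>R h) has_derivative (\<lambda>s. s *\<^sub>R h)) (at 0)"
          by (auto intro!: derivative_eq_intros)
        have 2: "((\<lambda>y. f y z) has_derivative f' x z) (at (x + 0 *\<^sub>R h))"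
          using der[OF S(3) z] by simp
        have "((\<lambda>s. f (x + s *\<^sub>R h) z) has_derivative (\<lambda>s. f' x z (s *\<^sub>R h))) (at 0)"
          by (rule has_derivative_compose[OF 1 2])
        moreover have "f' x z (s *\<^sub>R h) = s *\<^sub>R f' x z h" for s
          using has_derivative_linear[OF der[OF S(3) z]] by (simp add: linear_cmul)
        ultimately show ?thesis by (simp add: has_vector_derivative_def)
      qed
      then have L: "((\<lambda>s. (1 / s) *\<^sub>R (f (x + s *\<^sub>R h) z - f x z)) \<longlongrightarrow> f' x z h) (at 0)"
      proof -
        assume "((\<lambda>s. f (x + s *\<^sub>R h) z) has_vector_derivative f' x z h) (at 0)"
        then have "((\<lambda>s. norm (f (x + s *\<^sub>R h) z - f x z - s *\<^sub>R f' x z h) / norm s) \<longlongrightarrow> 0) (at 0)"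
          by (simp add: has_vector_derivative_def has_derivative_at)
        moreover have "\<forall>\<^sub>F s in at 0. norm (f (x + s *\<^sub>R h) z - f x z - s *\<^sub>R f' x z h) / norm s
            = norm ((1 / s) *\<^sub>R (f (x + s *\<^sub>R h) z - f x z) - f' x z h)"
          using eventually_neq_at_within[of 0]
        proof eventually_elim
          case (elim s)
          then have "(1 / s) *\<^sub>R (f (x + s *\<^sub>R h) z - f x z) - f' x z h
             = (1 / s) *\<^sub>R (f (x + s *\<^sub>R h) z - f x z - s *\<^sub>R f' x z h)"
            by (simp add: scaleR_diff_right)
          then show ?case by simp
        qed
        ultimately have "((\<lambda>s. norm ((1 / s) *\<^sub>R (f (x + s *\<^sub>R h) z - f x z) - f' x z h)) \<longlongrightarrow> 0) (at 0)"
          by (rule Lim_transform_eventually)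
        then show ?thesis using LIM_zero_iff tendsto_norm_zero_iff by blast
      qed
      show "(\<lambda>n. (1 / t n) *\<^sub>R (f (x + t n *\<^sub>R h) z - f x z)) \<longlonglongrightarrow> f' x z h"
        by (rule filterlim_compose[OF L]) 
           (use tn tl in \<open>auto simp: filterlim_at\<close>)
    qed
  qed
  show int': "integrable M (\<lambda>z. f' x z h)" for h
  proof (rule Bochner_Integration.integrable_bound)
    show "integrable M (\<lambda>z. B z * norm h)" using B by simp
    show "AE z in M. norm (f' x z h) \<le> norm (B z * norm h)"
      by (intro AE_I2 order_trans[OF bnd[OF S(3)]]) auto
  qed (rule meas)
  have lip: "norm (f y z - f x z) \<le> B z * norm (y - x)" if "y \<in> S" "z \<in> space M" for y z
    by (rule differentiable_bound[OF S(2) _ _ that(1) S(3), of "\<lambda>y. f y z" "\<lambda>y. f' y z"])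
       (use der bnd that(2) in \<open>auto intro: has_derivative_at_withinI onorm_le\<close>)
  define F where "F = (\<lambda>y. \<integral>z. f y z \<partial>M)"
  define F' where "F' = (\<lambda>h. \<integral>z. f' x z h \<partial>M)"
  have lin: "linear (f' x z)" if "z \<in> space M" for z
    using has_derivative_linear[OF der[OF S(3) that]] .
  have "bounded_linear F'"
  proof (rule bounded_linear_intro)
    show "F' (h + k) = F' h + F' k" for h k
    proof -
      have "F' (h + k) = (\<integral>z. f' x z h + f' x z k \<partial>M)"
        unfolding F'_def by (rule Bochner_Integration.integral_cong) (auto simp: linear_add[OF lin])
      then show ?thesis using int'[of h] int'[of k] by (simp add: F'_def)
    qed
    show "F' (c *\<^sub>R h) = c *\<^sub>R F' h" for c h
    proof -
      have "F' (c *\<^sub>R h) = (\<integral>z. c *\<^sub>R f' x z h \<partial>M)"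
        unfolding F'_def by (rule Bochner_Integration.integral_cong) (auto simp: linear_cmul[OF lin])
      then show ?thesis by (simp add: F'_def)
    qed
    show "norm (F' h) \<le> norm h * (\<integral>z. B z \<partial>M)" for h
    proof -
      have "norm (F' h) \<le> (\<integral>z. norm (f' x z h) \<partial>M)" unfolding F'_def by (rule integral_norm_bound)
      also have "\<dots> \<le> (\<integral>z. B z * norm h \<partial>M)"
        by (rule integral_mono) (use int' B bnd S(3) in auto)
      finally show ?thesis by (simp add: mult.commute)
    qed
  qed
  moreover have "((\<lambda>h. norm (F (x + h) - F x - F' h) / norm h) \<longlongrightarrow> 0) (at 0)"
    unfolding tendsto_at_iff_sequentially
  proof (intro allI impI, unfold comp_def)
    fix X :: "nat \<Rightarrow> 'a" assume X: "\<forall>i. X i \<in> UNIV - {0}" "X \<longlonglongrightarrow> 0"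
    \<comment> \<open>The normalised remainder along a sequence of increments, set to 0 while x + X
      i is still outside \<open>S\<close>. The increment quotient and the linear term are each at
      most \<open>B z\<close>, whence the majorant \<open>2 * B z\<close>.\<close>
    define r where "r = (\<lambda>i z. if x + X i \<in> S then norm (f (x + X i) z - f x z - f' x z (X i)) / norm (X i) else 0)"
    have "(\<lambda>i. x + X i) \<longlonglongrightarrow> x + 0" by (intro tendsto_intros X)
    then have ev: "\<forall>\<^sub>F i in sequentially. x + X i \<in> S"
      using S(1,3) by (simp add: topological_tendstoD)
    have "(\<lambda>i. \<integral>z. r i z \<partial>M) \<longlonglongrightarrow> (\<integral>z. 0 \<partial>M)"
    proof (rule integral_dominated_convergence[where w = "\<lambda>z. 2 * B z"])
      show "r i \<in> borel_measurable M" for i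
        unfolding r_def using int[of "x + X i"] int[OF S(3)] meas[of "X i"]
        by (cases "x + X i \<in> S") (auto dest: borel_measurable_integrable)
      show "AE z in M. (\<lambda>i. r i z) \<longlonglongrightarrow> 0"
      proof (rule AE_I2)
        fix z assume z: "z \<in> space M"
        have "((\<lambda>h. norm (f (x + h) z - f x z - f' x z h) / norm h) \<longlongrightarrow> 0) (at 0)"
          using der[OF S(3) z] unfolding has_derivative_at by blast
        then have "(\<lambda>i. norm (f (x + X i) z - f x z - f' x z (X i)) / norm (X i)) \<longlonglongrightarrow> 0"
          using X unfolding tendsto_at_iff_sequentially comp_def by blast
        then show "(\<lambda>i. r i z) \<longlonglongrightarrow> 0"
          by (rule Lim_transform_eventually) (use ev in eventually_elim, simp add: r_def)
      qed
      show "AE z in M. norm (r i z) \<le> 2 * B z" for i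
      proof (rule AE_I2)
        fix z assume z: "z \<in> space M"
        obtain k :: 'a where "k \<noteq> 0" using X(1) by auto
        then have B0: "0 \<le> B z" using bnd[OF S(3) z, of k] norm_ge_zero[of "f' x z k"]
          by (meson dual_order.trans zero_le_mult_iff norm_le_zero_iff)
        show "norm (r i z) \<le> 2 * B z"
        proof (cases "x + X i \<in> S")
          case True
          have "norm (f (x + X i) z - f x z - f' x z (X i)) \<le> norm (f (x + X i) z - f x z) + norm (f' x z (X i))"
            by (rule norm_triangle_ineq4)
          also have "\<dots> \<le> B z * norm (X i) + B z * norm (X i)"
            using lip[OF True z] bnd[OF S(3) z] by (intro add_mono) auto
          finally show ?thesis using X(1) True by (simp add: r_def divide_simps)
        qed (simp add: r_def B0)
      qed
    qed (use B in auto)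
    then have lim: "(\<lambda>i. \<integral>z. r i z \<partial>M) \<longlonglongrightarrow> 0" by simp
    show "(\<lambda>i. norm (F (x + X i) - F x - F' (X i)) / norm (X i)) \<longlonglongrightarrow> 0"
    proof (rule Lim_null_comparison[OF _ lim])
      show "\<forall>\<^sub>F i in sequentially. norm (norm (F (x + X i) - F x - F' (X i)) / norm (X i)) \<le> (\<integral>z. r i z \<partial>M)"
        using ev
      proof eventually_elim
        case (elim i)
        have "F (x + X i) - F x - F' (X i) = (\<integral>z. f (x + X i) z - f x z - f' x z (X i) \<partial>M)"
          unfolding F_def F'_def using int[OF elim] int[OF S(3)] int' by simp
        then have "norm (F (x + X i) - F x - F' (X i)) \<le> (\<integral>z. norm (f (x + X i) z - f x z - f' x z (X i)) \<partial>M)"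
          by (simp add: integral_norm_bound)
        then have "norm (F (x + X i) - F x - F' (X i)) / norm (X i) \<le> (\<integral>z. norm (f (x + X i) z - f x z - f' x z (X i)) \<partial>M) / norm (X i)"
          by (simp add: divide_right_mono)
        then show ?case using elim by (simp add: r_def)
      qed
    qed
  qed
  ultimately show "((\<lambda>y. \<integral>z. f y z \<partial>M) has_derivative (\<lambda>h. \<integral>z. f' x z h \<partial>M)) (at x)"
    unfolding has_derivative_at F_def F'_def by blast
qed

section \<open>Orthogonality of monomials on the disc\<close>

text \<open>Multiplication by c is holomorphic with constant derivative of modulus 1, so the
  holomorphic change of variables applies with Jacobian 1.\<close>

lemma lborel_distr_rotation:
  fixes c :: complex
  assumes c: "cmod c = 1"
  shows "distr lborel borel (\<lambda>z. c * z) = lborel"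
proof (rule sym, rule lborel_eqI)
  fix l u :: complex
  assume le: "\<And>b. b \<in> Basis \<Longrightarrow> l \<bullet> b \<le> u \<bullet> b"
  have c0: "c \<noteq> 0" using c by auto
  define S where "S = (\<lambda>z. c * z) -` box l u"
  have S: "open S" unfolding S_def by (intro open_vimage continuous_intros) auto
  have im: "(\<lambda>z. c * z) ` S = box l u"
    unfolding S_def using c0 by (subst image_vimage_eq) (auto intro!: range_eqI[of _ _ "_ / c"])
  \<comment> \<open>Only to make the measure of the preimage finite, as the change of variables
    requires.\<close>
  have "S \<subseteq> cball 0 (Sup (norm ` closure (box l u)))"
  proof
    fix z assume "z \<in> S"
    then have "c * z \<in> closure (box l u)" using closure_subset by (auto simp: S_def)
    then have "norm (c * z) \<le> Sup (norm ` closure (box l u))"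
      by (intro cSUP_upper bounded_imp_bdd_above compact_imp_bounded compact_continuous_image continuous_intros)
        (auto simp: compact_closure)
    then show "z \<in> cball 0 (Sup (norm ` closure (box l u)))" by (simp add: norm_mult c)
  qed
  then have "emeasure lborel S < \<infinity>"
    by (meson bounded_cball bounded_subset emeasure_bounded_finite)
  then have b: "emeasure lborel S = ennreal (measure lborel S)"
    by (simp add: emeasure_eq_ennreal_measure top.not_eq_extremum)
  have "(\<integral>\<^sup>+z. ennreal 1 * indicator ((\<lambda>z. c * z) ` S) z \<partial>lborel) = ennreal (measure lborel S)"
    by (rule nn_integral_holomorphic_change_of_variables[where g' = "\<lambda>_. c"])
      (use S c c0 b in \<open>auto simp: im inj_on_def intro!: derivative_eq_intros\<close>)
  then have "emeasure lborel (box l u) = emeasure lborel S"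
    unfolding im b by simp
  then show "emeasure (distr lborel borel (\<lambda>z. c * z)) (box l u) = (\<Prod>b\<in>Basis. (u - l) \<bullet> b)"
    using le by (simp add: emeasure_distr S_def emeasure_lborel_box)
qed simp

text \<open>The rotation by a (k - l)-th root of -1 changes the sign of the integral.\<close>

lemma integral_radial_monomial:
  fixes \<rho> :: "real \<Rightarrow> real"
  assumes [measurable]: "\<rho> \<in> borel_measurable borel" and lk: "l < k"
  shows "(\<integral>z. of_real (\<rho> (cmod z)) * (z ^ k * cnj z ^ l) \<partial>lborel) = 0"
proof -
  define c where "c = cis (pi / real (k - l))"
  have c: "cmod c = 1" by (simp add: c_def)
  have "c ^ (k - l) = -1" unfolding c_def Complex.DeMoivre using lk by (simp del: of_nat_diff)
  moreover have "c ^ k * cnj c ^ l = c ^ (k - l) * (c * cnj c) ^ l"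
    using lk by (simp add: power_mult_distrib mult.assoc[symmetric] power_add[symmetric])
  moreover have "c * cnj c = 1" using c by (simp add: complex_norm_square[symmetric])
  ultimately have ck: "c ^ k * cnj c ^ l = -1" by simp
  let ?I = "\<integral>z. of_real (\<rho> (cmod z)) * (z ^ k * cnj z ^ l) \<partial>lborel"
  have [measurable]: "cnj \<in> borel_measurable borel"
    by (intro borel_measurable_continuous_onI continuous_intros)
  have "?I = (\<integral>z. of_real (\<rho> (cmod z)) * (z ^ k * cnj z ^ l) \<partial>distr lborel borel (\<lambda>z. c * z))"
    by (simp add: lborel_distr_rotation[OF c])
  also have "\<dots> = (\<integral>z. of_real (\<rho> (cmod (c * z))) * ((c * z) ^ k * cnj (c * z) ^ l) \<partial>lborel)"
    by (rule integral_distr) measurable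
  also have "\<dots> = (\<integral>z. (c ^ k * cnj c ^ l) * (of_real (\<rho> (cmod z)) * (z ^ k * cnj z ^ l)) \<partial>lborel)"
    by (intro Bochner_Integration.integral_cong) (auto simp: norm_mult c power_mult_distrib)
  also have "\<dots> = - ?I" by (simp add: ck)
  finally show ?thesis by simp
qed

lemma disc_weight_measurable [measurable]:
  "(\<lambda>z. indicator (ball 0 1) z / cmod z) \<in> borel_measurable borel"
  by (intro borel_measurable_divide borel_measurable_indicator borel_measurable_norm) auto

text \<open>The planar area element 2 pi t dt absorbs the singularity. The same function later
  dominates the logarithm near 0.\<close>

lemma integrable_disc_inverse: "integrable lborel (\<lambda>z. indicator (ball 0 1) z / cmod z)"
proof (rule integrableI_nonneg)
  have "(\<integral>\<^sup>+z. ennreal (indicator (ball 0 1) z / cmod z) \<partial>lborel) = 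
     (\<integral>\<^sup>+z. ennreal (cmod z ^ 0 / cmod z) * indicator (ball 0 1) z \<partial>lborel)"
    by (intro nn_integral_cong) (auto simp: indicator_def)
  also have "\<dots> < \<infinity>" by (subst nn_integral_disc_power) auto
  finally show "(\<integral>\<^sup>+z. ennreal (indicator (ball 0 1) z / cmod z) \<partial>lborel) < \<infinity>" .
  show "(\<lambda>z. indicator (ball 0 1) z / cmod z) \<in> borel_measurable lborel" by simp
qed auto

lemma integrable_disc_inverse_mult:
  fixes f :: "complex \<Rightarrow> 'b::{real_normed_algebra,banach,second_countable_topology}"
  assumes "continuous_on UNIV f"
  shows "integrable lborel (\<lambda>z. (indicator (ball 0 1) z / cmod z) *\<^sub>R f z)"
proof -
  have "bounded (f ` cball 0 1)"
    by (intro compact_imp_bounded compact_continuous_image) (auto intro: continuous_on_subset[OF assms])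
  then obtain B where B: "\<And>z. z \<in> cball 0 1 \<Longrightarrow> norm (f z) \<le> B" 
    unfolding bounded_iff by blast
  have [measurable]: "f \<in> borel_measurable borel" using assms by (rule borel_measurable_continuous_onI)
  show ?thesis
  proof (rule Bochner_Integration.integrable_bound)
    show "integrable lborel (\<lambda>z. B * (indicator (ball 0 1) z / cmod z))"
      by (rule integrable_mult_right[OF integrable_disc_inverse])
    show "AE z in lborel. norm ((indicator (ball 0 1) z / cmod z) *\<^sub>R f z) \<le> norm (B * (indicator (ball 0 1) z / cmod z))"
    proof (rule AE_I2)
      fix z :: complex
      show "norm ((indicator (ball 0 1) z / cmod z) *\<^sub>R f z) \<le> norm (B * (indicator (ball 0 1) z / cmod z))"
      proof (cases "z \<in> ball 0 1")
        case True
        then have "norm (f z) \<le> B" using B by auto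
        then show ?thesis using True by (auto simp: divide_right_mono)
      qed simp
    qed
  qed measurable
qed

text \<open>Parseval's identity for the weight 1/|z|: the weight is radial, so distinct monomials
  are orthogonal, and the squared norm of z^k is 2 pi / (2k + 1).\<close>

lemma nn_integral_disc_polynomial:
  "(\<integral>\<^sup>+z. ennreal ((cmod (\<Sum>k<n. a k * z ^ k))\<^sup>2 / cmod z) * indicator (ball 0 1) z \<partial>lborel)
    = ennreal (\<Sum>k<n. (cmod (a k))\<^sup>2 * (2 * pi / (2 * k + 1)))"
proof -
  let ?w = "\<lambda>z. indicator (ball 0 1) z / cmod z"
  have I: "integrable lborel (\<lambda>z. ?w z *\<^sub>R f z)" if "continuous_on UNIV f" for f :: "complex \<Rightarrow> real"
    using integrable_disc_inverse_mult[OF that] .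
  have IC: "integrable lborel (\<lambda>z. ?w z *\<^sub>R f z)" if "continuous_on UNIV f" for f :: "complex \<Rightarrow> complex"
    using integrable_disc_inverse_mult[OF that] .
  define S where "S = (\<lambda>n z. \<Sum>k<n. a k * z ^ k)"
  have contS: "continuous_on UNIV (S n)" for n unfolding S_def by (intro continuous_intros)
  have M: "(\<integral>z. ?w z *\<^sub>R (cmod z ^ (2 * n)) \<partial>lborel) = 2 * pi / (2 * n + 1)" for n
  proof -
    have "(\<integral>z. ?w z *\<^sub>R (cmod z ^ (2 * n)) \<partial>lborel) = enn2real (\<integral>\<^sup>+z. ennreal (?w z *\<^sub>R (cmod z ^ (2 * n))) \<partial>lborel)"
      by (rule integral_eq_nn_integral, measurable) auto
    also have "(\<integral>\<^sup>+z. ennreal (?w z *\<^sub>R (cmod z ^ (2 * n))) \<partial>lborel) = (\<integral>\<^sup>+z. ennreal (cmod z ^ (2 * n) / cmod z) * indicator (ball 0 1) z \<partial>lborel)"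
      by (intro nn_integral_cong) (auto simp: indicator_def)
    also have "\<dots> = ennreal (2 * pi / (2 * n + 1))"
      using nn_integral_disc_power[of 1 "2 * n"] by (simp add: add.commute)
    finally show ?thesis by simp
  qed
  \<comment> \<open>The cross term when the monomial of degree n is added: it is orthogonal to each
    monomial of lower degree.\<close>
  have C: "(\<integral>z. ?w z *\<^sub>R (cnj (S n z) * (a n * z ^ n)) \<partial>lborel) = 0" for n
  proof -
    have "(\<integral>z. ?w z *\<^sub>R (cnj (S n z) * (a n * z ^ n)) \<partial>lborel) 
      = (\<integral>z. (\<Sum>k<n. (cnj (a k) * a n) * (?w z *\<^sub>R (z ^ n * cnj z ^ k))) \<partial>lborel)"
      by (intro Bochner_Integration.integral_cong)
        (auto simp: S_def sum_distrib_left sum_distrib_right scaleR_sum_right mult_ac scaleR_conv_of_real)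
    also have "\<dots> = (\<Sum>k<n. (\<integral>z. (cnj (a k) * a n) * (?w z *\<^sub>R (z ^ n * cnj z ^ k)) \<partial>lborel))"
      by (intro Bochner_Integration.integral_sum integrable_mult_right IC continuous_intros)
    also have "\<dots> = 0"
    proof (intro sum.neutral ballI)
      fix k assume "k \<in> {..<n}"
      then have "(\<integral>z. of_real ((\<lambda>t. indicator {..<1} t / t) (cmod z)) * (z ^ n * cnj z ^ k) \<partial>lborel) = 0"
        by (intro integral_radial_monomial) auto
      also have "(\<integral>z. of_real ((\<lambda>t. indicator {..<1} t / t) (cmod z)) * (z ^ n * cnj z ^ k) \<partial>lborel)
        = (\<integral>z. ?w z *\<^sub>R (z ^ n * cnj z ^ k) \<partial>lborel)"
        by (intro Bochner_Integration.integral_cong) (auto simp: indicator_def scaleR_conv_of_real)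
      finally show "(\<integral>z. (cnj (a k) * a n) * (?w z *\<^sub>R (z ^ n * cnj z ^ k)) \<partial>lborel) = 0"
        by (simp only: integral_mult_right_zero mult_zero_right)
    qed
    finally show ?thesis .
  qed
  have main: "(\<integral>z. ?w z *\<^sub>R (cmod (S n z))\<^sup>2 \<partial>lborel) = (\<Sum>k<n. (cmod (a k))\<^sup>2 * (2 * pi / (2 * k + 1)))" for n
  proof (induction n)
    case 0
    then show ?case by (simp add: S_def)
  next
    case (Suc n)
    have ex: "(cmod (S (Suc n) z))\<^sup>2 = (cmod (S n z))\<^sup>2 + 2 * Re (cnj (S n z) * (a n * z ^ n)) + (cmod (a n))\<^sup>2 * cmod z ^ (2 * n)" for z
    proof -
      have *: "(cmod (x + y))\<^sup>2 = (cmod x)\<^sup>2 + 2 * Re (cnj x * y) + (cmod y)\<^sup>2" for x y :: complex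
        unfolding cmod_power2 by (simp add: power2_eq_square algebra_simps)
      have "S (Suc n) z = S n z + a n * z ^ n" by (simp add: S_def)
      then show ?thesis using *[of "S n z" "a n * z ^ n"]
        by (simp add: norm_mult norm_power power_mult_distrib power_mult[symmetric] mult.commute)
    qed
    have alg: "w *\<^sub>R (A + 2 * Re X + c * d) = w *\<^sub>R A + 2 * Re (w *\<^sub>R X) + c * (w *\<^sub>R d)" 
      for w A c d :: real and X :: complex
      by (simp add: algebra_simps)
    have "(\<integral>z. ?w z *\<^sub>R (cmod (S (Suc n) z))\<^sup>2 \<partial>lborel) 
      = (\<integral>z. ?w z *\<^sub>R (cmod (S n z))\<^sup>2 + 2 * Re (?w z *\<^sub>R (cnj (S n z) * (a n * z ^ n))) + (cmod (a n))\<^sup>2 * (?w z *\<^sub>R cmod z ^ (2 * n)) \<partial>lborel)"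
      by (simp only: ex alg)
    also have "\<dots> = (\<integral>z. ?w z *\<^sub>R (cmod (S n z))\<^sup>2 \<partial>lborel) + 2 * Re (\<integral>z. ?w z *\<^sub>R (cnj (S n z) * (a n * z ^ n)) \<partial>lborel)
       + (cmod (a n))\<^sup>2 * (\<integral>z. ?w z *\<^sub>R cmod z ^ (2 * n) \<partial>lborel)"
    proof -
      have 1: "integrable lborel (\<lambda>z. ?w z *\<^sub>R (cmod (S n z))\<^sup>2)"
        by (intro I continuous_intros contS)
      have 2: "integrable lborel (\<lambda>z. ?w z *\<^sub>R (cnj (S n z) * (a n * z ^ n)))"
        by (intro IC continuous_intros contS)
      have 3: "integrable lborel (\<lambda>z. ?w z *\<^sub>R cmod z ^ (2 * n))"
        by (intro I continuous_intros)
      have 4: "integrable lborel (\<lambda>z. 2 * Re (?w z *\<^sub>R (cnj (S n z) * (a n * z ^ n))))"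
        by (intro integrable_mult_right integrable_Re 2)
      have 5: "integrable lborel (\<lambda>z. (cmod (a n))\<^sup>2 * (?w z *\<^sub>R cmod z ^ (2 * n)))"
        by (intro integrable_mult_right 3)
      have 6: "integrable lborel (\<lambda>z. ?w z *\<^sub>R (cmod (S n z))\<^sup>2 + 2 * Re (?w z *\<^sub>R (cnj (S n z) * (a n * z ^ n))))"
        by (rule Bochner_Integration.integrable_add[OF 1 4])
      show ?thesis
        unfolding Bochner_Integration.integral_add[OF 6 5] Bochner_Integration.integral_add[OF 1 4]
        by (simp only: integral_mult_right_zero integral_Re[OF 2])
    qed
    finally show ?case unfolding C M Suc.IH by simp
  qed
  have "(\<integral>\<^sup>+z. ennreal ((cmod (S n z))\<^sup>2 / cmod z) * indicator (ball 0 1) z \<partial>lborel) 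
     = (\<integral>\<^sup>+z. ennreal (?w z *\<^sub>R (cmod (S n z))\<^sup>2) \<partial>lborel)"
    by (intro nn_integral_cong) (auto simp: indicator_def)
  also have "\<dots> = ennreal (\<integral>z. ?w z *\<^sub>R (cmod (S n z))\<^sup>2 \<partial>lborel)"
    by (intro nn_integral_eq_integral I continuous_intros contS) auto
  also note main
  finally show ?thesis unfolding S_def .
qed

section \<open>The logarithmic potential\<close>

lemma integrable_continuous_compact_support:
  fixes k :: "complex \<Rightarrow> real"
  assumes "continuous_on UNIV k" and "\<And>z. B \<le> cmod z \<Longrightarrow> k z = 0"
  shows "integrable lborel k"
proof -
  have "integrable lborel (\<lambda>z. indicator (cball 0 B) z *\<^sub>R k z)"
    by (intro borel_integrable_compact) (auto intro: continuous_on_subset[OF assms(1)])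
  moreover have "(\<lambda>z. indicator (cball 0 B) z *\<^sub>R k z) = k"
    using assms(2) by (intro ext) (auto simp: indicator_def)
  ultimately show ?thesis by simp
qed

lemma bounded_continuous_compact_support:
  fixes k :: "complex \<Rightarrow> real"
  assumes "continuous_on UNIV k" and "\<And>z. B \<le> cmod z \<Longrightarrow> k z = 0"
  obtains C where "0 \<le> C" "\<And>z. \<bar>k z\<bar> \<le> C"
proof -
  have "bounded (k ` cball 0 B)"
    by (intro compact_imp_bounded compact_continuous_image) (auto intro: continuous_on_subset[OF assms(1)])
  then obtain C where C: "\<forall>z \<in> cball 0 B. norm (k z) \<le> C" 
    unfolding bounded_iff by blast
  have "\<bar>k z\<bar> \<le> max C 0" for z
    using bspec[OF C, of z] assms(2)[of z] by (cases "cmod z \<le> B") auto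
  then show thesis using that[of "max C 0"] by auto
qed

text \<open>The integral of k(z + t e) does not depend on t, so its derivative in t vanishes.\<close>

lemma integral_directional_derivative_eq_0:
  fixes k ke :: "complex \<Rightarrow> real" and e :: complex
  assumes der: "\<And>z. ((\<lambda>t. k (z + t *\<^sub>R e)) has_real_derivative ke z) (at 0)"
    and cont: "continuous_on UNIV k" "continuous_on UNIV ke"
    and supp: "\<And>z. B \<le> cmod z \<Longrightarrow> k z = 0" "\<And>z. B \<le> cmod z \<Longrightarrow> ke z = 0"
  shows "(\<integral>z. ke z \<partial>lborel) = 0"
proof -
  obtain C where C: "0 \<le> C" "\<And>z. \<bar>ke z\<bar> \<le> C"
    using bounded_continuous_compact_support[OF cont(2) supp(2)] by blast
  define R where "R = B + cmod e"
  have supp': "R \<le> cmod z \<Longrightarrow> \<bar>t\<bar> \<le> 1 \<Longrightarrow> B \<le> cmod (z + t *\<^sub>R e)" for z t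
  proof -
    assume "R \<le> cmod z" "\<bar>t\<bar> \<le> 1"
    moreover have "cmod z \<le> cmod (z + t *\<^sub>R e) + cmod (t *\<^sub>R e)"
      using norm_triangle_ineq4[of "z + t *\<^sub>R e" "t *\<^sub>R e"] by simp
    moreover have "cmod (t *\<^sub>R e) \<le> cmod e" using \<open>\<bar>t\<bar> \<le> 1\<close> by (simp add: mult_left_le_one_le)
    ultimately show ?thesis by (simp add: R_def)
  qed
  have der': "((\<lambda>s. k (z + s *\<^sub>R e)) has_derivative (\<lambda>h. h * ke (z + t *\<^sub>R e))) (at t)" for z t
  proof -
    have "((\<lambda>s. k ((z + t *\<^sub>R e) + s *\<^sub>R e)) has_real_derivative ke (z + t *\<^sub>R e)) (at 0)" by (rule der)
    then have "((\<lambda>s. (\<lambda>s. k (z + s *\<^sub>R e)) (s + t)) has_real_derivative ke (z + t *\<^sub>R e)) (at 0)"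
      by (simp add: algebra_simps)
    then have "((\<lambda>s. k (z + s *\<^sub>R e)) has_real_derivative ke (z + t *\<^sub>R e)) (at t)"
      by (subst (asm) DERIV_shift[symmetric]) simp
    then show ?thesis by (simp add: has_field_derivative_def mult.commute[of _ "ke _"])
  qed
  have inv: "(\<integral>z. k (z + t *\<^sub>R e) \<partial>lborel) = (\<integral>z. k z \<partial>lborel)" for t
  proof -
    have [measurable]: "k \<in> borel_measurable borel" using cont(1) by (rule borel_measurable_continuous_onI)
    have "(\<integral>z. k z \<partial>lborel) = (\<integral>z. k z \<partial>distr lborel borel ((+) (t *\<^sub>R e)))"
      by (simp add: lborel_distr_plus)
    also have "\<dots> = (\<integral>z. k (t *\<^sub>R e + z) \<partial>lborel)" by (rule integral_distr) measurable
    finally show ?thesis by (simp add: add.commute)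
  qed
  have "((\<lambda>t. \<integral>z. k (z + t *\<^sub>R e) \<partial>lborel) has_derivative (\<lambda>h. \<integral>z. h * ke (z + 0 *\<^sub>R e) \<partial>lborel)) (at (0::real))"
  proof (rule has_derivative_integral_parameter(2)[where S = "ball 0 1" and B = "\<lambda>z. C * indicator (cball 0 R) z"])
    show "((\<lambda>t. k (z + t *\<^sub>R e)) has_derivative (\<lambda>h. h * ke (z + t *\<^sub>R e))) (at t)" for z t by (rule der')
    show "norm (h * ke (z + t *\<^sub>R e)) \<le> C * indicator (cball 0 R) z * norm h" if "t \<in> ball 0 1" for t z and h :: real
    proof (cases "z \<in> cball 0 R")
      case True
      then show ?thesis using mult_left_mono[OF C(2)[of "z + t *\<^sub>R e"] abs_ge_zero[of h]] by (simp add: abs_mult mult.commute)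
    next
      case False
      then have "ke (z + t *\<^sub>R e) = 0" using that by (intro supp supp') auto
      then show ?thesis using False by simp
    qed
    show "integrable lborel (\<lambda>z. k (z + t *\<^sub>R e))" if "t \<in> ball 0 1" for t
      by (rule integrable_continuous_compact_support[where B = R])
        (use that in \<open>auto intro!: supp supp' continuous_on_compose2[OF cont(1)] continuous_intros\<close>)
    show "integrable lborel (\<lambda>z. C * indicator (cball 0 R) z :: real)"
      by (intro integrable_mult_right integrable_real_indicator) (auto simp: emeasure_bounded_finite[unfolded infinity_ennreal_def])
  qed auto
  then have "((\<lambda>t::real. \<integral>z. k z \<partial>lborel) has_derivative (\<lambda>h. \<integral>z. h * ke z \<partial>lborel)) (at 0)"
    by (simp add: inv)
  from has_derivative_unique[OF this has_derivative_const]
  have "(\<lambda>h::real. \<integral>z. h * ke z \<partial>lborel) = (\<lambda>h. 0)" .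
  from fun_cong[OF this, of 1] show ?thesis by simp
qed

text \<open>Two integrations by parts. Both \<open>Le * fe + L * fee\<close> and
  \<open>Lee * f + Le * fe\<close> are derivatives of products supported where f is, so both
  integrate to 0 and the common term cancels. \<open>L\<close> itself may grow at infinity, as a
  logarithm does.\<close>

lemma integral_second_directional_derivative_swap:
  fixes L Le Lee f fe fee :: "complex \<Rightarrow> real" and e :: complex
  assumes L: "\<And>z. ((\<lambda>t. L (z + t *\<^sub>R e)) has_real_derivative Le z) (at 0)"
      "\<And>z. ((\<lambda>t. Le (z + t *\<^sub>R e)) has_real_derivative Lee z) (at 0)"
    and Lcont: "continuous_on UNIV L" "continuous_on UNIV Le" "continuous_on UNIV Lee"
    and f: "\<And>z. ((\<lambda>t. f (z + t *\<^sub>R e)) has_real_derivative fe z) (at 0)"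
      "\<And>z. ((\<lambda>t. fe (z + t *\<^sub>R e)) has_real_derivative fee z) (at 0)"
    and fcont: "continuous_on UNIV f" "continuous_on UNIV fe" "continuous_on UNIV fee"
    and supp: "\<And>z. B \<le> cmod z \<Longrightarrow> f z = 0" "\<And>z. B \<le> cmod z \<Longrightarrow> fe z = 0" "\<And>z. B \<le> cmod z \<Longrightarrow> fee z = 0"
  shows "(\<integral>z. L z * fee z \<partial>lborel) = (\<integral>z. Lee z * f z \<partial>lborel)"
proof -
  have I: "integrable lborel (\<lambda>z. Le z * fe z)" "integrable lborel (\<lambda>z. L z * fee z)" "integrable lborel (\<lambda>z. Lee z * f z)"
    by (rule integrable_continuous_compact_support[where B = B],
        auto simp: supp intro!: continuous_intros Lcont fcont)+
  have "(\<integral>z. Le z * fe z + L z * fee z \<partial>lborel) = 0"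
  proof (rule integral_directional_derivative_eq_0[where e = e and B = B])
    fix z
    from DERIV_mult[OF L(1)[of z] f(2)[of z]] 
    show "((\<lambda>t. L (z + t *\<^sub>R e) * fe (z + t *\<^sub>R e)) has_real_derivative (Le z * fe z + L z * fee z)) (at 0)"
      by (simp add: mult.commute)
  qed (auto simp: supp intro!: continuous_intros Lcont fcont)
  moreover have "(\<integral>z. Lee z * f z + Le z * fe z \<partial>lborel) = 0"
  proof (rule integral_directional_derivative_eq_0[where e = e and B = B])
    fix z
    from DERIV_mult[OF L(2)[of z] f(1)[of z]] 
    show "((\<lambda>t. Le (z + t *\<^sub>R e) * f (z + t *\<^sub>R e)) has_real_derivative (Lee z * f z + Le z * fe z)) (at 0)"
      by (simp add: mult.commute)
  qed (auto simp: supp intro!: continuous_intros Lcont fcont)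
  ultimately show ?thesis using I by simp
qed

lemma lborel_integral_complex_scaling:
  fixes f :: "complex \<Rightarrow> real"
  assumes [measurable]: "f \<in> borel_measurable borel" and c: "0 < c"
  shows "(\<integral>z. f z \<partial>lborel) = c\<^sup>2 * (\<integral>z. f (c *\<^sub>R z) \<partial>lborel)"
proof -
  have "(\<integral>z. f z \<partial>lborel) = (\<integral>z. f z \<partial>density (distr lborel borel (\<lambda>x. 0 + c *\<^sub>R x)) (\<lambda>_. ennreal (c\<^sup>2)))"
    using lborel_affine[of c "0 :: complex"] c by (simp add: ennreal_power)
  also have "\<dots> = (\<integral>z. c\<^sup>2 * f z \<partial>distr lborel borel (\<lambda>x. 0 + c *\<^sub>R x))"
    by (subst integral_density) auto
  also have "\<dots> = (\<integral>z. c\<^sup>2 * f (c *\<^sub>R z) \<partial>lborel)"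
    by (subst integral_distr) auto
  finally show ?thesis by simp
qed

text \<open>Near 0 the bound is ln x \<le> x - 1 at x = 1/|z|; at 0 itself it relies on ln 0 = 0.
  The summand 1 in \<open>B\<^sup>2 + 1\<close> keeps the logarithm nonnegative for small B and
  later absorbs the square of a regularisation parameter at most 1.\<close>

lemma abs_ln_cmod_square_le:
  assumes "cmod z \<le> B"
  shows "\<bar>ln ((cmod z)\<^sup>2)\<bar> \<le> 2 * (indicator (ball 0 1) z / cmod z) + ln (B\<^sup>2 + 1)"
proof (cases "z = 0")
  case True
  then show ?thesis by simp
next
  case False
  show ?thesis
  proof (cases "cmod z < 1")
    case True
    have "ln (inverse (cmod z)) \<le> inverse (cmod z) - 1" using False by (intro ln_le_minus_one) simp
    then have "- 2 * ln (cmod z) \<le> 2 / cmod z" using False by (simp add: ln_inverse divide_inverse)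
    moreover have "\<bar>ln ((cmod z)\<^sup>2)\<bar> = - 2 * ln (cmod z)" using True False by (simp add: ln_realpow)
    moreover have "2 * (indicator (ball 0 1) z / cmod z) = 2 / cmod z" using True by simp
    moreover have "0 \<le> ln (B\<^sup>2 + 1)" by (rule ln_ge_zero) simp
    ultimately show ?thesis by linarith
  next
    case F: False
    have "(cmod z)\<^sup>2 \<le> B\<^sup>2" using assms by (simp add: power_mono)
    then have "(cmod z)\<^sup>2 \<le> B\<^sup>2 + 1" by linarith
    moreover have "0 < (cmod z)\<^sup>2" using False by simp
    ultimately have "ln ((cmod z)\<^sup>2) \<le> ln (B\<^sup>2 + 1)" by (intro ln_mono)
    moreover have "0 \<le> ln ((cmod z)\<^sup>2)" using F by (intro ln_ge_zero) simp
    ultimately show ?thesis using F by simp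
  qed
qed

text \<open>The majorant is exported together with the integrability claim because it also dominates
  the regularised logarithms in the limit below.\<close>

lemma integrable_log_mult:
  fixes h :: "complex \<Rightarrow> real"
  assumes [measurable]: "h \<in> borel_measurable borel" and bnd: "\<And>z. \<bar>h z\<bar> \<le> C" and supp: "\<And>z. B \<le> cmod z \<Longrightarrow> h z = 0"
  shows "integrable lborel (\<lambda>z. ln ((cmod z)\<^sup>2) * h z)"
    and "integrable lborel (\<lambda>z. C * (2 * (indicator (ball 0 1) z / cmod z) + ln (B\<^sup>2 + 1) * indicator (cball 0 B) z))"
proof -
  show int: "integrable lborel (\<lambda>z. C * (2 * (indicator (ball 0 1) z / cmod z) + ln (B\<^sup>2 + 1) * indicator (cball 0 B) z))"
    by (intro integrable_mult_right Bochner_Integration.integrable_add integrable_disc_inverse integrable_real_indicator)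
      (auto simp: emeasure_bounded_finite[unfolded infinity_ennreal_def])
  have C: "0 \<le> C" using bnd[of 0] by linarith
  show "integrable lborel (\<lambda>z. ln ((cmod z)\<^sup>2) * h z)"
  proof (rule Bochner_Integration.integrable_bound[OF int])
    show "AE z in lborel. norm (ln ((cmod z)\<^sup>2) * h z) \<le> norm (C * (2 * (indicator (ball 0 1) z / cmod z) + ln (B\<^sup>2 + 1) * indicator (cball 0 B) z))"
    proof (rule AE_I2)
      fix z
      show "norm (ln ((cmod z)\<^sup>2) * h z) \<le> norm (C * (2 * (indicator (ball 0 1) z / cmod z) + ln (B\<^sup>2 + 1) * indicator (cball 0 B) z))"
      proof (cases "cmod z \<le> B")
        case True
        have "\<bar>ln ((cmod z)\<^sup>2)\<bar> * \<bar>h z\<bar> \<le> (2 * (indicator (ball 0 1) z / cmod z) + ln (B\<^sup>2 + 1)) * C"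
          by (intro mult_mono abs_ln_cmod_square_le True bnd) (auto simp: add_nonneg_nonneg)
        then show ?thesis using True C by (simp add: abs_mult mult.commute)
      qed (simp add: supp)
    qed
  qed measurable
qed

text \<open>ln (|z|^2 + \<delta>^2) is smooth with Laplacian 4 \<delta>^2 / (|z|^2 + \<delta>^2)^2.
  Both derivatives are moved onto it, and scaling by \<delta> then leaves a kernel free of \<delta>,
  so that \<delta> survives only in the argument of f.\<close>

lemma integral_regularized_log_laplacian:
  fixes f fx fy fxx fyy :: "complex \<Rightarrow> real"
  assumes x: "\<And>z. ((\<lambda>t. f (z + t *\<^sub>R 1)) has_real_derivative fx z) (at 0)"
      "\<And>z. ((\<lambda>t. fx (z + t *\<^sub>R 1)) has_real_derivative fxx z) (at 0)"
    and y: "\<And>z. ((\<lambda>t. f (z + t *\<^sub>R \<i>)) has_real_derivative fy z) (at 0)"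
      "\<And>z. ((\<lambda>t. fy (z + t *\<^sub>R \<i>)) has_real_derivative fyy z) (at 0)"
    and cont: "continuous_on UNIV f" "continuous_on UNIV fx" "continuous_on UNIV fy" "continuous_on UNIV fxx" "continuous_on UNIV fyy"
    and supp: "\<And>z. B \<le> cmod z \<Longrightarrow> f z = 0" "\<And>z. B \<le> cmod z \<Longrightarrow> fx z = 0" "\<And>z. B \<le> cmod z \<Longrightarrow> fy z = 0"
       "\<And>z. B \<le> cmod z \<Longrightarrow> fxx z = 0" "\<And>z. B \<le> cmod z \<Longrightarrow> fyy z = 0"
    and d: "0 < \<delta>"
  shows "(\<integral>z. ln ((cmod z)\<^sup>2 + \<delta>\<^sup>2) * (fxx z + fyy z) \<partial>lborel) = (\<integral>z. 4 / (1 + (cmod z)\<^sup>2)\<^sup>2 * f (\<delta> *\<^sub>R z) \<partial>lborel)"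
proof -
  define q where "q = (\<lambda>z. (cmod z)\<^sup>2 + \<delta>\<^sup>2)"
  have q: "0 < q z" for z using d by (simp add: q_def add_nonneg_pos)
  hence q0: "q z \<noteq> 0" for z by (metis less_irrefl)
  have qcont: "continuous_on UNIV q" unfolding q_def by (intro continuous_intros)
  have qe: "((\<lambda>t. q (z + t *\<^sub>R 1)) has_real_derivative 2 * Re z) (at 0)" 
     "((\<lambda>t. q (z + t *\<^sub>R \<i>)) has_real_derivative 2 * Im z) (at 0)" for z
    unfolding q_def cmod_power2 by (auto intro!: derivative_eq_intros)
  have re: "((\<lambda>t. 2 * Re (z + t *\<^sub>R 1)) has_real_derivative 2) (at 0)" 
     "((\<lambda>t. 2 * Im (z + t *\<^sub>R \<i>)) has_real_derivative 2) (at 0)" for z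
    by (auto intro!: derivative_eq_intros)
  have L1: "((\<lambda>t. ln (q (z + t *\<^sub>R 1))) has_real_derivative 2 * Re z / q z) (at 0)"
    "((\<lambda>t. ln (q (z + t *\<^sub>R \<i>))) has_real_derivative 2 * Im z / q z) (at 0)" for z
    using DERIV_chain2[OF DERIV_ln_divide[OF q] qe(1)[of z]] DERIV_chain2[OF DERIV_ln_divide[OF q] qe(2)[of z]] 
    by simp_all
  have L2: "((\<lambda>t. 2 * Re (z + t *\<^sub>R 1) / q (z + t *\<^sub>R 1)) has_real_derivative (2 * q z - 2 * Re z * (2 * Re z)) / (q z * q z)) (at 0)"
    "((\<lambda>t. 2 * Im (z + t *\<^sub>R \<i>) / q (z + t *\<^sub>R \<i>)) has_real_derivative (2 * q z - 2 * Im z * (2 * Im z)) / (q z * q z)) (at 0)" for z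
    using DERIV_divide[OF re(1)[of z] qe(1)[of z] q0] DERIV_divide[OF re(2)[of z] qe(2)[of z] q0] by simp_all
  have contx: "continuous_on UNIV (\<lambda>z. ln (q z))" "continuous_on UNIV (\<lambda>z. 2 * Re z / q z)" "continuous_on UNIV (\<lambda>z. 2 * Im z / q z)"
     "continuous_on UNIV (\<lambda>z. (2 * q z - 2 * Re z * (2 * Re z)) / (q z * q z))" 
     "continuous_on UNIV (\<lambda>z. (2 * q z - 2 * Im z * (2 * Im z)) / (q z * q z))"
    by (intro continuous_intros qcont; simp add: q0)+
  have X: "(\<integral>z. ln (q z) * fxx z \<partial>lborel) = (\<integral>z. (2 * q z - 2 * Re z * (2 * Re z)) / (q z * q z) * f z \<partial>lborel)"
    by (rule integral_second_directional_derivative_swap[OF L1(1) L2(1) contx(1,2,4) x cont(1,2,4) supp(1,2,4)])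
  have Y: "(\<integral>z. ln (q z) * fyy z \<partial>lborel) = (\<integral>z. (2 * q z - 2 * Im z * (2 * Im z)) / (q z * q z) * f z \<partial>lborel)"
    by (rule integral_second_directional_derivative_swap[OF L1(2) L2(2) contx(1,3,5) y cont(1,3,5) supp(1,3,5)])
  have ints: "integrable lborel (\<lambda>z. ln (q z) * fxx z)" "integrable lborel (\<lambda>z. ln (q z) * fyy z)"
    "integrable lborel (\<lambda>z. (2 * q z - 2 * Re z * (2 * Re z)) / (q z * q z) * f z)"
    "integrable lborel (\<lambda>z. (2 * q z - 2 * Im z * (2 * Im z)) / (q z * q z) * f z)"
    by (rule integrable_continuous_compact_support[where B = B], 
       intro continuous_on_mult contx cont, simp add: supp)+
  have "(\<integral>z. ln (q z) * (fxx z + fyy z) \<partial>lborel) = (\<integral>z. ln (q z) * fxx z \<partial>lborel) + (\<integral>z. ln (q z) * fyy z \<partial>lborel)"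
    using ints by (simp add: distrib_left)
  also have "\<dots> = (\<integral>z. (2 * q z - 2 * Re z * (2 * Re z)) / (q z * q z) * f z + (2 * q z - 2 * Im z * (2 * Im z)) / (q z * q z) * f z \<partial>lborel)"
    unfolding X Y using ints by simp
  also have "\<dots> = (\<integral>z. 4 * \<delta>\<^sup>2 / (q z)\<^sup>2 * f z \<partial>lborel)"
  proof (rule Bochner_Integration.integral_cong)
    fix z
    have "(2 * q z - 2 * Re z * (2 * Re z)) + (2 * q z - 2 * Im z * (2 * Im z)) = 4 * \<delta>\<^sup>2"
      unfolding q_def cmod_power2 by (simp add: power2_eq_square)
    then show "(2 * q z - 2 * Re z * (2 * Re z)) / (q z * q z) * f z + (2 * q z - 2 * Im z * (2 * Im z)) / (q z * q z) * f z = 4 * \<delta>\<^sup>2 / (q z)\<^sup>2 * f z"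
      by (simp add: power2_eq_square distrib_right[symmetric] add_divide_distrib[symmetric] del: distrib_right)
  qed simp
  also have "\<dots> = \<delta>\<^sup>2 * (\<integral>z. 4 * \<delta>\<^sup>2 / (q (\<delta> *\<^sub>R z))\<^sup>2 * f (\<delta> *\<^sub>R z) \<partial>lborel)"
    using borel_measurable_continuous_onI[OF qcont] borel_measurable_continuous_onI[OF cont(1)] d
    by (intro lborel_integral_complex_scaling) auto
  also have "\<dots> = (\<integral>z. \<delta>\<^sup>2 * (4 * \<delta>\<^sup>2 / (q (\<delta> *\<^sub>R z))\<^sup>2 * f (\<delta> *\<^sub>R z)) \<partial>lborel)"
    by (rule integral_mult_right_zero[symmetric])
  also have "\<dots> = (\<integral>z. 4 / (1 + (cmod z)\<^sup>2)\<^sup>2 * f (\<delta> *\<^sub>R z) \<partial>lborel)"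
  proof (rule Bochner_Integration.integral_cong)
    fix z :: complex
    have "q (\<delta> *\<^sub>R z) = \<delta>\<^sup>2 * (1 + (cmod z)\<^sup>2)" by (simp add: q_def power_mult_distrib algebra_simps)
    moreover have "1 + (cmod z)\<^sup>2 \<noteq> 0" by (metis add_nonneg_pos less_irrefl zero_le_power2 zero_less_one add.commute)
    ultimately show "\<delta>\<^sup>2 * (4 * \<delta>\<^sup>2 / (q (\<delta> *\<^sub>R z))\<^sup>2 * f (\<delta> *\<^sub>R z)) = 4 / (1 + (cmod z)\<^sup>2)\<^sup>2 * f (\<delta> *\<^sub>R z)"
      using d by (simp add: power_mult_distrib power2_eq_square)
  qed simp
  finally show ?thesis by (simp add: q_def)
qed

text \<open>ln |z|^2 divided by 4 pi is the fundamental solution of the Laplacian. The regularised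
  identity passes to the limit \<delta> \<rightarrow> 0 on both sides by dominated
  convergence.\<close>

lemma integral_log_laplacian:
  fixes f fx fy fxx fyy :: "complex \<Rightarrow> real"
  assumes x: "\<And>z. ((\<lambda>t. f (z + t *\<^sub>R 1)) has_real_derivative fx z) (at 0)"
      "\<And>z. ((\<lambda>t. fx (z + t *\<^sub>R 1)) has_real_derivative fxx z) (at 0)"
    and y: "\<And>z. ((\<lambda>t. f (z + t *\<^sub>R \<i>)) has_real_derivative fy z) (at 0)"
      "\<And>z. ((\<lambda>t. fy (z + t *\<^sub>R \<i>)) has_real_derivative fyy z) (at 0)"
    and cont: "continuous_on UNIV f" "continuous_on UNIV fx" "continuous_on UNIV fy" "continuous_on UNIV fxx" "continuous_on UNIV fyy"
    and supp: "\<And>z. B \<le> cmod z \<Longrightarrow> f z = 0" "\<And>z. B \<le> cmod z \<Longrightarrow> fx z = 0" "\<And>z. B \<le> cmod z \<Longrightarrow> fy z = 0"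
       "\<And>z. B \<le> cmod z \<Longrightarrow> fxx z = 0" "\<And>z. B \<le> cmod z \<Longrightarrow> fyy z = 0"
  shows "(\<integral>z. ln ((cmod z)\<^sup>2) * (fxx z + fyy z) \<partial>lborel) = 4 * pi * f 0"
proof -
  define \<delta> where "\<delta> = (\<lambda>n. inverse (real (Suc n)))"
  have \<delta>: "0 < \<delta> n" "\<delta> n \<le> 1" for n by (auto simp: \<delta>_def field_simps)
  have \<delta>0: "\<delta> \<longlonglongrightarrow> 0" unfolding \<delta>_def by (rule LIMSEQ_inverse_real_of_nat)
  define h where "h = (\<lambda>z. fxx z + fyy z)"
  have hc: "continuous_on UNIV h" unfolding h_def by (intro continuous_intros cont)
  have hs: "h z = 0" if "B \<le> cmod z" for z using that by (simp add: h_def supp)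
  obtain C where C: "0 \<le> C" "\<And>z. \<bar>h z\<bar> \<le> C"
    using bounded_continuous_compact_support[OF hc hs] by blast
  obtain C' where C': "0 \<le> C'" "\<And>z. \<bar>f z\<bar> \<le> C'"
    using bounded_continuous_compact_support[OF cont(1) supp(1)] by blast
  have [measurable]: "h \<in> borel_measurable borel" "f \<in> borel_measurable borel"
    using hc cont(1) by (auto intro: borel_measurable_continuous_onI)
  have eq: "(\<integral>z. ln ((cmod z)\<^sup>2 + (\<delta> n)\<^sup>2) * h z \<partial>lborel) = (\<integral>z. 4 / (1 + (cmod z)\<^sup>2)\<^sup>2 * f (\<delta> n *\<^sub>R z) \<partial>lborel)" for n
    unfolding h_def by (rule integral_regularized_log_laplacian[OF x y cont supp \<delta>(1)])
  have l1: "(\<lambda>n. \<integral>z. ln ((cmod z)\<^sup>2 + (\<delta> n)\<^sup>2) * h z \<partial>lborel) \<longlonglongrightarrow> (\<integral>z. ln ((cmod z)\<^sup>2) * h z \<partial>lborel)"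
  proof (rule integral_dominated_convergence)
    let ?w = "\<lambda>z. C * (2 * (indicator (ball 0 1) z / cmod z) + ln (B\<^sup>2 + 1) * indicator (cball 0 B) z)"
    show "integrable lborel (\<lambda>z. 2 * ?w z)"
      by (rule integrable_mult_right) (rule integrable_log_mult(2)[of h C B], use C hs in auto)
    show "AE z in lborel. (\<lambda>n. ln ((cmod z)\<^sup>2 + (\<delta> n)\<^sup>2) * h z) \<longlonglongrightarrow> ln ((cmod z)\<^sup>2) * h z"
      using AE_lborel_singleton[of 0]
    proof eventually_elim
      case (elim z)
      have "(\<lambda>n. ln ((cmod z)\<^sup>2 + (\<delta> n)\<^sup>2) * h z) \<longlonglongrightarrow> ln ((cmod z)\<^sup>2 + 0\<^sup>2) * h z"
        using elim by (intro tendsto_intros \<delta>0) auto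
      then show ?case by simp
    qed
    show "AE z in lborel. norm (ln ((cmod z)\<^sup>2 + (\<delta> n)\<^sup>2) * h z) \<le> 2 * ?w z" for n
      using AE_lborel_singleton[of 0]
    proof eventually_elim
      case (elim z)
      show ?case
      proof (cases "cmod z \<le> B")
        case True
        have d2: "(\<delta> n)\<^sup>2 \<le> 1" "0 < (\<delta> n)\<^sup>2" using \<delta>[of n] by (auto simp: power_le_one)
        have z: "0 < (cmod z)\<^sup>2" "(cmod z)\<^sup>2 \<le> B\<^sup>2" using elim True by (auto simp: power_mono)
        have "ln ((cmod z)\<^sup>2) \<le> ln ((cmod z)\<^sup>2 + (\<delta> n)\<^sup>2)" "ln ((cmod z)\<^sup>2 + (\<delta> n)\<^sup>2) \<le> ln (B\<^sup>2 + 1)"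
          using z d2 by (intro ln_mono; linarith)+
        moreover note abs_ln_cmod_square_le[OF True]
        moreover have "0 \<le> ln (B\<^sup>2 + 1)" by simp
        moreover have "0 \<le> indicator (ball 0 1) z / cmod z" by simp
        \<comment> \<open>The regularised logarithm u lies between v = ln |z|^2 and y = ln (B^2 +
          1). Bounding it by the moduli of both ends accounts for the factor 2 in the
          majorant.\<close>
        moreover have "\<bar>u\<bar> \<le> 2 * (2 * x + y)" if "v \<le> u" "u \<le> y" "\<bar>v\<bar> \<le> 2 * x + y" "0 \<le> y" "0 \<le> x" for u v x y :: real
          using that by argo
        ultimately have "\<bar>ln ((cmod z)\<^sup>2 + (\<delta> n)\<^sup>2)\<bar> \<le> 2 * (2 * (indicator (ball 0 1) z / cmod z) + ln (B\<^sup>2 + 1))"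
          by blast
        then have "\<bar>ln ((cmod z)\<^sup>2 + (\<delta> n)\<^sup>2)\<bar> * \<bar>h z\<bar> \<le> (2 * (2 * (indicator (ball 0 1) z / cmod z) + ln (B\<^sup>2 + 1))) * C"
          by (intro mult_mono C) (auto simp: add_nonneg_nonneg)
        then show ?thesis using True by (simp add: abs_mult mult_ac)
      qed (use hs C in auto)
    qed
  qed measurable
  have I1: "has_bochner_integral lborel (\<lambda>z. 1 / (1 + (cmod z)\<^sup>2)\<^sup>2) pi"
    using nn_integral_inverse_square_one_plus by (intro has_bochner_integral_nn_integral) auto
  \<comment> \<open>The kernel is now fixed and integrable, f is bounded, and the argument of f
    shrinks to the origin.\<close>
  have l2: "(\<lambda>n. \<integral>z. 4 / (1 + (cmod z)\<^sup>2)\<^sup>2 * f (\<delta> n *\<^sub>R z) \<partial>lborel) \<longlonglongrightarrow> (\<integral>z. 4 / (1 + (cmod z)\<^sup>2)\<^sup>2 * f 0 \<partial>lborel)"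
  proof (rule integral_dominated_convergence)
    show "integrable lborel (\<lambda>z. (4 * C') * (1 / (1 + (cmod z)\<^sup>2)\<^sup>2))"
      using I1 by (intro integrable_mult_right) (simp add: has_bochner_integral_iff)
    show "AE z in lborel. (\<lambda>n. 4 / (1 + (cmod z)\<^sup>2)\<^sup>2 * f (\<delta> n *\<^sub>R z)) \<longlonglongrightarrow> 4 / (1 + (cmod z)\<^sup>2)\<^sup>2 * f 0"
    proof (rule AE_I2)
      fix z :: complex
      have "(\<lambda>n. \<delta> n *\<^sub>R z) \<longlonglongrightarrow> 0 *\<^sub>R z" by (intro tendsto_intros \<delta>0)
      then have "(\<lambda>n. f (\<delta> n *\<^sub>R z)) \<longlonglongrightarrow> f 0"
        using isCont_tendsto_compose[of "0 *\<^sub>R z" f "\<lambda>n. \<delta> n *\<^sub>R z"] cont(1)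
        by (simp add: continuous_on_eq_continuous_at)
      then show "(\<lambda>n. 4 / (1 + (cmod z)\<^sup>2)\<^sup>2 * f (\<delta> n *\<^sub>R z)) \<longlonglongrightarrow> 4 / (1 + (cmod z)\<^sup>2)\<^sup>2 * f 0"
        by (rule tendsto_mult[OF tendsto_const])
    qed
    show "AE z in lborel. norm (4 / (1 + (cmod z)\<^sup>2)\<^sup>2 * f (\<delta> n *\<^sub>R z)) \<le> (4 * C') * (1 / (1 + (cmod z)\<^sup>2)\<^sup>2)" for n
    proof (rule AE_I2)
      fix z :: complex
      have "4 / (1 + (cmod z)\<^sup>2)\<^sup>2 * \<bar>f (\<delta> n *\<^sub>R z)\<bar> \<le> 4 / (1 + (cmod z)\<^sup>2)\<^sup>2 * C'"
        by (intro mult_left_mono C') auto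
      then show "norm (4 / (1 + (cmod z)\<^sup>2)\<^sup>2 * f (\<delta> n *\<^sub>R z)) \<le> (4 * C') * (1 / (1 + (cmod z)\<^sup>2)\<^sup>2)"
        by (simp add: abs_mult mult.commute)
    qed
  qed measurable
  have "(\<integral>z. 4 / (1 + (cmod z)\<^sup>2)\<^sup>2 * f 0 \<partial>lborel) = (\<integral>z. (4 * f 0) * (1 / (1 + (cmod z)\<^sup>2)\<^sup>2) \<partial>lborel)"
    by (simp add: mult.commute)
  also have "\<dots> = (4 * f 0) * pi"
    using I1 by (subst integral_mult_right_zero) (simp add: has_bochner_integral_iff)
  finally have "(\<integral>z. 4 / (1 + (cmod z)\<^sup>2)\<^sup>2 * f 0 \<partial>lborel) = 4 * pi * f 0" by simp
  with LIMSEQ_unique[OF l1[unfolded eq] l2] show ?thesis by (simp add: h_def)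
qed

section \<open>The extremal estimate for a point mass\<close>

text \<open>The coefficients 2k + 1 are reciprocal, up to 2 pi, to the squared norms of the
  monomials. The squared norm is therefore 2 pi times the same series evaluated at |q|^2, as befits
  a reproducing kernel on the diagonal.\<close>

lemma nn_integral_disc_series:
  assumes q: "cmod q < 1"
  shows "(\<integral>\<^sup>+w. ennreal ((cmod ((1 + q * w) / (1 - q * w)\<^sup>2))\<^sup>2 / cmod w) * indicator (ball 0 1) w \<partial>lborel)
    \<le> ennreal (2 * pi * (1 + (cmod q)\<^sup>2) / (1 - (cmod q)\<^sup>2)\<^sup>2)"
proof -
  have series: "(\<lambda>k. of_nat (2 * k + 1) * y ^ k) sums ((1 + y) / (1 - y)\<^sup>2)" if "norm y < 1" 
    for y :: "'a::{real_normed_field,banach}"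
  proof -
    have y: "1 - y \<noteq> 0" using that by auto
    \<comment> \<open>2k + 1 = 2 (k + 1) - 1: twice the differentiated geometric series minus the
      geometric series.\<close>
    have "(\<lambda>k. 2 * (of_nat (Suc k) * y ^ k) - y ^ k) sums (2 * (1 / (1 - y)\<^sup>2) - 1 / (1 - y))"
      by (intro sums_diff sums_mult geometric_deriv_sums geometric_sums that)
    moreover have "2 * (1 / (1 - y)\<^sup>2) - 1 / (1 - y) = (1 + y) / (1 - y)\<^sup>2"
      using y by (simp add: divide_simps) (simp add: power2_eq_square algebra_simps)
    ultimately show ?thesis by (simp add: algebra_simps)
  qed
  have [measurable]: "ball (0::complex) 1 \<in> sets borel" by simp
  define a where "a = (\<lambda>k. of_nat (2 * k + 1) * q ^ k)"
  let ?u = "\<lambda>n w. ennreal ((cmod (\<Sum>k<n. a k * w ^ k))\<^sup>2 / cmod w) * indicator (ball 0 1) w"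
  have "(\<integral>\<^sup>+w. ennreal ((cmod ((1 + q * w) / (1 - q * w)\<^sup>2))\<^sup>2 / cmod w) * indicator (ball 0 1) w \<partial>lborel)
     = (\<integral>\<^sup>+w. liminf (\<lambda>n. ?u n w) \<partial>lborel)"
  proof (rule nn_integral_cong)
    fix w :: complex
    show "ennreal ((cmod ((1 + q * w) / (1 - q * w)\<^sup>2))\<^sup>2 / cmod w) * indicator (ball 0 1) w = liminf (\<lambda>n. ?u n w)"
    proof (cases "w \<in> ball 0 1")
      case True
      then have "cmod (q * w) < 1"
        using q by (simp add: norm_mult) (metis mult_strict_mono' norm_ge_zero mult_1_right)
      from series[OF this] have "(\<lambda>n. \<Sum>k<n. a k * w ^ k) \<longlonglongrightarrow> (1 + q * w) / (1 - q * w)\<^sup>2"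
        unfolding sums_def a_def by (simp add: power_mult_distrib mult_ac)
      then have "(\<lambda>n. ?u n w) \<longlonglongrightarrow> ennreal ((cmod ((1 + q * w) / (1 - q * w)\<^sup>2))\<^sup>2 / cmod w) * indicator (ball 0 1) w"
        using True by (cases "w = 0") (auto intro!: tendsto_ennrealI tendsto_intros)
      then show ?thesis by (simp add: lim_imp_Liminf)
    qed (simp add: Liminf_const)
  qed
  \<comment> \<open>Fatou's lemma, applied to the partial sums of the power series.\<close>
  also have "\<dots> \<le> liminf (\<lambda>n. \<integral>\<^sup>+w. ?u n w \<partial>lborel)"
    by (rule nn_integral_liminf) measurable
  also have "\<dots> \<le> liminf (\<lambda>n::nat. ennreal (2 * pi * (1 + (cmod q)\<^sup>2) / (1 - (cmod q)\<^sup>2)\<^sup>2))"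
  proof (intro Liminf_mono always_eventually allI)
    fix n
    have q2: "norm ((cmod q)\<^sup>2) < 1" using q by (simp add: power_less_one_iff abs_square_less_1)
    have "(\<Sum>k<n. (cmod (a k))\<^sup>2 * (2 * pi / (2 * k + 1))) = 2 * pi * (\<Sum>k<n. of_nat (2 * k + 1) * ((cmod q)\<^sup>2) ^ k)"
      unfolding sum_distrib_left
    proof (rule sum.cong)
      fix k
      have "cmod (a k) = (2 * real k + 1) * cmod q ^ k"
        unfolding a_def norm_mult norm_power norm_of_nat by simp
      moreover have "(x * y)\<^sup>2 * (2 * pi / x) = 2 * pi * (x * y\<^sup>2)" if "x \<noteq> 0" for x y :: real
        using that by (simp add: power2_eq_square)
      moreover have "((cmod q)\<^sup>2) ^ k = (cmod q ^ k)\<^sup>2" by (simp add: power_mult[symmetric] mult.commute)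
      moreover have "real (2 * k + 1) = 2 * real k + 1" "2 * real k + 1 \<noteq> 0" by auto
      ultimately show "(cmod (a k))\<^sup>2 * (2 * pi / (2 * k + 1)) = 2 * pi * (of_nat (2 * k + 1) * ((cmod q)\<^sup>2) ^ k)"
        by metis
    qed simp
    also have "(\<Sum>k<n. of_nat (2 * k + 1) * ((cmod q)\<^sup>2) ^ k) \<le> (1 + (cmod q)\<^sup>2) / (1 - (cmod q)\<^sup>2)\<^sup>2"
      using sum_le_suminf[OF sums_summable[OF series[OF q2]], of "{..<n}"] sums_unique[OF series[OF q2]]
      by simp
    finally show "(\<integral>\<^sup>+w. ?u n w \<partial>lborel) \<le> ennreal (2 * pi * (1 + (cmod q)\<^sup>2) / (1 - (cmod q)\<^sup>2)\<^sup>2)"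
      unfolding nn_integral_disc_polynomial by (simp add: ennreal_leI)
  qed
  finally show ?thesis by (simp add: Liminf_const)
qed

text \<open>For the pole (1/2) log |b|^2 of the weight, |f|^2 exp(-weight), normalised to be 1 at the
  centre, where f is its extremal function.\<close>

definition disc_kernel :: "complex \<Rightarrow> complex \<Rightarrow> real" where
  "disc_kernel \<zeta> z = (cmod (1 - 2 * cnj \<zeta> * z / (1 + of_real ((cmod \<zeta>)\<^sup>2))))\<^sup>2 * cmod \<zeta>
     / (cmod (1 - cnj \<zeta> * z) * cmod (z - \<zeta>))"

text \<open>The Moebius map sending 0 to zeta turns the kernel into a constant times |h|^2 / |w| with
  h = (1 + y) / (1 - y)^2 = sum (2k + 1) y^k and y = - cnj(zeta) w.\<close>

lemma nn_integral_disc_kernel_le: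
  assumes \<zeta>: "\<zeta> \<noteq> 0" "cmod \<zeta> < 1"
  shows "(\<integral>\<^sup>+z. ennreal (disc_kernel \<zeta> z) * indicator (ball 0 1) z \<partial>lborel) \<le> ennreal pi"
proof -
  define s where "s = (cmod \<zeta>)\<^sup>2"
  have s: "0 < s" "s < 1" using \<zeta> by (auto simp: s_def power_less_one_iff abs_square_less_1)
  have sc: "of_real s = cnj \<zeta> * \<zeta>" "1 + cnj \<zeta> * \<zeta> \<noteq> 0"
  proof -
    show "of_real s = cnj \<zeta> * \<zeta>" unfolding s_def complex_norm_square by (simp add: mult.commute)
    then have "1 + cnj \<zeta> * \<zeta> = of_real (1 + s)" by simp
    then show "1 + cnj \<zeta> * \<zeta> \<noteq> 0" using s by (metis add_pos_pos less_irrefl of_real_eq_0_iff zero_less_one)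
  qed
  have [measurable]: "ball (0::complex) 1 \<in> sets borel" by simp
  \<comment> \<open>This map sends 0 to the pole \<zeta> and -\<zeta> to the centre 0. The function
    h is thus the reproducing kernel at -\<zeta>, which is proportional to the function of least
    norm with prescribed value there.\<close>
  define g where "g = Moebius_function 0 (- \<zeta>)"
  have g: "g w = (w + \<zeta>) / (1 + cnj \<zeta> * w)" for w by (simp add: g_def Moebius_function_def)
  define g' where "g' = (\<lambda>w. of_real (1 - s) / (1 + cnj \<zeta> * w)\<^sup>2)"
  have nz: "1 + cnj \<zeta> * w \<noteq> 0" if "w \<in> ball 0 1" for w
  proof
    assume "1 + cnj \<zeta> * w = 0"
    then have "cmod (cnj \<zeta> * w) = 1" by (metis add.commute add_eq_0_iff norm_minus_cancel norm_one)
    moreover have "cmod (cnj \<zeta> * w) < 1"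
      using \<zeta> that by (simp add: norm_mult) (metis mult_strict_mono' norm_ge_zero mult_1_right)
    ultimately show False by simp
  qed
  have im: "g ` ball 0 1 = ball 0 1"
  proof (intro equalityI subsetI)
    fix z assume "z \<in> g ` ball 0 1"
    then show "z \<in> ball 0 1" using \<zeta> by (auto simp: g_def intro!: Moebius_function_norm_lt_1)
  next
    fix z :: complex assume z: "z \<in> ball 0 1"
    have "z = g (Moebius_function 0 \<zeta> z)" unfolding g_def
      using z \<zeta> by (subst Moebius_function_compose) auto
    moreover have "Moebius_function 0 \<zeta> z \<in> ball 0 1"
      using z \<zeta> by (auto intro!: Moebius_function_norm_lt_1)
    ultimately show "z \<in> g ` ball 0 1" by (rule image_eqI)
  qed
  have inj: "inj_on g (ball 0 1)"
  proof (rule inj_on_inverseI)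
    fix z :: complex assume z: "z \<in> ball 0 1"
    then show "Moebius_function 0 \<zeta> (g z) = z" unfolding g_def
      using \<zeta> by (subst Moebius_function_compose) auto
  qed
  have der: "(g has_field_derivative g' w) (at w)" if "w \<in> ball 0 1" for w
  proof -
    have "((\<lambda>w. (w + \<zeta>) / (1 + cnj \<zeta> * w)) has_field_derivative 
        (1 * (1 + cnj \<zeta> * w) - (w + \<zeta>) * cnj \<zeta>) / ((1 + cnj \<zeta> * w) * (1 + cnj \<zeta> * w))) (at w)"
      by (rule DERIV_divide) (use nz[OF that] in \<open>auto intro!: derivative_eq_intros\<close>)
    moreover have "(1 * (1 + cnj \<zeta> * w) - (w + \<zeta>) * cnj \<zeta>) / ((1 + cnj \<zeta> * w) * (1 + cnj \<zeta> * w)) = g' w"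
      by (simp add: g'_def sc power2_eq_square algebra_simps)
    moreover have "g = (\<lambda>w. (w + \<zeta>) / (1 + cnj \<zeta> * w))" by (rule ext) (rule g)
    ultimately show ?thesis by simp
  qed
  define C where "C = cmod \<zeta> * (1 - s)\<^sup>2 / (1 + s)\<^sup>2"
  have C0: "0 \<le> C" by (simp add: C_def)
  let ?h = "\<lambda>w. (cmod ((1 + (- cnj \<zeta>) * w) / (1 - (- cnj \<zeta>) * w)\<^sup>2))\<^sup>2 / cmod w"
  have key: "(cmod (g' w))\<^sup>2 * disc_kernel \<zeta> (g w) = C * ?h w" if w: "w \<in> ball 0 1" for w
  proof -
    let ?D = "1 + cnj \<zeta> * w"
    note D = nz[OF w]
    have 1: "1 - cnj \<zeta> * g w = of_real (1 - s) / ?D"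
      using D by (simp add: g divide_simps sc) (simp add: algebra_simps)
    have 2: "g w - \<zeta> = of_real (1 - s) * w / ?D"
      using D by (simp add: g divide_simps sc) (simp add: algebra_simps)
    have 3: "1 - 2 * cnj \<zeta> * g w / (1 + of_real ((cmod \<zeta>)\<^sup>2)) = of_real (1 - s) * (1 - cnj \<zeta> * w) / (of_real (1 + s) * ?D)"
      using D sc(2) unfolding s_def[symmetric] by (simp add: g divide_simps sc) (simp add: algebra_simps)
    define d where "d = cmod ?D"
    have d: "d > 0" using D by (simp add: d_def)
    have "cmod (g' w) = (1 - s) / d\<^sup>2"
      unfolding g'_def norm_divide norm_power d_def[symmetric] norm_of_real using s by simp
    moreover have "disc_kernel \<zeta> (g w) = ((1 - s) * cmod (1 - cnj \<zeta> * w) / ((1 + s) * d))\<^sup>2 * cmod \<zeta> / ((1 - s) / d * ((1 - s) * cmod w / d))"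
      unfolding disc_kernel_def 1 2 3 norm_divide norm_mult d_def[symmetric] norm_of_real using s by simp
    moreover have "?h w = (cmod (1 - cnj \<zeta> * w) / d\<^sup>2)\<^sup>2 / cmod w"
      by (simp add: norm_divide norm_power d_def)
    moreover have "(\<sigma> / d\<^sup>2)\<^sup>2 * ((\<sigma> * x / (\<tau> * d))\<^sup>2 * y / (\<sigma> / d * (\<sigma> * v / d)))
       = (y * \<sigma>\<^sup>2 / \<tau>\<^sup>2) * ((x / d\<^sup>2)\<^sup>2 / v)" if "\<sigma> \<noteq> 0" "\<tau> \<noteq> 0" for x y v \<sigma> \<tau> :: real
      using that d by (cases "v = 0") (simp_all add: field_simps power2_eq_square)
    moreover have "1 - s \<noteq> 0" "1 + s \<noteq> 0" using s by auto
    ultimately show ?thesis unfolding C_def by metis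
  qed
  let ?L = "\<integral>\<^sup>+w. ennreal ((cmod (g' w))\<^sup>2 * disc_kernel \<zeta> (g w)) * indicator (ball 0 1) w \<partial>lborel"
  have "?L = (\<integral>\<^sup>+w. ennreal C * (ennreal (?h w) * indicator (ball 0 1) w) \<partial>lborel)"
  proof (rule nn_integral_cong)
    fix w :: complex
    show "ennreal ((cmod (g' w))\<^sup>2 * disc_kernel \<zeta> (g w)) * indicator (ball 0 1) w = ennreal C * (ennreal (?h w) * indicator (ball 0 1) w)"
    proof (cases "w \<in> ball 0 1")
      case True
      then show ?thesis unfolding key[OF True] ennreal_mult'[OF C0] by simp
    qed simp
  qed
  also have "\<dots> = ennreal C * (\<integral>\<^sup>+w. ennreal (?h w) * indicator (ball 0 1) w \<partial>lborel)"
    by (rule nn_integral_cmult) measurable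
  also have "\<dots> \<le> ennreal C * ennreal (2 * pi * (1 + (cmod (- cnj \<zeta>))\<^sup>2) / (1 - (cmod (- cnj \<zeta>))\<^sup>2)\<^sup>2)"
    using \<zeta> by (intro mult_left_mono nn_integral_disc_series) auto
  also have "\<dots> = ennreal (C * (2 * pi * (1 + s) / (1 - s)\<^sup>2))"
    using C0 s by (simp add: s_def ennreal_mult'[symmetric])
  also have "C * (2 * pi * (1 + s) / (1 - s)\<^sup>2) = pi * (2 * cmod \<zeta> / (1 + s))"
  proof -
    have "a * \<sigma>\<^sup>2 / \<tau>\<^sup>2 * (2 * pi * \<tau> / \<sigma>\<^sup>2) = pi * (2 * a / \<tau>)" if "\<sigma> \<noteq> 0" "\<tau> \<noteq> 0" for a \<sigma> \<tau> :: real
      using that by (simp add: field_simps power2_eq_square)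
    moreover have "1 - s \<noteq> 0" "1 + s \<noteq> 0" using s by auto
    ultimately show ?thesis unfolding C_def by blast
  qed
  \<comment> \<open>Arithmetic-geometric mean inequality. The slack vanishes as \<zeta> approaches
    the unit circle, so pi is the best constant uniform in the pole.\<close>
  also have "ennreal (pi * (2 * cmod \<zeta> / (1 + s))) \<le> ennreal pi"
  proof (rule ennreal_leI)
    have "0 \<le> (1 - cmod \<zeta>)\<^sup>2" by simp
    then have "2 * cmod \<zeta> \<le> 1 + s" by (simp add: s_def power2_eq_square algebra_simps)
    then have "2 * cmod \<zeta> / (1 + s) \<le> 1" using s by simp
    from mult_left_mono[OF this pi_ge_zero] show "pi * (2 * cmod \<zeta> / (1 + s)) \<le> pi"
      by (simp only: mult_1_right)
  qed
  finally have L: "?L \<le> ennreal pi" .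
  then have "?L < \<infinity>" using ennreal_less_top infinity_ennreal_def order_le_less_trans by metis
  then have b: "?L = ennreal (enn2real ?L)" by simp
  have "(\<integral>\<^sup>+z. ennreal (disc_kernel \<zeta> z) * indicator (g ` ball 0 1) z \<partial>lborel) = ennreal (enn2real ?L)"
  proof (rule nn_integral_holomorphic_change_of_variables[OF _ _ inj der _ _ _ b])
    show "continuous_on (ball 0 1) g'"
      unfolding g'_def using nz by (intro continuous_intros) auto
    show "disc_kernel \<zeta> \<in> borel_measurable borel" unfolding disc_kernel_def by measurable
  qed (auto simp: im disc_kernel_def)
  then show ?thesis using L b unfolding im by simp
qed

section \<open>Subharmonic weights on the unit disc\<close>

text \<open>Since |\<alpha>| \<le> 1, the factor 1 - \<alpha> z stays in the right half-plane for
  |z| < 1, where the principal logarithm is holomorphic. Exponentials of these averages are the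
  zero-free competitors.\<close>

lemma holomorphic_integral_Ln:
  fixes \<kappa> :: "complex \<Rightarrow> real" and \<alpha> :: "complex \<Rightarrow> complex"
  assumes \<kappa>: "integrable lborel \<kappa>" and [measurable]: "\<alpha> \<in> borel_measurable borel" and \<alpha>: "\<And>\<zeta>. cmod (\<alpha> \<zeta>) \<le> 1"
  shows "(\<lambda>z. \<integral>\<zeta>. \<kappa> \<zeta> *\<^sub>R Ln (1 - \<alpha> \<zeta> * z) \<partial>lborel) holomorphic_on ball 0 1"
    and "\<And>z. cmod z < 1 \<Longrightarrow> integrable lborel (\<lambda>\<zeta>. \<kappa> \<zeta> *\<^sub>R Ln (1 - \<alpha> \<zeta> * z))"
proof -
  have [measurable]: "\<kappa> \<in> borel_measurable borel" using \<kappa> by simp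
  have az: "cmod (\<alpha> \<zeta> * z) \<le> cmod z" for \<zeta> z
    using \<alpha>[of \<zeta>] by (simp add: norm_mult mult_left_le_one_le)
  have nn: "1 - w \<notin> \<real>\<^sub>\<le>\<^sub>0" if "cmod w < 1" for w
  proof
    assume "1 - w \<in> \<real>\<^sub>\<le>\<^sub>0"
    then have "Re w \<ge> 1" by (auto simp: complex_nonpos_Reals_iff)
    then show False using complex_Re_le_cmod[of w] that by linarith
  qed
  show int: "integrable lborel (\<lambda>\<zeta>. \<kappa> \<zeta> *\<^sub>R Ln (1 - \<alpha> \<zeta> * z))" if z: "cmod z < 1" for z
  proof -
    have "bounded ((\<lambda>w. Ln (1 - w)) ` cball 0 (cmod z))"
      by (intro compact_imp_bounded compact_continuous_image continuous_intros) (use z nn in auto)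
    then obtain K where K: "\<forall>w \<in> cball 0 (cmod z). norm (Ln (1 - w)) \<le> K" 
      unfolding bounded_iff by blast
    show ?thesis
    proof (rule Bochner_Integration.integrable_bound)
      show "integrable lborel (\<lambda>\<zeta>. K * \<bar>\<kappa> \<zeta>\<bar>)" using \<kappa> by simp
      show "AE \<zeta> in lborel. norm (\<kappa> \<zeta> *\<^sub>R Ln (1 - \<alpha> \<zeta> * z)) \<le> norm (K * \<bar>\<kappa> \<zeta>\<bar>)"
      proof (rule AE_I2)
        fix \<zeta>
        have "norm (Ln (1 - \<alpha> \<zeta> * z)) \<le> K" using K az[of \<zeta> z] by simp
        then have "norm (Ln (1 - \<alpha> \<zeta> * z)) * \<bar>\<kappa> \<zeta>\<bar> \<le> \<bar>K\<bar> * \<bar>\<kappa> \<zeta>\<bar>"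
          by (intro mult_right_mono) auto
        then show "norm (\<kappa> \<zeta> *\<^sub>R Ln (1 - \<alpha> \<zeta> * z)) \<le> norm (K * \<bar>\<kappa> \<zeta>\<bar>)"
          by (simp add: abs_mult mult.commute)
      qed
    qed measurable
  qed
  show "(\<lambda>z. \<integral>\<zeta>. \<kappa> \<zeta> *\<^sub>R Ln (1 - \<alpha> \<zeta> * z) \<partial>lborel) holomorphic_on ball 0 1"
  proof (rule holomorphic_onI)
    fix z :: complex assume z: "z \<in> ball 0 1"
    \<comment> \<open>A radius strictly between |z| and 1: on the smaller disc |1 - \<alpha> y| is
      at least 1 - \<rho>, which yields a bound for the derivative uniform in \<zeta>.\<close>
    define \<rho> where "\<rho> = (1 + cmod z) / 2"
    have \<rho>: "cmod z < \<rho>" "\<rho> < 1" using z by (auto simp: \<rho>_def)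
    define f' where "f' = (\<lambda>y \<zeta> h. \<kappa> \<zeta> *\<^sub>R ((- \<alpha> \<zeta> / (1 - \<alpha> \<zeta> * y)) * h))"
    have "((\<lambda>z. \<integral>\<zeta>. \<kappa> \<zeta> *\<^sub>R Ln (1 - \<alpha> \<zeta> * z) \<partial>lborel) has_derivative (\<lambda>h. \<integral>\<zeta>. f' z \<zeta> h \<partial>lborel)) (at z)"
    proof (rule has_derivative_integral_parameter(2)[where S = "ball 0 \<rho>" and B = "\<lambda>\<zeta>. \<bar>\<kappa> \<zeta>\<bar> / (1 - \<rho>)"])
      fix y \<zeta> h :: complex assume y: "y \<in> ball 0 \<rho>"
      have l: "cmod (\<alpha> \<zeta> * y) < \<rho>" using az[of \<zeta> y] y by simp
      then have "((\<lambda>y. Ln (1 - \<alpha> \<zeta> * y)) has_field_derivative - \<alpha> \<zeta> / (1 - \<alpha> \<zeta> * y)) (at y)"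
        using \<rho> by (auto intro!: derivative_eq_intros nn simp: divide_inverse)
      then have "((\<lambda>y. Ln (1 - \<alpha> \<zeta> * y)) has_derivative (\<lambda>h. (- \<alpha> \<zeta> / (1 - \<alpha> \<zeta> * y)) * h)) (at y)"
        unfolding has_field_derivative_def .
      then show "((\<lambda>y. \<kappa> \<zeta> *\<^sub>R Ln (1 - \<alpha> \<zeta> * y)) has_derivative f' y \<zeta>) (at y)"
        unfolding f'_def by (rule has_derivative_scaleR_right)
      have "1 - \<rho> \<le> cmod (1 - \<alpha> \<zeta> * y)"
        using l norm_triangle_ineq2[of 1 "\<alpha> \<zeta> * y"] by simp
      then have "cmod (\<alpha> \<zeta>) / cmod (1 - \<alpha> \<zeta> * y) \<le> 1 / (1 - \<rho>)"
        using \<rho> \<alpha> by (intro frac_le) auto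
      then have "\<bar>\<kappa> \<zeta>\<bar> * (cmod (\<alpha> \<zeta>) / cmod (1 - \<alpha> \<zeta> * y) * cmod h) \<le> \<bar>\<kappa> \<zeta>\<bar> * (1 / (1 - \<rho>) * cmod h)"
        by (intro mult_left_mono mult_right_mono) auto
      then show "norm (f' y \<zeta> h) \<le> \<bar>\<kappa> \<zeta>\<bar> / (1 - \<rho>) * norm h"
        unfolding f'_def by (simp add: norm_mult norm_divide)
    next
      show "integrable lborel (\<lambda>\<zeta>. \<kappa> \<zeta> *\<^sub>R Ln (1 - \<alpha> \<zeta> * y))" if "y \<in> ball 0 \<rho>" for y
        using that \<rho> by (intro int) auto
    qed (use \<rho> \<kappa> in auto)
    moreover have "(\<lambda>h. \<integral>\<zeta>. f' z \<zeta> h \<partial>lborel) = (*) (\<integral>\<zeta>. \<kappa> \<zeta> *\<^sub>R (- \<alpha> \<zeta> / (1 - \<alpha> \<zeta> * z)) \<partial>lborel)"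
    proof
      fix h
      have "(\<integral>\<zeta>. f' z \<zeta> h \<partial>lborel) = (\<integral>\<zeta>. (\<kappa> \<zeta> *\<^sub>R (- \<alpha> \<zeta> / (1 - \<alpha> \<zeta> * z))) * h \<partial>lborel)"
        by (simp add: f'_def)
      then show "(\<integral>\<zeta>. f' z \<zeta> h \<partial>lborel) = (\<integral>\<zeta>. \<kappa> \<zeta> *\<^sub>R (- \<alpha> \<zeta> / (1 - \<alpha> \<zeta> * z)) \<partial>lborel) * h"
        by (simp only: integral_mult_left_zero)
    qed
    ultimately have "((\<lambda>z. \<integral>\<zeta>. \<kappa> \<zeta> *\<^sub>R Ln (1 - \<alpha> \<zeta> * z) \<partial>lborel) has_field_derivative (\<integral>\<zeta>. \<kappa> \<zeta> *\<^sub>R (- \<alpha> \<zeta> / (1 - \<alpha> \<zeta> * z)) \<partial>lborel)) (at z)"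
      by (simp add: has_field_derivative_def)
    then show "(\<lambda>z. \<integral>\<zeta>. \<kappa> \<zeta> *\<^sub>R Ln (1 - \<alpha> \<zeta> * z) \<partial>lborel) field_differentiable at z within ball 0 1"
      using field_differentiable_at_within field_differentiable_def by blast
  qed
qed

section \<open>Averaging the extremal functions against the mass of the weight\<close>

text \<open>Jensen's inequality for a density of total mass m at most 1. The missing mass 1 - m is
  placed where the exponent is 0, and contributes exp 0 = 1 per unit of mass.\<close>

lemma exp_integral_le_nn_integral:
  fixes w X :: "'a \<Rightarrow> real"
  assumes w: "integrable M w" "\<And>x. 0 \<le> w x" "(\<integral>x. w x \<partial>M) \<le> 1"
    and X [measurable]: "X \<in> borel_measurable M" and wX: "integrable M (\<lambda>x. w x * X x)"
  shows "ennreal (exp (\<integral>x. w x * X x \<partial>M)) \<le> ennreal (1 - (\<integral>x. w x \<partial>M)) + (\<integral>\<^sup>+x. ennreal (w x * exp (X x)) \<partial>M)"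
proof (cases "(\<integral>\<^sup>+x. ennreal (w x * exp (X x)) \<partial>M) = \<infinity>")
  case False
  define E where "E = (\<integral>x. w x * X x \<partial>M)"
  define m where "m = (\<integral>x. w x \<partial>M)"
  have [measurable]: "w \<in> borel_measurable M" using w by simp
  have int: "integrable M (\<lambda>x. w x * exp (X x))"
    using False w(2) by (intro integrableI_nonneg) (auto simp: less_top)
  have "(\<integral>x. (exp E * (1 - E)) * w x + exp E * (w x * X x) \<partial>M) \<le> (\<integral>x. w x * exp (X x) \<partial>M)"
  proof (rule integral_mono)
    fix x
    \<comment> \<open>The tangent to the exponential at E lies below the graph.\<close>
    have "exp E * (1 + (X x - E)) \<le> exp E * exp (X x - E)" by (intro mult_left_mono exp_ge_add_one_self) auto
    also have "\<dots> = exp (X x)" by (simp add: exp_diff)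
    finally have "w x * (exp E * (1 + (X x - E))) \<le> w x * exp (X x)" by (intro mult_left_mono w)
    then show "(exp E * (1 - E)) * w x + exp E * (w x * X x) \<le> w x * exp (X x)" by (simp add: algebra_simps)
  qed (use w wX int in auto)
  also have "(\<integral>x. (exp E * (1 - E)) * w x + exp E * (w x * X x) \<partial>M) = exp E * (1 - E) * m + exp E * E"
    using w wX by (simp add: E_def m_def)
  finally have 1: "exp E * (1 - E) * m + exp E * E \<le> (\<integral>x. w x * exp (X x) \<partial>M)" .
  \<comment> \<open>The same tangent evaluated at the exponent 0, that of the missing mass.\<close>
  have "1 - E \<le> exp (- E)" using exp_ge_add_one_self[of "- E"] by simp
  then have "exp E * (1 - E) \<le> 1" using mult_left_mono[of "1 - E" "exp (- E)" "exp E"] by (simp add: exp_minus)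
  then have "exp E * (1 - E) * (1 - m) \<le> 1 * (1 - m)" using w(3) by (intro mult_right_mono) (auto simp: m_def)
  then have "exp E \<le> (1 - m) + (\<integral>x. w x * exp (X x) \<partial>M)" using 1 by (simp add: algebra_simps)
  then have "ennreal (exp E) \<le> ennreal ((1 - m) + (\<integral>x. w x * exp (X x) \<partial>M))" by (rule ennreal_leI)
  also have "\<dots> = ennreal (1 - m) + ennreal (\<integral>x. w x * exp (X x) \<partial>M)"
    by (rule ennreal_plus) (use w(2,3) in \<open>auto simp: m_def\<close>)
  finally have "ennreal (exp E) \<le> ennreal (1 - m) + ennreal (\<integral>x. w x * exp (X x) \<partial>M)" .
  then show ?thesis unfolding E_def m_def
    using int w(2) by (subst nn_integral_eq_integral) auto
qed simp

text \<open>exp F is the competitor for the weight f on the unit disc. The Laplacian is controlled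
  only on the disc; masses outside may have any sign, since their potentials are harmonic in the
  disc and can be removed exactly by a holomorphic factor.\<close>

lemma disc_subharmonic_extension:
  fixes f fx fy fxx fyy :: "complex \<Rightarrow> real"
  assumes x: "\<And>z. ((\<lambda>t. f (z + t *\<^sub>R 1)) has_real_derivative fx z) (at 0)"
      "\<And>z. ((\<lambda>t. fx (z + t *\<^sub>R 1)) has_real_derivative fxx z) (at 0)"
    and y: "\<And>z. ((\<lambda>t. f (z + t *\<^sub>R \<i>)) has_real_derivative fy z) (at 0)"
      "\<And>z. ((\<lambda>t. fy (z + t *\<^sub>R \<i>)) has_real_derivative fyy z) (at 0)"
    and cont: "continuous_on UNIV f" "continuous_on UNIV fx" "continuous_on UNIV fy" "continuous_on UNIV fxx" "continuous_on UNIV fyy"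
    and supp: "\<And>z. B \<le> cmod z \<Longrightarrow> f z = 0" "\<And>z. B \<le> cmod z \<Longrightarrow> fx z = 0" "\<And>z. B \<le> cmod z \<Longrightarrow> fy z = 0"
       "\<And>z. B \<le> cmod z \<Longrightarrow> fxx z = 0" "\<And>z. B \<le> cmod z \<Longrightarrow> fyy z = 0"
    and lap: "\<And>z. cmod z < 1 \<Longrightarrow> 0 \<le> fxx z + fyy z" "\<And>z. cmod z < 1 \<Longrightarrow> fxx z + fyy z \<le> 2"
  obtains F where "F holomorphic_on ball 0 1" "F 0 = 0"
    "(\<integral>\<^sup>+z. ennreal (exp (2 * Re (F z) - f z + f 0)) * indicator (ball 0 1) z \<partial>lborel) \<le> ennreal pi"
proof -
  \<comment> \<open>The Riesz density, normalised so that f is its potential against ln |\<zeta> -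
    z|^2.\<close>
  define \<kappa> where "\<kappa> = (\<lambda>z. (fxx z + fyy z) / (4 * pi))"
  have \<kappa>c: "continuous_on UNIV \<kappa>" unfolding \<kappa>_def by (intro continuous_intros cont) auto
  have \<kappa>s: "\<kappa> z = 0" if "B \<le> cmod z" for z using that by (simp add: \<kappa>_def supp)
  have \<kappa>m [measurable]: "\<kappa> \<in> borel_measurable borel" using \<kappa>c by (rule borel_measurable_continuous_onI)
  have \<kappa>i: "integrable lborel \<kappa>" using \<kappa>c \<kappa>s by (rule integrable_continuous_compact_support)
  obtain C where C: "0 \<le> C" "\<And>z. \<bar>\<kappa> z\<bar> \<le> C"
    using bounded_continuous_compact_support[OF \<kappa>c \<kappa>s] by blast
  have [measurable]: "ball (0::complex) 1 \<in> sets borel" by simp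
  \<comment> \<open>The fundamental-solution identity recovers the value at the origin, so f is
    translated by z; the radius of the support grows to B + |z|.\<close>
  have pot: "integrable lborel (\<lambda>\<zeta>. \<kappa> \<zeta> * ln ((cmod (\<zeta> - z))\<^sup>2))"
    "(\<integral>\<zeta>. \<kappa> \<zeta> * ln ((cmod (\<zeta> - z))\<^sup>2) \<partial>lborel) = f z" for z
  proof -
    have s: "B \<le> cmod (z + w)" if "B + cmod z \<le> cmod w" for w
      using that norm_triangle_ineq4[of "z + w" z] by simp
    have c: "continuous_on UNIV (\<lambda>w. g (z + w))" if "continuous_on UNIV g" for g :: "complex \<Rightarrow> real"
      by (rule continuous_on_compose2[OF that]) (auto intro!: continuous_intros)
    have "(\<integral>w. ln ((cmod w)\<^sup>2) * (fxx (z + w) + fyy (z + w)) \<partial>lborel) = 4 * pi * f (z + 0)"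
      by (rule integral_log_laplacian[where B = "B + cmod z" and f = "\<lambda>w. f (z + w)" and fx = "\<lambda>w. fx (z + w)" and fy = "\<lambda>w. fy (z + w)"];
          (rule c cont)?)
        (simp_all add: add.assoc[symmetric] x[simplified] y[simplified] supp s c cont)
    then have 1: "(\<integral>w. ln ((cmod w)\<^sup>2) * \<kappa> (z + w) \<partial>lborel) = f z"
      by (simp add: \<kappa>_def)
    have 2: "integrable lborel (\<lambda>w. ln ((cmod w)\<^sup>2) * \<kappa> (z + w))"
      by (rule integrable_log_mult(1)[where B = "B + cmod z" and C = C]) (use C s \<kappa>s in auto)
    have d: "lborel = distr lborel borel ((+) z)" by (simp add: lborel_distr_plus)
    show "integrable lborel (\<lambda>\<zeta>. \<kappa> \<zeta> * ln ((cmod (\<zeta> - z))\<^sup>2))"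
      by (subst d, subst integrable_distr_eq) (use 2 in \<open>auto simp: mult.commute\<close>)
    show "(\<integral>\<zeta>. \<kappa> \<zeta> * ln ((cmod (\<zeta> - z))\<^sup>2) \<partial>lborel) = f z"
      by (subst d, subst integral_distr) (use 1 in \<open>auto simp: mult.commute\<close>)
  qed
  \<comment> \<open>A mass at \<zeta> outside the disc is cancelled by 1 - z/\<zeta>. For a mass
    inside, (1 - \<open>\<alpha>2 \<zeta>\<close> z) / (1 - \<open>\<alpha>3 \<zeta>\<close> z) is
    the extremal function of its half-strength pole.\<close>
  define \<alpha>1 where "\<alpha>1 = (\<lambda>\<zeta>::complex. if cmod \<zeta> < 1 then 0 else 1 / \<zeta>)"
  define \<alpha>2 where "\<alpha>2 = (\<lambda>\<zeta>. 2 * cnj \<zeta> / (1 + of_real ((cmod \<zeta>)\<^sup>2)))"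
  define \<alpha>3 where "\<alpha>3 = (\<lambda>\<zeta>. if cmod \<zeta> < 1 then cnj \<zeta> else 0)"
  define \<kappa>D where "\<kappa>D = (\<lambda>\<zeta>. indicator (ball 0 1) \<zeta> * \<kappa> \<zeta>)"
  have \<kappa>Di: "integrable lborel \<kappa>D"
    unfolding \<kappa>D_def using integrable_mult_indicator[OF _ \<kappa>i, of "ball 0 1"] by simp
  have \<kappa>D0: "0 \<le> \<kappa>D \<zeta>" for \<zeta> using lap(1)[of \<zeta>] by (auto simp: \<kappa>D_def \<kappa>_def indicator_def)
  have [measurable]: "\<kappa>D \<in> borel_measurable borel" unfolding \<kappa>D_def by measurable
  have [measurable]: "cnj \<in> borel_measurable borel"
    by (intro borel_measurable_continuous_onI continuous_intros)
  have am [measurable]: "\<alpha>1 \<in> borel_measurable borel" "\<alpha>2 \<in> borel_measurable borel" "\<alpha>3 \<in> borel_measurable borel"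
    unfolding \<alpha>1_def \<alpha>2_def \<alpha>3_def by measurable
  have a1: "cmod (\<alpha>1 \<zeta>) \<le> 1" for \<zeta> by (simp add: \<alpha>1_def norm_divide divide_le_eq)
  \<comment> \<open>The zero (1 + |\<zeta>|^2) / (2 cnj \<zeta>) of the extremal function does not
    lie in the open disc; this is again 2 |\<zeta>| \<le> 1 + |\<zeta>|^2.\<close>
  have a2: "cmod (\<alpha>2 \<zeta>) \<le> 1" for \<zeta>
  proof -
    have "0 \<le> (1 - cmod \<zeta>)\<^sup>2" by simp
    then have "2 * cmod \<zeta> \<le> 1 + (cmod \<zeta>)\<^sup>2" by (simp add: power2_eq_square algebra_simps)
    moreover have "cmod (1 + of_real ((cmod \<zeta>)\<^sup>2)) = 1 + (cmod \<zeta>)\<^sup>2"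
      by (metis abs_of_nonneg add_nonneg_nonneg norm_of_real of_real_1 of_real_add zero_le_one zero_le_power2)
    moreover have "0 < 1 + (cmod \<zeta>)\<^sup>2" by (simp add: add_pos_nonneg)
    ultimately show ?thesis unfolding \<alpha>2_def norm_divide by (simp add: norm_mult)
  qed
  have a3: "cmod (\<alpha>3 \<zeta>) \<le> 1" for \<zeta> by (simp add: \<alpha>3_def)
  define A1 where "A1 = (\<lambda>z. \<integral>\<zeta>. \<kappa> \<zeta> *\<^sub>R Ln (1 - \<alpha>1 \<zeta> * z) \<partial>lborel)"
  define A2 where "A2 = (\<lambda>z. \<integral>\<zeta>. \<kappa>D \<zeta> *\<^sub>R Ln (1 - \<alpha>2 \<zeta> * z) \<partial>lborel)"
  define A3 where "A3 = (\<lambda>z. \<integral>\<zeta>. \<kappa>D \<zeta> *\<^sub>R Ln (1 - \<alpha>3 \<zeta> * z) \<partial>lborel)"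
  note hol = holomorphic_integral_Ln(1)[OF \<kappa>i am(1) a1, folded A1_def]
     holomorphic_integral_Ln(1)[OF \<kappa>Di am(2) a2, folded A2_def]
     holomorphic_integral_Ln(1)[OF \<kappa>Di am(3) a3, folded A3_def]
  note ints = holomorphic_integral_Ln(2)[OF \<kappa>i am(1) a1]
     holomorphic_integral_Ln(2)[OF \<kappa>Di am(2) a2]
     holomorphic_integral_Ln(2)[OF \<kappa>Di am(3) a3]
  \<comment> \<open>Two half-strength poles contribute the square of the extremal function, which is
    2 A2 - 2 A3 on the level of logarithms. Replacing ln |\<zeta> - z|^2 by ln |b|^2 gives one A3
    back.\<close>
  define F where "F = (\<lambda>z. A1 z + 2 * A2 z - A3 z)"
  have F: "F holomorphic_on ball 0 1" unfolding F_def by (intro holomorphic_intros hol)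
  have F0: "F 0 = 0" by (simp add: F_def A1_def A2_def A3_def)
  \<comment> \<open>A Laplacian at most 2 gives \<open>2 * \<kappa>D\<close> \<le> 1/pi, and the
    disc has area pi; hence m \<le> 1. This fixes the constant 2 in the hypothesis.\<close>
  define m where "m = (\<integral>\<zeta>. 2 * \<kappa>D \<zeta> \<partial>lborel)"
  have m: "0 \<le> m" "m \<le> 1"
  proof -
    show "0 \<le> m" unfolding m_def by (intro Bochner_Integration.integral_nonneg) (simp add: \<kappa>D0)
    have "m \<le> (\<integral>\<zeta>. (1 / pi) * indicator (ball 0 1 :: complex set) \<zeta> \<partial>lborel)" unfolding m_def
    proof (rule integral_mono)
      show "integrable lborel (\<lambda>\<zeta>. (1 / pi) * indicator (ball 0 1 :: complex set) \<zeta> :: real)"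
        by (intro integrable_mult_right integrable_real_indicator) (auto simp: emeasure_bounded_finite[unfolded infinity_ennreal_def])
      show "2 * \<kappa>D \<zeta> \<le> (1 / pi) * indicator (ball 0 1) \<zeta>" for \<zeta> :: complex
      proof (cases "cmod \<zeta> < 1")
        case True
        then have "(fxx \<zeta> + fyy \<zeta>) / (2 * pi) \<le> 2 / (2 * pi)"
          by (intro divide_right_mono lap(2)) auto
        moreover have "(fxx \<zeta> + fyy \<zeta>) / (2 * pi) = 2 * \<kappa> \<zeta>" by (simp add: \<kappa>_def field_simps)
        ultimately show ?thesis using True by (simp add: \<kappa>D_def)
      qed (simp add: \<kappa>D_def)
    qed (use \<kappa>Di in auto)
    also have "\<dots> = 1"
      by (simp add: measure_def emeasure_ball unit_ball_vol_2)
    finally show "m \<le> 1" .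
  qed
  have key: "ennreal (exp (2 * Re (F z) - f z + f 0)) \<le> ennreal (1 - m) + (\<integral>\<^sup>+\<zeta>. ennreal (2 * \<kappa>D \<zeta>) * ennreal (disc_kernel \<zeta> z) \<partial>lborel)" 
    if z: "cmod z < 1" for z
  proof -
    have "2 * Re (F z) - f z + f 0 = (\<integral>\<zeta>. 2 * \<kappa>D \<zeta> * ln (disc_kernel \<zeta> z) \<partial>lborel) \<and>
       integrable lborel (\<lambda>\<zeta>. 2 * \<kappa>D \<zeta> * ln (disc_kernel \<zeta> z))"
    proof -
      let ?l1 = "\<lambda>\<zeta>. \<kappa> \<zeta> *\<^sub>R Ln (1 - \<alpha>1 \<zeta> * z)" and ?l2 = "\<lambda>\<zeta>. \<kappa>D \<zeta> *\<^sub>R Ln (1 - \<alpha>2 \<zeta> * z)" 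
        and ?l3 = "\<lambda>\<zeta>. \<kappa>D \<zeta> *\<^sub>R Ln (1 - \<alpha>3 \<zeta> * z)"
      \<comment> \<open>All terms under one integral over \<zeta>. The integral of \<open>?S\<close>
        is the exponent 2 Re F - f + f(0), while pointwise \<open>?S\<close> collapses to the
        logarithm of the kernel inside the disc and to 0 outside.\<close>
      let ?S = "\<lambda>\<zeta>. 2 * Re (?l1 \<zeta> + 2 * ?l2 \<zeta> - ?l3 \<zeta>) - \<kappa> \<zeta> * ln ((cmod (\<zeta> - z))\<^sup>2) + \<kappa> \<zeta> * ln ((cmod (\<zeta> - 0))\<^sup>2)"
      note i = ints(1)[OF z] ints(2)[OF z] ints(3)[OF z]
      have i2: "integrable lborel (\<lambda>\<zeta>. 2 * ?l2 \<zeta>)" by (intro integrable_mult_right i)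
      have iL: "integrable lborel (\<lambda>\<zeta>. ?l1 \<zeta> + 2 * ?l2 \<zeta> - ?l3 \<zeta>)"
        by (intro Bochner_Integration.integrable_diff Bochner_Integration.integrable_add integrable_mult_right i)
      have iLR: "integrable lborel (\<lambda>\<zeta>. 2 * Re (?l1 \<zeta> + 2 * ?l2 \<zeta> - ?l3 \<zeta>))"
        by (intro integrable_mult_right integrable_Re iL)
      have eL: "(\<integral>\<zeta>. ?l1 \<zeta> + 2 * ?l2 \<zeta> - ?l3 \<zeta> \<partial>lborel) = F z"
        unfolding F_def A1_def A2_def A3_def
          Bochner_Integration.integral_diff[OF Bochner_Integration.integrable_add[OF i(1) i2] i(3)]
          Bochner_Integration.integral_add[OF i(1) i2] integral_mult_right_zero ..
      have iS: "integrable lborel ?S"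
        by (intro Bochner_Integration.integrable_diff Bochner_Integration.integrable_add iLR pot(1))
      have "(\<integral>\<zeta>. ?S \<zeta> \<partial>lborel) = 2 * Re (F z) - f z + f 0"
        unfolding Bochner_Integration.integral_add[OF Bochner_Integration.integrable_diff[OF iLR pot(1)] pot(1)]
          Bochner_Integration.integral_diff[OF iLR pot(1)] pot(2) integral_mult_right_zero integral_Re[OF iL] eL ..
      \<comment> \<open>The points \<zeta> = z and \<zeta> = 0 are excluded because ln 0 = 0 would
        falsify the logarithm rules there.\<close>
      moreover have ae: "AE \<zeta> in lborel. ?S \<zeta> = 2 * \<kappa>D \<zeta> * ln (disc_kernel \<zeta> z)"
        using AE_lborel_singleton[of z] AE_lborel_singleton[of 0]
      proof eventually_elim
        case (elim \<zeta>)
        have nz: "1 - a * z \<noteq> 0" if "cmod a \<le> 1" for a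
        proof
          assume "1 - a * z = 0"
          then have "1 = cmod a * cmod z" by (metis eq_iff_diff_eq_0 norm_mult norm_one)
          moreover have "cmod a * cmod z \<le> cmod z" using that by (simp add: mult_left_le_one_le)
          ultimately show False using z by simp
        qed
        have RL: "Re (Ln (1 - a * z)) = ln (cmod (1 - a * z))" if "cmod a \<le> 1" for a
          using Re_Ln[OF nz[OF that]] .
        have sq: "ln ((cmod (\<zeta> - w))\<^sup>2) = 2 * ln (cmod (\<zeta> - w))" if "\<zeta> \<noteq> w" for w
          using that by (simp add: ln_realpow)
        have S: "?S \<zeta> = 2 * (\<kappa> \<zeta> * ln (cmod (1 - \<alpha>1 \<zeta> * z)) + 2 * (\<kappa>D \<zeta> * ln (cmod (1 - \<alpha>2 \<zeta> * z))) - \<kappa>D \<zeta> * ln (cmod (1 - \<alpha>3 \<zeta> * z)))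
             - \<kappa> \<zeta> * (2 * ln (cmod (\<zeta> - z))) + \<kappa> \<zeta> * (2 * ln (cmod \<zeta>))"
          using sq[OF elim(1)] sq[OF elim(2)] RL[OF a1] RL[OF a2] RL[OF a3] by simp
        show ?case
        proof (cases "cmod \<zeta> < 1")
          case True
          then have e: "\<kappa>D \<zeta> = \<kappa> \<zeta>" "\<alpha>1 \<zeta> = 0" "\<alpha>3 \<zeta> = cnj \<zeta>" by (auto simp: \<kappa>D_def \<alpha>1_def \<alpha>3_def)
          have p: "0 < cmod (1 - \<alpha>2 \<zeta> * z)" "0 < cmod (1 - cnj \<zeta> * z)" "0 < cmod \<zeta>" "0 < cmod (z - \<zeta>)"
            using nz[OF a2] nz[of "cnj \<zeta>"] True elim by auto
          have "disc_kernel \<zeta> z = (cmod (1 - \<alpha>2 \<zeta> * z))\<^sup>2 * cmod \<zeta> / (cmod (1 - cnj \<zeta> * z) * cmod (z - \<zeta>))"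
            by (simp add: disc_kernel_def \<alpha>2_def)
          then have lk: "ln (disc_kernel \<zeta> z) = 2 * ln (cmod (1 - \<alpha>2 \<zeta> * z)) + ln (cmod \<zeta>) - (ln (cmod (1 - cnj \<zeta> * z)) + ln (cmod (z - \<zeta>)))"
            using p by (simp add: ln_div ln_mult ln_realpow)
          show ?thesis unfolding S unfolding e lk by (simp add: norm_minus_commute[of z \<zeta>] algebra_simps)
        next
          case False
          then have e: "\<kappa>D \<zeta> = 0" "\<alpha>1 \<zeta> = 1 / \<zeta>" by (auto simp: \<kappa>D_def \<alpha>1_def)
          have "1 - 1 / \<zeta> * z = (\<zeta> - z) / \<zeta>" using elim by (simp add: diff_divide_distrib)
          then have lq: "ln (cmod (1 - 1 / \<zeta> * z)) = ln (cmod (\<zeta> - z)) - ln (cmod \<zeta>)"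
            using elim by (simp add: norm_divide ln_div)
          show ?thesis unfolding S unfolding e lq by (simp add: algebra_simps)
        qed
      qed
      moreover have mk: "(\<lambda>\<zeta>. 2 * \<kappa>D \<zeta> * ln (disc_kernel \<zeta> z)) \<in> borel_measurable lborel"
        unfolding disc_kernel_def by measurable
      ultimately show ?thesis
        using integral_cong_AE[OF borel_measurable_integrable[OF iS] mk ae] integrable_cong_AE_imp[OF iS mk ae]
        by simp
    qed
    then have e: "2 * Re (F z) - f z + f 0 = (\<integral>\<zeta>. 2 * \<kappa>D \<zeta> * ln (disc_kernel \<zeta> z) \<partial>lborel)"
      and i: "integrable lborel (\<lambda>\<zeta>. 2 * \<kappa>D \<zeta> * ln (disc_kernel \<zeta> z))" by auto
    have "ennreal (exp (2 * Re (F z) - f z + f 0)) \<le> ennreal (1 - m) + (\<integral>\<^sup>+\<zeta>. ennreal (2 * \<kappa>D \<zeta> * exp (ln (disc_kernel \<zeta> z))) \<partial>lborel)"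
      unfolding e m_def
      by (rule exp_integral_le_nn_integral[OF _ _ _ _ i]) (use \<kappa>Di \<kappa>D0 m in \<open>auto simp: m_def disc_kernel_def\<close>)
    also have "(\<integral>\<^sup>+\<zeta>. ennreal (2 * \<kappa>D \<zeta> * exp (ln (disc_kernel \<zeta> z))) \<partial>lborel) = (\<integral>\<^sup>+\<zeta>. ennreal (2 * \<kappa>D \<zeta>) * ennreal (disc_kernel \<zeta> z) \<partial>lborel)"
    proof (rule nn_integral_cong_AE)
      show "AE \<zeta> in lborel. ennreal (2 * \<kappa>D \<zeta> * exp (ln (disc_kernel \<zeta> z))) = ennreal (2 * \<kappa>D \<zeta>) * ennreal (disc_kernel \<zeta> z)"
        using AE_lborel_singleton[of z] AE_lborel_singleton[of 0]
      proof eventually_elim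
        case (elim \<zeta>)
        show ?case
        proof (cases "cmod \<zeta> < 1")
          case True
          have nz: "1 - a * z \<noteq> 0" if "cmod a \<le> 1" for a
          proof
            assume "1 - a * z = 0"
            then have "1 = cmod a * cmod z" by (metis eq_iff_diff_eq_0 norm_mult norm_one)
            moreover have "cmod a * cmod z \<le> cmod z" using that by (simp add: mult_left_le_one_le)
            ultimately show False using z by simp
          qed
          have "0 < disc_kernel \<zeta> z" 
            using nz[OF a2[of \<zeta>]] nz[of "cnj \<zeta>"] True elim unfolding disc_kernel_def \<alpha>2_def by simp
          then show ?thesis using \<kappa>D0[of \<zeta>] by (simp add: ennreal_mult'[symmetric])
        qed (simp add: \<kappa>D_def)
      qed
    qed
    finally show ?thesis .
  qed
  have "(\<integral>\<^sup>+z. ennreal (exp (2 * Re (F z) - f z + f 0)) * indicator (ball 0 1) z \<partial>lborel)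
    \<le> (\<integral>\<^sup>+z. ennreal (1 - m) * indicator (ball 0 1) z + (\<integral>\<^sup>+\<zeta>. ennreal (2 * \<kappa>D \<zeta>) * (ennreal (disc_kernel \<zeta> z) * indicator (ball 0 1) z) \<partial>lborel) \<partial>lborel)"
  proof (rule nn_integral_mono)
    fix z
    show "ennreal (exp (2 * Re (F z) - f z + f 0)) * indicator (ball 0 1) z
      \<le> ennreal (1 - m) * indicator (ball 0 1) z + (\<integral>\<^sup>+\<zeta>. ennreal (2 * \<kappa>D \<zeta>) * (ennreal (disc_kernel \<zeta> z) * indicator (ball 0 1) z) \<partial>lborel)"
      using key[of z] by (cases "z \<in> ball 0 1") auto
  qed
  also have "\<dots> = ennreal (1 - m) * ennreal pi + (\<integral>\<^sup>+z. (\<integral>\<^sup>+\<zeta>. ennreal (2 * \<kappa>D \<zeta>) * (ennreal (disc_kernel \<zeta> z) * indicator (ball 0 1) z) \<partial>lborel) \<partial>lborel)"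
    by (subst nn_integral_add) (auto simp: disc_kernel_def nn_integral_cmult_indicator emeasure_ball unit_ball_vol_2)
  \<comment> \<open>Exchanging the integrals leaves, for each fixed \<zeta>, the estimate for a
    single pole.\<close>
  also have "(\<integral>\<^sup>+z. (\<integral>\<^sup>+\<zeta>. ennreal (2 * \<kappa>D \<zeta>) * (ennreal (disc_kernel \<zeta> z) * indicator (ball 0 1) z) \<partial>lborel) \<partial>lborel)
     = (\<integral>\<^sup>+\<zeta>. (\<integral>\<^sup>+z. ennreal (2 * \<kappa>D \<zeta>) * (ennreal (disc_kernel \<zeta> z) * indicator (ball 0 1) z) \<partial>lborel) \<partial>lborel)"
    unfolding disc_kernel_def by (rule lborel_pair.Fubini') measurable
  also have "\<dots> \<le> (\<integral>\<^sup>+\<zeta>. ennreal (2 * \<kappa>D \<zeta>) * ennreal pi \<partial>lborel)"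
  proof (rule nn_integral_mono)
    fix \<zeta>
    have mk: "(\<lambda>z. ennreal (disc_kernel \<zeta> z) * indicator (ball 0 1) z) \<in> borel_measurable lborel"
      unfolding disc_kernel_def by measurable
    show "(\<integral>\<^sup>+z. ennreal (2 * \<kappa>D \<zeta>) * (ennreal (disc_kernel \<zeta> z) * indicator (ball 0 1) z) \<partial>lborel) \<le> ennreal (2 * \<kappa>D \<zeta>) * ennreal pi"
    \<comment> \<open>Poles outside the disc have density 0. At \<zeta> = 0 the kernel vanishes
      identically through its factor |\<zeta>|.\<close>
    proof (cases "cmod \<zeta> < 1 \<and> \<zeta> \<noteq> 0")
      case True
      then show ?thesis
        by (subst nn_integral_cmult[OF mk]) (intro mult_left_mono nn_integral_disc_kernel_le, auto)
    next
      case False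
      then have "\<kappa>D \<zeta> = 0 \<or> \<zeta> = 0" by (auto simp: \<kappa>D_def)
      then show ?thesis by (auto simp: disc_kernel_def)
    qed
  qed
  also have "\<dots> = ennreal m * ennreal pi"
    unfolding m_def using \<kappa>Di \<kappa>D0
    by (subst nn_integral_multc) (auto simp: nn_integral_eq_integral)
  also have "ennreal (1 - m) * ennreal pi + ennreal m * ennreal pi = ennreal pi"
    using m by (simp add: ennreal_mult'[symmetric] ennreal_plus[symmetric] algebra_simps del: ennreal_plus)
  finally show thesis using that F F0 by (auto simp: add_left_mono)
qed

section \<open>Calculus of C^k functions\<close>

lemma Ck_on_SucI:
  assumes "\<And>x. x \<in> S \<Longrightarrow> (f has_derivative f' x) (at x)" "\<And>v. Ck_on k (\<lambda>x. f' x v) S"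
  shows "Ck_on (Suc k) f S"
  using assms by auto

lemma Ck_on_SucE:
  assumes "Ck_on (Suc k) f S"
  obtains f' where "\<And>x. x \<in> S \<Longrightarrow> (f has_derivative f' x) (at x)" "\<And>v. Ck_on k (\<lambda>x. f' x v) S"
  using assms by auto

declare Ck_on.simps(2) [simp del]

lemma Ck_on_SucD: "Ck_on (Suc k) f S \<Longrightarrow> Ck_on k f S"
proof (induction k arbitrary: f)
  case 0
  then show ?case
    by (elim Ck_on_SucE) (auto intro!: continuous_at_imp_continuous_on dest: has_derivative_continuous)
next
  case (Suc k)
  from Suc.prems obtain f' where f': "\<And>x. x \<in> S \<Longrightarrow> (f has_derivative f' x) (at x)" "\<And>v. Ck_on (Suc k) (\<lambda>x. f' x v) S"
    by (rule Ck_on_SucE) (rule that)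
  show ?case using f'(1) Suc.IH[OF f'(2)] by (rule Ck_on_SucI)
qed

lemma Ck_on_continuous_on: "Ck_on k f S \<Longrightarrow> continuous_on S f"
  by (induction k) (auto dest: Ck_on_SucD)

lemma Ck_on_subset: "Ck_on k f S \<Longrightarrow> T \<subseteq> S \<Longrightarrow> Ck_on k f T"
proof (induction k arbitrary: f)
  case 0
  then show ?case by (auto intro: continuous_on_subset)
next
  case (Suc k)
  obtain f' where f': "\<And>x. x \<in> S \<Longrightarrow> (f has_derivative f' x) (at x)" "\<And>v. Ck_on k (\<lambda>x. f' x v) S"
    using Suc.prems(1) by (rule Ck_on_SucE) (rule that)
  show ?case
    by (rule Ck_on_SucI[OF f'(1) Suc.IH[OF f'(2)]]) (use Suc.prems(2) in auto)
qed

lemma Ck_on_cong: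
  assumes "open S" "\<And>x. x \<in> S \<Longrightarrow> f x = g x" "Ck_on k f S"
  shows "Ck_on k g S"
proof (cases k)
  case 0
  then show ?thesis using assms by (auto cong: continuous_on_cong)
next
  case (Suc m)
  obtain f' where f': "\<And>x. x \<in> S \<Longrightarrow> (f has_derivative f' x) (at x)" "\<And>v. Ck_on m (\<lambda>x. f' x v) S"
    using assms(3) unfolding Suc by (rule Ck_on_SucE) (rule that)
  have "(g has_derivative f' x) (at x)" if "x \<in> S" for x
    using f'(1)[OF that] assms(1) that assms(2) by (rule has_derivative_transform_within_open)
  then show ?thesis using f'(2) unfolding Suc by (rule Ck_on_SucI)
qed

lemma Ck_on_const: "Ck_on k (\<lambda>x. c) S"
proof (induction k arbitrary: c)
  case (Suc k)
  show ?case by (rule Ck_on_SucI[OF has_derivative_const Suc.IH])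
qed auto

lemma Ck_on_bounded_linear: 
  assumes "bounded_linear A"
  shows "Ck_on k A S"
proof (cases k)
  case 0
  then show ?thesis using assms by (simp add: linear_continuous_on)
next
  case (Suc m)
  show ?thesis unfolding Suc
    by (rule Ck_on_SucI[OF bounded_linear_imp_has_derivative[OF assms] Ck_on_const])
qed

lemma Ck_on_add:
  assumes "Ck_on k f S" "Ck_on k g S"
  shows "Ck_on k (\<lambda>x. f x + g x) S"
  using assms
proof (induction k arbitrary: f g)
  case 0
  then show ?case by (auto intro: continuous_intros)
next
  case (Suc k)
  obtain f' where f': "\<And>x. x \<in> S \<Longrightarrow> (f has_derivative f' x) (at x)" "\<And>v. Ck_on k (\<lambda>x. f' x v) S"
    using Suc.prems(1) by (rule Ck_on_SucE) (rule that)
  obtain g' where g': "\<And>x. x \<in> S \<Longrightarrow> (g has_derivative g' x) (at x)" "\<And>v. Ck_on k (\<lambda>x. g' x v) S"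
    using Suc.prems(2) by (rule Ck_on_SucE) (rule that)
  show ?case
  proof (rule Ck_on_SucI)
    show "((\<lambda>x. f x + g x) has_derivative (\<lambda>v. f' x v + g' x v)) (at x)" if "x \<in> S" for x
      using f'(1)[OF that] g'(1)[OF that] by (rule has_derivative_add)
    show "Ck_on k (\<lambda>x. f' x v + g' x v) S" for v
      by (intro Suc.IH f' g')
  qed
qed

lemma Ck_on_mult:
  fixes f g :: "'a::real_normed_vector \<Rightarrow> real"
  assumes "Ck_on k f S" "Ck_on k g S"
  shows "Ck_on k (\<lambda>x. f x * g x) S"
  using assms
proof (induction k arbitrary: f g)
  case 0
  then show ?case by (auto intro: continuous_intros)
next
  case (Suc k)
  note fk = Ck_on_SucD[OF Suc.prems(1)] and gk = Ck_on_SucD[OF Suc.prems(2)]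
  obtain f' where f': "\<And>x. x \<in> S \<Longrightarrow> (f has_derivative f' x) (at x)" "\<And>v. Ck_on k (\<lambda>x. f' x v) S"
    using Suc.prems(1) by (rule Ck_on_SucE) (rule that)
  obtain g' where g': "\<And>x. x \<in> S \<Longrightarrow> (g has_derivative g' x) (at x)" "\<And>v. Ck_on k (\<lambda>x. g' x v) S"
    using Suc.prems(2) by (rule Ck_on_SucE) (rule that)
  show ?case
  proof (rule Ck_on_SucI)
    show "((\<lambda>x. f x * g x) has_derivative (\<lambda>v. f x * g' x v + f' x v * g x)) (at x)" if "x \<in> S" for x
      using f'(1)[OF that] g'(1)[OF that] by (rule has_derivative_mult)
    show "Ck_on k (\<lambda>x. f x * g' x v + f' x v * g x) S" for v
      by (intro Ck_on_add Suc.IH fk gk f' g')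
  qed
qed

lemma Ck_on_compose:
  fixes f :: "'a::real_normed_vector \<Rightarrow> real" and g :: "real \<Rightarrow> real"
  assumes "Ck_on k f S" "Ck_on k g T" "f ` S \<subseteq> T"
  shows "Ck_on k (\<lambda>x. g (f x)) S"
  using assms
proof (induction k arbitrary: g)
  case 0
  then show ?case by (auto intro: continuous_on_compose2)
next
  case (Suc k)
  obtain f' where f': "\<And>x. x \<in> S \<Longrightarrow> (f has_derivative f' x) (at x)" "\<And>v. Ck_on k (\<lambda>x. f' x v) S"
    using Suc.prems(1) by (rule Ck_on_SucE) (rule that)
  obtain g' where g': "\<And>x. x \<in> T \<Longrightarrow> (g has_derivative g' x) (at x)" "\<And>v. Ck_on k (\<lambda>x. g' x v) T"
    using Suc.prems(2) by (rule Ck_on_SucE) (rule that)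
  show ?case
  proof (rule Ck_on_SucI)
    fix x assume x: "x \<in> S"
    have gx: "(g has_derivative g' (f x)) (at (f x))" using g'(1) Suc.prems(3) x by blast
    have "g' (f x) v = v * g' (f x) 1" for v
      using linear_cmul[OF has_derivative_linear[OF gx], of v 1] by simp
    then have "(\<lambda>v. g' (f x) (f' x v)) = (\<lambda>v. f' x v * g' (f x) 1)" by (rule ext)
    with has_derivative_compose[OF f'(1)[OF x] gx]
    show "((\<lambda>x. g (f x)) has_derivative (\<lambda>v. f' x v * g' (f x) 1)) (at x)" by simp
  next
    fix v
    have "Ck_on k (\<lambda>x. g' (f x) 1) S"
      using Ck_on_SucD[OF Suc.prems(1)] g'(2) Suc.prems(3) by (rule Suc.IH)
    then show "Ck_on k (\<lambda>x. f' x v * g' (f x) 1) S" by (rule Ck_on_mult[OF f'(2)])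
  qed
qed

lemma Ck_on_affine_compose:
  assumes "bounded_linear A" "Ck_on k f S"
  shows "Ck_on k (\<lambda>x. f (a + A x)) {x. a + A x \<in> S}"
  using assms(2)
proof (induction k arbitrary: f)
  case 0
  have "continuous_on {x. a + A x \<in> S} (\<lambda>x. a + A x)"
    by (intro continuous_intros linear_continuous_on assms(1))
  with 0 have "continuous_on {x. a + A x \<in> S} (\<lambda>x. f (a + A x))"
    by (auto intro: continuous_on_compose2[of S f _ "\<lambda>x. a + A x"])
  then show ?case by simp
next
  case (Suc k)
  obtain f' where f': "\<And>x. x \<in> S \<Longrightarrow> (f has_derivative f' x) (at x)" "\<And>v. Ck_on k (\<lambda>x. f' x v) S"
    using Suc.prems unfolding Ck_on.simps(2) by auto
  show ?case
  proof (rule Ck_on_SucI)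
    fix x assume "x \<in> {x. a + A x \<in> S}"
    then have fx: "(f has_derivative f' (a + A x)) (at (a + A x))" using f'(1) by blast
    have "((\<lambda>x. a + A x) has_derivative (\<lambda>v. 0 + A v)) (at x)"
      by (intro has_derivative_add has_derivative_const bounded_linear_imp_has_derivative assms(1))
    then have "((\<lambda>x. a + A x) has_derivative A) (at x)" by simp
    from has_derivative_compose[OF this fx]
    show "((\<lambda>x. f (a + A x)) has_derivative (\<lambda>v. f' (a + A x) (A v))) (at x)" .
  next
    show "Ck_on k (\<lambda>x. f' (a + A x) (A v)) {x. a + A x \<in> S}" for v
      by (rule Suc.IH[OF f'(2)])
  qed
qed

text \<open>Glues a cut-off product with the zero function beyond its support. Derivatives agree on
  the overlap by uniqueness, so the patched derivative is of class C^k on each piece and the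
  induction continues.\<close>

lemma Ck_on_Un:
  assumes "open S" "open T" "Ck_on k f S" "Ck_on k f T"
  shows "Ck_on k f (S \<union> T)"
  using assms(3,4)
proof (induction k arbitrary: f)
  case 0
  then show ?case using assms(1,2) by (auto intro: continuous_on_open_Un)
next
  case (Suc k)
  obtain f1 where f1: "\<And>x. x \<in> S \<Longrightarrow> (f has_derivative f1 x) (at x)" "\<And>v. Ck_on k (\<lambda>x. f1 x v) S"
    using Suc.prems(1) by (rule Ck_on_SucE) (rule that)
  obtain f2 where f2: "\<And>x. x \<in> T \<Longrightarrow> (f has_derivative f2 x) (at x)" "\<And>v. Ck_on k (\<lambda>x. f2 x v) T"
    using Suc.prems(2) by (rule Ck_on_SucE) (rule that)
  define f' where "f' = (\<lambda>x. if x \<in> S then f1 x else f2 x)"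
  have S: "f' x = f1 x" if "x \<in> S" for x using that by (simp add: f'_def)
  have T: "f' x = f2 x" if "x \<in> T" for x
    using has_derivative_unique[OF f1(1) f2(1)[OF that]] by (auto simp: f'_def)
  show ?case
  proof (rule Ck_on_SucI)
    show "(f has_derivative f' x) (at x)" if "x \<in> S \<union> T" for x
      using f1(1)[of x] f2(1)[of x] S[of x] T[of x] that by auto
    show "Ck_on k (\<lambda>x. f' x v) (S \<union> T)" for v
    proof (rule Suc.IH)
      show "Ck_on k (\<lambda>x. f' x v) S"
        by (rule Ck_on_cong[OF assms(1) _ f1(2)[of v]]) (simp add: S)
      show "Ck_on k (\<lambda>x. f' x v) T"
        by (rule Ck_on_cong[OF assms(2) _ f2(2)[of v]]) (simp add: T)
    qed
  qed
qed

lemma Ck_on_exp: "Ck_on k (exp :: real \<Rightarrow> real) S"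
proof (induction k)
  case 0
  show ?case by (auto intro: continuous_intros)
next
  case (Suc k)
  show ?case
  proof (rule Ck_on_SucI)
    show "(exp has_derivative (\<lambda>v. exp x * v)) (at x)" for x :: real
      using DERIV_exp unfolding has_field_derivative_def by blast
    show "Ck_on k (\<lambda>x. exp x * v) S" for v :: real
      by (rule Ck_on_mult[OF Suc Ck_on_const])
  qed
qed

lemma Ck_on_inverse: "Ck_on k (inverse :: real \<Rightarrow> real) {0<..}"
proof (induction k)
  case 0
  show ?case by (auto intro!: continuous_intros)
next
  case (Suc k)
  show ?case
  proof (rule Ck_on_SucI)
    show "(inverse has_derivative (\<lambda>v. - (inverse x * v * inverse x))) (at x)" if "x \<in> {0<..}" for x :: real
      using that by (intro has_derivative_inverse') simp
    have "Ck_on k (\<lambda>x. (- v) * (inverse x * inverse x)) {0<..}" for v :: real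
      by (rule Ck_on_mult[OF Ck_on_const Ck_on_mult[OF Suc Suc]])
    then show "Ck_on k (\<lambda>x. - (inverse x * v * inverse x)) {0<..}" for v :: real
      by (simp add: mult_ac)
  qed
qed

lemma Ck_on_ln: "Ck_on k (ln :: real \<Rightarrow> real) {0<..}"
proof (cases k)
  case 0
  then show ?thesis by (auto intro!: continuous_intros)
next
  case (Suc m)
  show ?thesis unfolding Suc
  proof (rule Ck_on_SucI)
    show "(ln has_derivative (\<lambda>v. inverse x * v)) (at x)" if "x \<in> {0<..}" for x :: real
      using DERIV_ln[of x] that unfolding has_field_derivative_def by simp
    show "Ck_on m (\<lambda>x. inverse x * v) {0<..}" for v :: real
      by (rule Ck_on_mult[OF Ck_on_inverse Ck_on_const])
  qed
qed

section \<open>Smooth dependence of integrals on a parameter\<close>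

text \<open>Because \<open>W\<close> contains the compact closure of the product, every continuous
  function on \<open>W\<close> is bounded there, and constants serve as majorants. The induction
  varies \<open>H\<close>: a derivative of the integral has the integrand H'(\<tau>, z)(v, 0), of
  the same kind.\<close>

lemma Ck_on_integral_parameter:
  fixes H :: "complex \<times> 'v::euclidean_space \<Rightarrow> real"
  assumes U: "open U" and \<Omega>: "\<Omega> \<in> sets borel" and bdd: "bounded U" "bounded \<Omega>"
    and W: "closure (U \<times> \<Omega>) \<subseteq> W" and H: "Ck_on k H W"
  shows "Ck_on k (\<lambda>\<tau>. \<integral>z. H (\<tau>, z) \<partial>restrict_space lborel \<Omega>) U"
    and "\<tau> \<in> U \<Longrightarrow> integrable (restrict_space lborel \<Omega>) (\<lambda>z. H (\<tau>, z))"
proof -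
  let ?M = "restrict_space lborel \<Omega>"
  have fin: "finite_measure ?M"
    using \<Omega> emeasure_bounded_finite[OF bdd(2)]
    by (intro finite_measureI) (simp add: emeasure_restrict_space space_restrict_space top.not_eq_extremum)
  have spM: "space ?M = \<Omega>" by (simp add: space_restrict_space)
  have cpt: "compact (closure (U \<times> \<Omega>))"
    using bdd by (simp add: compact_closure bounded_Times)
  have sub: "U \<times> \<Omega> \<subseteq> W" by (rule order_trans[OF closure_subset W])
  have bound: "\<exists>C. \<forall>\<tau>\<in>U. \<forall>z\<in>\<Omega>. \<bar>H (\<tau>, z)\<bar> \<le> C" if "continuous_on W H" for H :: "complex \<times> 'v \<Rightarrow> real"
  proof -
    have "bounded (H ` closure (U \<times> \<Omega>))"
      by (intro compact_imp_bounded compact_continuous_image continuous_on_subset[OF that W] cpt)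
    then obtain C where "\<forall>x\<in>closure (U \<times> \<Omega>). norm (H x) \<le> C" unfolding bounded_iff by blast
    then show ?thesis using closure_subset[of "U \<times> \<Omega>"] by (intro exI[of _ C]) auto
  qed
  have meas: "(\<lambda>z. H (\<tau>, z)) \<in> borel_measurable ?M" if "continuous_on W H" "\<tau> \<in> U" 
    for H :: "complex \<times> 'v \<Rightarrow> real" and \<tau>
  proof -
    have "continuous_on \<Omega> (\<lambda>z. H (\<tau>, z))"
      by (rule continuous_on_compose2[OF that(1)]) (use sub that(2) in \<open>auto intro!: continuous_intros\<close>)
    then have "(\<lambda>z. H (\<tau>, z)) \<in> borel_measurable (restrict_space borel \<Omega>)"
      by (rule borel_measurable_continuous_on_restrict)
    moreover have "sets ?M = sets (restrict_space borel \<Omega>)" by (rule sets_restrict_space_cong) simp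
    ultimately show ?thesis using measurable_cong_sets[OF _ refl] by blast
  qed
  have int: "integrable ?M (\<lambda>z. H (\<tau>, z))" if cH: "continuous_on W H" and \<tau>: "\<tau> \<in> U" for H :: "complex \<times> 'v \<Rightarrow> real" and \<tau>
  proof -
    obtain C where "\<forall>\<tau>\<in>U. \<forall>z\<in>\<Omega>. \<bar>H (\<tau>, z)\<bar> \<le> C" using bound[OF cH] by blast
    then show ?thesis using cH \<tau>
      by (intro finite_measure.integrable_const_bound[OF fin, of _ C] meas AE_I2) (auto simp: spM)
  qed
  show "\<tau> \<in> U \<Longrightarrow> integrable ?M (\<lambda>z. H (\<tau>, z))"
    using int Ck_on_continuous_on[OF H] by blast
  show "Ck_on k (\<lambda>\<tau>. \<integral>z. H (\<tau>, z) \<partial>?M) U"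
    using H
  proof (induction k arbitrary: H)
    case (0 H)
    then have cont: "continuous_on W H" by simp
    obtain C where C: "\<forall>\<tau>\<in>U. \<forall>z\<in>\<Omega>. \<bar>H (\<tau>, z)\<bar> \<le> C" using bound[OF cont] by blast
    have "continuous_on U (\<lambda>\<tau>. \<integral>z. H (\<tau>, z) \<partial>?M)"
    proof (rule continuous_on_sequentiallyI)
      fix u \<tau> assume u: "\<forall>n. u n \<in> U" "\<tau> \<in> U" "u \<longlonglongrightarrow> \<tau>"
      show "(\<lambda>n. \<integral>z. H (u n, z) \<partial>?M) \<longlonglongrightarrow> (\<integral>z. H (\<tau>, z) \<partial>?M)"
      proof (rule integral_dominated_convergence)
        show "integrable ?M (\<lambda>z. C)" using fin by (simp add: finite_measure.integrable_const)
        show "AE z in ?M. (\<lambda>n. H (u n, z)) \<longlonglongrightarrow> H (\<tau>, z)"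
        proof (rule AE_I2)
          fix z assume "z \<in> space ?M"
          then have "(\<tau>, z) \<in> W" "\<And>n. (u n, z) \<in> W" using u sub spM by auto
          then show "(\<lambda>n. H (u n, z)) \<longlonglongrightarrow> H (\<tau>, z)"
            using u(3) by (intro continuous_on_tendsto_compose[OF cont] tendsto_intros) auto
        qed
        show "AE z in ?M. norm (H (u n, z)) \<le> C" for n
          using C u by (intro AE_I2) (auto simp: spM)
      qed (use meas[OF cont] u in auto)
    qed
    then show ?case by simp
  next
    case (Suc k)
    note cont = Ck_on_continuous_on[OF Suc.prems]
    obtain H' where H': "\<And>x. x \<in> W \<Longrightarrow> (H has_derivative H' x) (at x)" "\<And>v. Ck_on k (\<lambda>x. H' x v) W"
      using Suc.prems by (rule Ck_on_SucE) (rule that)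
    obtain C1 where C1: "\<forall>\<tau>\<in>U. \<forall>z\<in>\<Omega>. \<bar>H' (\<tau>, z) (1, 0)\<bar> \<le> C1" 
      using bound[OF Ck_on_continuous_on[OF H'(2)]] by blast
    obtain C2 where C2: "\<forall>\<tau>\<in>U. \<forall>z\<in>\<Omega>. \<bar>H' (\<tau>, z) (\<i>, 0)\<bar> \<le> C2" 
      using bound[OF Ck_on_continuous_on[OF H'(2)]] by blast
    show ?case
    proof (rule Ck_on_SucI)
      show "Ck_on k (\<lambda>\<tau>. \<integral>z. H' (\<tau>, z) (v, 0) \<partial>?M) U" for v
        by (rule Suc.IH[OF H'(2)])
      fix \<tau> assume \<tau>: "\<tau> \<in> U"
      obtain e where e: "e > 0" "ball \<tau> e \<subseteq> U" using U \<tau> by (meson open_contains_ball)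
      show "((\<lambda>\<tau>. \<integral>z. H (\<tau>, z) \<partial>?M) has_derivative (\<lambda>v. \<integral>z. H' (\<tau>, z) (v, 0) \<partial>?M)) (at \<tau>)"
      proof (rule has_derivative_integral_parameter(2)[where S = "ball \<tau> e" and B = "\<lambda>_. C1 + C2"])
        fix y z and h :: complex assume "y \<in> ball \<tau> e" "z \<in> space ?M"
        then have yz: "y \<in> U" "z \<in> \<Omega>" "(y, z) \<in> W" using e sub spM by auto
        have "((\<lambda>y. (y, z)) has_derivative (\<lambda>h. (h, 0))) (at y)"
          by (auto intro!: derivative_eq_intros)
        from has_derivative_compose[OF this H'(1)[OF yz(3)]]
        show "((\<lambda>y. H (y, z)) has_derivative (\<lambda>h. H' (y, z) (h, 0))) (at y)" .
        have lin: "linear (H' (y, z))" using has_derivative_linear[OF H'(1)[OF yz(3)]] .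
        \<comment> \<open>\<open>Ck_on\<close> controls derivatives one direction at a time.
          Expanding h in 1 and \<i> turns two such bounds into a bound uniform over all
          directions.\<close>
        have "(h, 0) = Re h *\<^sub>R (1, 0) + Im h *\<^sub>R (\<i>, 0 :: 'v)" by (simp add: complex_eq_iff)
        then have "H' (y, z) (h, 0) = Re h * H' (y, z) (1, 0) + Im h * H' (y, z) (\<i>, 0)"
          using lin by (simp add: linear_add linear_cmul del: scaleR_Pair add_Pair)
        also have "\<bar>\<dots>\<bar> \<le> \<bar>Re h\<bar> * \<bar>H' (y, z) (1, 0)\<bar> + \<bar>Im h\<bar> * \<bar>H' (y, z) (\<i>, 0)\<bar>"
          by (metis abs_mult abs_triangle_ineq)
        also have "\<dots> \<le> cmod h * C1 + cmod h * C2"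
          using C1 C2 yz by (intro add_mono mult_mono) (auto simp: abs_Re_le_cmod abs_Im_le_cmod)
        finally show "norm (H' (y, z) (h, 0)) \<le> (C1 + C2) * norm h" by (simp add: algebra_simps)
      next
        show "integrable ?M (\<lambda>z. H (y, z))" if "y \<in> ball \<tau> e" for y
          using that e by (intro int cont) auto
      qed (use e fin in \<open>auto simp: finite_measure.integrable_const\<close>)
    qed
  qed
qed

section \<open>Second derivatives and the coefficient of the Laplacian\<close>

text \<open>Connects the iterated one-variable \<open>deriv\<close> in the definition of
  \<open>ddbar_coeff\<close> with components of Frechet derivatives.\<close>

lemma ddbar_coeff_eq:
  assumes S: "open S" "\<tau> \<in> S" and f: "\<And>z. z \<in> S \<Longrightarrow> (f has_derivative D z) (at z)"
    and D1: "((\<lambda>z. D z 1) has_derivative D1) (at \<tau>)" and D2: "((\<lambda>z. D z \<i>) has_derivative D2) (at \<tau>)"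
  shows "ddbar_coeff f \<tau> = (D1 1 + D2 \<i>) / 4"
proof -
  have cx: "((\<lambda>t. Complex t y) has_derivative (\<lambda>t. of_real t)) (at s)" for s y :: real
    unfolding Complex_eq by (auto intro!: derivative_eq_intros)
  have cy: "((\<lambda>t. Complex x t) has_derivative (\<lambda>t. \<i> * of_real t)) (at s)" for s x :: real
    unfolding Complex_eq by (auto intro!: derivative_eq_intros)
  have lin: "A (of_real t * v) = t * A v" if "(g has_derivative A) (at z)" for A g t v and z :: complex
    using linear_cmul[OF has_derivative_linear[OF that], of t v] by (simp add: scaleR_conv_of_real)
  have dx: "((\<lambda>t. g (Complex t y)) has_real_derivative A 1) (at s)" if "(g has_derivative A) (at (Complex s y))" 
    for g :: "complex \<Rightarrow> real" and A s y
    using has_derivative_compose[OF cx that] lin[OF that, of _ 1] 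
    by (simp add: has_field_derivative_def mult_commute_abs)
  have dy: "((\<lambda>t. g (Complex x t)) has_real_derivative A \<i>) (at s)" if "(g has_derivative A) (at (Complex x s))" 
    for g :: "complex \<Rightarrow> real" and A s x
    using has_derivative_compose[OF cy that] lin[OF that, of _ \<i>] 
    by (simp add: has_field_derivative_def mult_commute_abs mult.commute[of \<i>])
  \<comment> \<open>The inner derivative has to be identified on a whole neighbourhood before the
    outer one is taken.\<close>
  have ox: "\<forall>\<^sub>F s in nhds (Re \<tau>). Complex s (Im \<tau>) \<in> S"
  proof -
    have "isCont (\<lambda>s. Complex s (Im \<tau>)) (Re \<tau>)" using cx has_derivative_continuous by blast
    then have "((\<lambda>s. Complex s (Im \<tau>)) \<longlongrightarrow> \<tau>) (nhds (Re \<tau>))" by (simp add: isCont_def tendsto_nhds_iff)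
    then show ?thesis using S by (simp add: topological_tendstoD)
  qed
  have oy: "\<forall>\<^sub>F s in nhds (Im \<tau>). Complex (Re \<tau>) s \<in> S"
  proof -
    have "isCont (\<lambda>s. Complex (Re \<tau>) s) (Im \<tau>)" using cy has_derivative_continuous by blast
    then have "((\<lambda>s. Complex (Re \<tau>) s) \<longlongrightarrow> \<tau>) (nhds (Im \<tau>))" by (simp add: isCont_def tendsto_nhds_iff)
    then show ?thesis using S by (simp add: topological_tendstoD)
  qed
  have "deriv (\<lambda>s. deriv (\<lambda>t. f (Complex t (Im \<tau>))) s) (Re \<tau>) = deriv (\<lambda>s. D (Complex s (Im \<tau>)) 1) (Re \<tau>)"
    by (rule deriv_cong_ev[OF eventually_mono[OF ox] refl]) (auto intro!: DERIV_imp_deriv dx f)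
  also have "\<dots> = D1 1" by (rule DERIV_imp_deriv, rule dx) (simp add: D1)
  finally have 1: "deriv (\<lambda>s. deriv (\<lambda>t. f (Complex t (Im \<tau>))) s) (Re \<tau>) = D1 1" .
  have "deriv (\<lambda>s. deriv (\<lambda>t. f (Complex (Re \<tau>) t)) s) (Im \<tau>) = deriv (\<lambda>s. D (Complex (Re \<tau>) s) \<i>) (Im \<tau>)"
    by (rule deriv_cong_ev[OF eventually_mono[OF oy] refl]) (auto intro!: DERIV_imp_deriv dy f)
  also have "\<dots> = D2 \<i>" by (rule DERIV_imp_deriv, rule dy) (simp add: D2)
  finally show ?thesis using 1 by (simp add: ddbar_coeff_def)
qed

lemma Ck_on_2_partials:
  fixes f :: "complex \<Rightarrow> real"
  assumes "open S" "Ck_on 2 f S"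
  obtains D D1 D2 where
    "\<And>z. z \<in> S \<Longrightarrow> (f has_derivative D z) (at z)"
    "\<And>z. z \<in> S \<Longrightarrow> ((\<lambda>z. D z 1) has_derivative D1 z) (at z)"
    "\<And>z. z \<in> S \<Longrightarrow> ((\<lambda>z. D z \<i>) has_derivative D2 z) (at z)"
    "continuous_on S f" "continuous_on S (\<lambda>z. D z 1)" "continuous_on S (\<lambda>z. D z \<i>)"
    "continuous_on S (\<lambda>z. D1 z 1)" "continuous_on S (\<lambda>z. D2 z \<i>)"
    "\<And>z. z \<in> S \<Longrightarrow> ddbar_coeff f z = (D1 z 1 + D2 z \<i>) / 4"
proof -
  have 2: "Ck_on (Suc (Suc 0)) f S" using assms(2) by (simp add: numeral_2_eq_2)
  obtain D where D: "\<And>z. z \<in> S \<Longrightarrow> (f has_derivative D z) (at z)" "\<And>v. Ck_on (Suc 0) (\<lambda>z. D z v) S"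
    using 2 by (rule Ck_on_SucE) (rule that)
  obtain D1 where D1: "\<And>z. z \<in> S \<Longrightarrow> ((\<lambda>z. D z 1) has_derivative D1 z) (at z)" "\<And>v. Ck_on 0 (\<lambda>z. D1 z v) S"
    using D(2)[of 1] by (rule Ck_on_SucE) (rule that)
  obtain D2 where D2: "\<And>z. z \<in> S \<Longrightarrow> ((\<lambda>z. D z \<i>) has_derivative D2 z) (at z)" "\<And>v. Ck_on 0 (\<lambda>z. D2 z v) S"
    using D(2)[of \<i>] by (rule Ck_on_SucE) (rule that)
  have dd: "ddbar_coeff f z = (D1 z 1 + D2 z \<i>) / 4" if "z \<in> S" for z
    using D(1) D1(1)[OF that] D2(1)[OF that] by (rule ddbar_coeff_eq[OF assms(1) that])
  show thesis
    by (rule that[OF D(1) D1(1) D2(1) Ck_on_continuous_on[OF assms(2)] Ck_on_continuous_on[OF D(2)] Ck_on_continuous_on[OF D(2)]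
          Ck_on_continuous_on[OF D1(2)] Ck_on_continuous_on[OF D2(2)] dd])
qed

text \<open>Each of the two derivatives brings out one factor r. This square is what makes the mass
  small on small discs.\<close>

lemma ddbar_coeff_scale:
  fixes f :: "complex \<Rightarrow> real"
  assumes "open S" "Ck_on 2 f S" "a + of_real r * z \<in> S"
  shows "ddbar_coeff (\<lambda>z. f (a + of_real r * z)) z = r\<^sup>2 * ddbar_coeff f (a + of_real r * z)"
proof -
  obtain D D1 D2 where D: "\<And>z. z \<in> S \<Longrightarrow> (f has_derivative D z) (at z)"
    and D1: "\<And>z. z \<in> S \<Longrightarrow> ((\<lambda>z. D z 1) has_derivative D1 z) (at z)"
    and D2: "\<And>z. z \<in> S \<Longrightarrow> ((\<lambda>z. D z \<i>) has_derivative D2 z) (at z)"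
    and dd: "\<And>z. z \<in> S \<Longrightarrow> ddbar_coeff f z = (D1 z 1 + D2 z \<i>) / 4"
    by (rule Ck_on_2_partials[OF assms(1,2)]) (rule that)
  let ?A = "\<lambda>z. a + of_real r * z"
  have A: "(?A has_derivative (\<lambda>v. of_real r * v)) (at z)" for z
    by (auto intro!: derivative_eq_intros)
  have lin: "B (of_real r * v) = r * B v" if "(g has_derivative B) (at z)" for B and g :: "complex \<Rightarrow> real" and v z
    using linear_cmul[OF has_derivative_linear[OF that], of r v] by (simp add: scaleR_conv_of_real)
  have D1z: "((\<lambda>z. D z 1) has_derivative D1 (?A z)) (at (?A z))" by (rule D1[OF assms(3)])
  have D2z: "((\<lambda>z. D z \<i>) has_derivative D2 (?A z)) (at (?A z))" by (rule D2[OF assms(3)])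
  define S' where "S' = ?A -` S"
  have S': "open S'" "z \<in> S'" unfolding S'_def using assms by (auto intro!: open_vimage continuous_intros)
  have "ddbar_coeff (\<lambda>z. f (?A z)) z = (r * (r * D1 (?A z) 1) + r * (r * D2 (?A z) \<i>)) / 4"
  proof (rule ddbar_coeff_eq[OF S', of _ "\<lambda>z v. r * D (?A z) v" "\<lambda>v. r * (r * D1 (?A z) v)" "\<lambda>v. r * (r * D2 (?A z) v)"])
    fix w assume "w \<in> S'"
    then have w: "(f has_derivative D (?A w)) (at (?A w))" using D by (simp add: S'_def)
    have eq: "(\<lambda>v. D (?A w) (of_real r * v)) = (\<lambda>v. r * D (?A w) v)" by (rule ext) (rule lin[OF w])
    show "((\<lambda>z. f (?A z)) has_derivative (\<lambda>v. r * D (?A w) v)) (at w)"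
      using has_derivative_compose[OF A[of w], of f, OF w] unfolding eq .
  next
    have eq: "(\<lambda>v. D1 (?A z) (of_real r * v)) = (\<lambda>v. r * D1 (?A z) v)" by (rule ext) (rule lin[OF D1[OF assms(3)]])
    show "((\<lambda>z. r * D (?A z) 1) has_derivative (\<lambda>v. r * (r * D1 (?A z) v))) (at z)"
    proof (rule has_derivative_mult_right)
      have "((\<lambda>z. D (?A z) 1) has_derivative (\<lambda>v. D1 (?A z) (of_real r * v))) (at z)"
        by (rule has_derivative_compose[OF A D1z])
      then show "((\<lambda>z. D (?A z) 1) has_derivative (\<lambda>v. r * D1 (?A z) v)) (at z)" unfolding eq .
    qed
  next
    have eq: "(\<lambda>v. D2 (?A z) (of_real r * v)) = (\<lambda>v. r * D2 (?A z) v)" by (rule ext) (rule lin[OF D2[OF assms(3)]])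
    show "((\<lambda>z. r * D (?A z) \<i>) has_derivative (\<lambda>v. r * (r * D2 (?A z) v))) (at z)"
    proof (rule has_derivative_mult_right)
      have "((\<lambda>z. D (?A z) \<i>) has_derivative (\<lambda>v. D2 (?A z) (of_real r * v))) (at z)"
        by (rule has_derivative_compose[OF A D2z])
      then show "((\<lambda>z. D (?A z) \<i>) has_derivative (\<lambda>v. r * D2 (?A z) v)) (at z)" unfolding eq .
    qed
  qed
  also have "\<dots> = r\<^sup>2 * ddbar_coeff f (?A z)" unfolding dd[OF assms(3)] by (simp only: power2_eq_square) algebra
  finally show ?thesis .
qed

text \<open>Building block of the cut-off function; 3 is the least integer power of the positive
  part that is C^2. The derivative rule is proved for the exponent n + 2 so that n = 1 and n = 0
  give the two successive derivatives.\<close>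

lemma Ck_on_2_truncated_cube: "Ck_on 2 (\<lambda>s::real. (max 0 s) ^ 3) UNIV"
proof -
  have d: "((\<lambda>s. (max 0 s) ^ (n + 2)) has_derivative (\<lambda>v. (real (n + 2) * (max 0 s) ^ (n + 1)) * v)) (at s)" for n and s :: real
  proof -
    consider "s < 0" | "s = 0" | "s > 0" by linarith
    then have "((\<lambda>s. (max 0 s) ^ (n + 2)) has_real_derivative real (n + 2) * (max 0 s) ^ (n + 1)) (at s)"
    proof cases
      case 1
      have "((\<lambda>s::real. 0) has_real_derivative 0) (at s)" by simp
      then have "((\<lambda>s. (max 0 s) ^ (n + 2)) has_real_derivative 0) (at s)"
        by (rule DERIV_cong_ev[THEN iffD1, rotated -1]) (use 1 in \<open>auto intro!: eventually_mono[OF eventually_nhds_in_open[of "{..<0}"]]\<close>)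
      then show ?thesis using 1 by simp
    next
      case 2
      have "((\<lambda>h. ((max 0 (0 + h)) ^ (n + 2) - (max 0 0) ^ (n + 2)) / h) \<longlongrightarrow> (0::real)) (at 0)"
      proof (rule Lim_null_comparison[where g = "\<lambda>h. \<bar>h\<bar> ^ (n + 1)"])
        show "\<forall>\<^sub>F h::real in at 0. norm (((max 0 (0 + h)) ^ (n + 2) - (max 0 0) ^ (n + 2)) / h) \<le> \<bar>h\<bar> ^ (n + 1)"
        proof (rule always_eventually, rule allI)
          fix h :: real
          have "norm (((max 0 (0 + h)) ^ (n + 2) - (max 0 0) ^ (n + 2)) / h) = (max 0 h) ^ (n + 2) / \<bar>h\<bar>" by simp
          also have "\<dots> \<le> \<bar>h\<bar> ^ (n + 2) / \<bar>h\<bar>" by (intro divide_right_mono power_mono) auto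
          also have "\<dots> \<le> \<bar>h\<bar> ^ (n + 1)" by simp
          finally show "norm (((max 0 (0 + h)) ^ (n + 2) - (max 0 0) ^ (n + 2)) / h) \<le> \<bar>h\<bar> ^ (n + 1)" .
        qed
        have "((\<lambda>h::real. \<bar>h\<bar> ^ (n + 1)) \<longlongrightarrow> \<bar>0\<bar> ^ (n + 1)) (at 0)" by (intro tendsto_intros)
        then show "((\<lambda>h::real. \<bar>h\<bar> ^ (n + 1)) \<longlongrightarrow> 0) (at 0)" by simp
      qed
      then show ?thesis using 2 by (simp add: DERIV_def)
    next
      case 3
      have "((\<lambda>s. s ^ (n + 2)) has_real_derivative real (n + 2) * s ^ (n + 1)) (at s)"
        using DERIV_pow[of "n + 2" s] by simp
      then have "((\<lambda>s. (max 0 s) ^ (n + 2)) has_real_derivative real (n + 2) * s ^ (n + 1)) (at s)"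
        by (rule DERIV_cong_ev[THEN iffD1, rotated -1]) (use 3 in \<open>auto intro!: eventually_mono[OF eventually_nhds_in_open[of "{0<..}"]]\<close>)
      then show ?thesis using 3 by simp
    qed
    then show ?thesis by (simp add: has_field_derivative_def)
  qed
  have c: "Ck_on 0 (\<lambda>s::real. (real m * (max 0 s) ^ k) * v) UNIV" for m k v
    by (auto intro!: continuous_intros)
  have 1: "Ck_on (Suc 0) (\<lambda>s::real. (max 0 s) ^ (0 + 2)) UNIV"
    by (rule Ck_on_SucI[OF d c])
  have "Ck_on (Suc (Suc 0)) (\<lambda>s::real. (max 0 s) ^ (1 + 2)) UNIV"
  proof (rule Ck_on_SucI[OF d])
    show "Ck_on (Suc 0) (\<lambda>s::real. (real (1 + 2) * (max 0 s) ^ (1 + 1)) * v) UNIV" for v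
      using 1 by (intro Ck_on_mult Ck_on_const) (simp add: numeral_2_eq_2)
  qed
  then show ?thesis by (simp add: numeral_2_eq_2 numeral_3_eq_3)
qed

section \<open>Estimates of the extremal quantity\<close>

lemma has_real_derivative_along:
  fixes f :: "complex \<Rightarrow> real"
  assumes "(f has_derivative A) (at z)"
  shows "((\<lambda>t. f (z + t *\<^sub>R e)) has_real_derivative A e) (at 0)"
proof -
  have "((\<lambda>t. z + t *\<^sub>R e) has_derivative (\<lambda>t. t *\<^sub>R e)) (at 0)"
    by (auto intro!: derivative_eq_intros)
  moreover have "(f has_derivative A) (at (z + 0 *\<^sub>R e))" using assms by simp
  ultimately have "((\<lambda>t. f (z + t *\<^sub>R e)) has_derivative (\<lambda>t. A (t *\<^sub>R e))) (at 0)"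
    by (rule has_derivative_compose)
  moreover have "(\<lambda>t. A (t *\<^sub>R e)) = (*) (A e)"
    using linear_cmul[OF has_derivative_linear[OF assms]] by (auto simp: mult.commute)
  ultimately show ?thesis by (simp add: has_field_derivative_def)
qed

text \<open>The weight is cut off outside the unit disc, where the Laplacian may do anything, so the
  potential representation becomes available without changing the weight on the disc.
  \<open>ddbar_coeff\<close> is a quarter of the Laplacian, hence 1/2 in place of 2.\<close>

lemma disc_subharmonic_extension_Ck:
  fixes u :: "complex \<Rightarrow> real"
  assumes u: "Ck_on 2 u (ball 0 2)"
    and lap: "\<And>z. cmod z < 1 \<Longrightarrow> 0 \<le> ddbar_coeff u z" "\<And>z. cmod z < 1 \<Longrightarrow> ddbar_coeff u z \<le> 1 / 2"
  obtains F where "F holomorphic_on ball 0 1" "F 0 = 0"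
    "(\<integral>\<^sup>+z. ennreal (exp (2 * Re (F z) - u z + u 0)) * indicator (ball 0 1) z \<partial>lborel) \<le> ennreal pi"
proof -
  define p where "p = (\<lambda>s::real. (max 0 s) ^ 3)"
  define q where "q = (\<lambda>z. Re z * Re z + Im z * Im z)"
  have q: "q z = (cmod z)\<^sup>2" for z unfolding cmod_power2 q_def by (simp add: power2_eq_square)
  \<comment> \<open>A C^2 cut-off. For |z| \<le> 1 the inner p vanishes and p(1) = 1 remains; for
    |z| > 3/2 one has |z|^2 - 1 \<ge> 1, so the outer argument is nonpositive.\<close>
  define \<theta> where "\<theta> = (\<lambda>z. p (1 + (- 1) * p (q z + (- 1))))"
  have pC: "Ck_on 2 p UNIV" unfolding p_def by (rule Ck_on_2_truncated_cube)
  have qC: "Ck_on 2 q UNIV" unfolding q_def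
    by (intro Ck_on_add Ck_on_mult Ck_on_bounded_linear bounded_linear_Re bounded_linear_Im)
  have "Ck_on 2 (\<lambda>z. p (q z + (- 1))) UNIV"
    by (rule Ck_on_compose[OF Ck_on_add[OF qC Ck_on_const] pC]) simp
  then have "Ck_on 2 (\<lambda>z. 1 + (- 1) * p (q z + (- 1))) UNIV"
    by (intro Ck_on_add Ck_on_mult Ck_on_const)
  from Ck_on_compose[OF this pC] have \<theta>C: "Ck_on 2 \<theta> UNIV" unfolding \<theta>_def by simp
  have \<theta>1: "\<theta> z = 1" if "cmod z \<le> 1" for z
  proof -
    have "q z \<le> 1" using that by (simp add: q power_le_one)
    then show ?thesis by (simp add: \<theta>_def p_def)
  qed
  have \<theta>0: "\<theta> z = 0" if "3 / 2 < cmod z" for z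
  proof -
    have "(3 / 2)\<^sup>2 \<le> (cmod z)\<^sup>2" using that by (intro power_mono) auto
    then have "1 \<le> q z - 1" by (simp add: q power2_eq_square)
    then have "1 \<le> (q z - 1) ^ 3" by (rule one_le_power)
    then have "1 \<le> p (q z + (- 1))" using \<open>1 \<le> q z - 1\<close> by (simp add: p_def)
    then show ?thesis by (simp add: \<theta>_def p_def)
  qed
  \<comment> \<open>The product already vanishes on 3/2 < |z| < 2, so its extension by zero is
    patched on an open overlap.\<close>
  define f where "f = (\<lambda>z. if cmod z < 2 then \<theta> z * u z else 0)"
  define T where "T = {z::complex. 3 / 2 < cmod z}"
  have T: "open T" unfolding T_def by (intro open_Collect_less continuous_intros)
  have fT: "f z = 0" if "z \<in> T" for z using that \<theta>0 by (simp add: f_def T_def)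
  have f1: "f z = u z" if "cmod z < 1" for z using that \<theta>1 by (simp add: f_def)
  have "Ck_on 2 f (ball 0 2 \<union> T)"
  proof (rule Ck_on_Un[OF open_ball T])
    show "Ck_on 2 f (ball 0 2)"
      by (rule Ck_on_cong[OF open_ball _ Ck_on_mult[OF Ck_on_subset[OF \<theta>C subset_UNIV] u]]) (simp add: f_def)
    show "Ck_on 2 f T"
      by (rule Ck_on_cong[OF T _ Ck_on_const[of 2 0]]) (simp add: fT)
  qed
  moreover have "ball 0 2 \<union> T = UNIV" by (auto simp: T_def)
  ultimately have fC: "Ck_on 2 f UNIV" by simp
  obtain D D1 D2 where D: "\<And>z. z \<in> UNIV \<Longrightarrow> (f has_derivative D z) (at z)"
    and D1: "\<And>z. z \<in> UNIV \<Longrightarrow> ((\<lambda>z. D z 1) has_derivative D1 z) (at z)"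
    and D2: "\<And>z. z \<in> UNIV \<Longrightarrow> ((\<lambda>z. D z \<i>) has_derivative D2 z) (at z)"
    and cont: "continuous_on UNIV f" "continuous_on UNIV (\<lambda>z. D z 1)" "continuous_on UNIV (\<lambda>z. D z \<i>)"
    "continuous_on UNIV (\<lambda>z. D1 z 1)" "continuous_on UNIV (\<lambda>z. D2 z \<i>)"
    and dd: "\<And>z. z \<in> UNIV \<Longrightarrow> ddbar_coeff f z = (D1 z 1 + D2 z \<i>) / 4"
    by (rule Ck_on_2_partials[OF open_UNIV fC]) (rule that)
  \<comment> \<open>Derivatives of a function vanishing on an open set vanish there too; this
    supplies the support conditions for all the partials.\<close>
  have van: "A = (\<lambda>_. 0)" if "(g has_derivative A) (at z)" "z \<in> T" "\<And>z. z \<in> T \<Longrightarrow> g z = 0" for g :: "complex \<Rightarrow> real" and A z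
  proof -
    have "(g has_derivative (\<lambda>_. 0)) (at z)"
      by (rule has_derivative_transform_within_open[OF has_derivative_const[of 0] T that(2)]) (simp add: that(3))
    then show ?thesis using has_derivative_unique[OF that(1)] by blast
  qed
  have DT: "D z = (\<lambda>_. 0)" if "z \<in> T" for z using van[OF D[OF UNIV_I] that] fT by blast
  have D1T: "D1 z = (\<lambda>_. 0)" if "z \<in> T" for z using van[OF D1[OF UNIV_I] that] by (simp add: DT)
  have D2T: "D2 z = (\<lambda>_. 0)" if "z \<in> T" for z using van[OF D2[OF UNIV_I] that] by (simp add: DT)
  have inT: "z \<in> T" if "2 \<le> cmod z" for z using that by (simp add: T_def)
  have ddu: "ddbar_coeff u z = (D1 z 1 + D2 z \<i>) / 4" if z: "cmod z < 1" for z
  proof (rule ddbar_coeff_eq[of "ball 0 1" _ _ D])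
    fix w :: complex assume w: "w \<in> ball 0 1"
    show "(u has_derivative D w) (at w)"
      by (rule has_derivative_transform_within_open[OF D[OF UNIV_I] open_ball w]) (simp add: f1)
  qed (use z D1 D2 in auto)
  obtain F where F: "F holomorphic_on ball 0 1" "F 0 = 0"
    "(\<integral>\<^sup>+z. ennreal (exp (2 * Re (F z) - f z + f 0)) * indicator (ball 0 1) z \<partial>lborel) \<le> ennreal pi"
  proof (rule disc_subharmonic_extension[of f "\<lambda>z. D z 1" "\<lambda>z. D1 z 1" "\<lambda>z. D z \<i>" "\<lambda>z. D2 z \<i>" 2])
    show "0 \<le> D1 z 1 + D2 z \<i>" if "cmod z < 1" for z using lap(1)[OF that] ddu[OF that] by simp
    show "D1 z 1 + D2 z \<i> \<le> 2" if "cmod z < 1" for z using lap(2)[OF that] ddu[OF that] by simp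
  qed (auto intro!: has_real_derivative_along D D1 D2 cont that simp: inT fT DT D1T D2T)
  have "(\<integral>\<^sup>+z. ennreal (exp (2 * Re (F z) - u z + u 0)) * indicator (ball 0 1) z \<partial>lborel)
     = (\<integral>\<^sup>+z. ennreal (exp (2 * Re (F z) - f z + f 0)) * indicator (ball 0 1) z \<partial>lborel)"
    by (intro nn_integral_cong) (auto simp: indicator_def f1)
  then show thesis using that F by simp
qed

section \<open>From weighted integrals to the extremal quantity\<close>

lemma nn_integral_complex_affine:
  fixes h :: "complex \<Rightarrow> ennreal"
  assumes [measurable]: "h \<in> borel_measurable borel" and r: "0 < r"
  shows "(\<integral>\<^sup>+z. h z \<partial>lborel) = ennreal (r\<^sup>2) * (\<integral>\<^sup>+z. h (a + of_real r * z) \<partial>lborel)"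
proof -
  have "(\<integral>\<^sup>+z. h z \<partial>lborel) = (\<integral>\<^sup>+z. h z \<partial>density (distr lborel borel (\<lambda>x. a + r *\<^sub>R x)) (\<lambda>_. ennreal (r\<^sup>2)))"
    using lborel_affine[of r a] r by (simp add: ennreal_power)
  also have "\<dots> = (\<integral>\<^sup>+z. ennreal (r\<^sup>2) * h z \<partial>distr lborel borel (\<lambda>x. a + r *\<^sub>R x))"
    by (subst nn_integral_density) auto
  also have "\<dots> = (\<integral>\<^sup>+z. ennreal (r\<^sup>2) * h (a + r *\<^sub>R z) \<partial>lborel)"
    by (subst nn_integral_distr) auto
  finally show ?thesis by (simp add: nn_integral_cmult scaleR_conv_of_real)
qed

lemma weighted_square_measurable:
  assumes "open S" "continuous_on S \<Phi>" "f holomorphic_on S"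
  shows "(\<lambda>\<tau>. (cmod (f \<tau>))\<^sup>2 * exp (- \<Phi> \<tau>) * indicator S \<tau>) \<in> borel_measurable borel"
proof -
  have "continuous_on S (\<lambda>\<tau>. (cmod (f \<tau>))\<^sup>2 * exp (- \<Phi> \<tau>))"
    by (intro continuous_intros assms(2) holomorphic_on_imp_continuous_on[OF assms(3)])
  from borel_measurable_continuous_on_indicator[OF _ this] show ?thesis
    using assms(1) by (simp add: mult.commute)
qed

text \<open>\<open>L_Phi\<close> is phrased with gauge integrals, whereas the estimates are carried
  out with \<open>nn_integral\<close>; here a bound on the latter is converted.\<close>

lemma weighted_square_has_integral:
  assumes "open S" "continuous_on S \<Phi>" "f holomorphic_on S"
    and K: "(\<integral>\<^sup>+\<tau>. ennreal ((cmod (f \<tau>))\<^sup>2 * exp (- \<Phi> \<tau>)) * indicator S \<tau> \<partial>lborel) \<le> ennreal K" "0 \<le> K"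
  shows "(\<lambda>\<tau>. (cmod (f \<tau>))\<^sup>2 * exp (- \<Phi> \<tau>)) integrable_on S" "integral S (\<lambda>\<tau>. (cmod (f \<tau>))\<^sup>2 * exp (- \<Phi> \<tau>)) \<le> K"
proof -
  let ?g = "\<lambda>\<tau>. (cmod (f \<tau>))\<^sup>2 * exp (- \<Phi> \<tau>)"
  have e: "(\<integral>\<^sup>+\<tau>. ennreal (?g \<tau> * indicator S \<tau>) \<partial>lborel) = (\<integral>\<^sup>+\<tau>. ennreal (?g \<tau>) * indicator S \<tau> \<partial>lborel)"
    by (intro nn_integral_cong) (auto simp: indicator_def)
  define I where "I = enn2real (\<integral>\<^sup>+\<tau>. ennreal (?g \<tau> * indicator S \<tau>) \<partial>lborel)"
  have "(\<integral>\<^sup>+\<tau>. ennreal (?g \<tau> * indicator S \<tau>) \<partial>lborel) < \<infinity>"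
    using K(1) unfolding e by (simp add: order_le_less_trans)
  then have I: "(\<integral>\<^sup>+\<tau>. ennreal (?g \<tau> * indicator S \<tau>) \<partial>lborel) = ennreal I" "0 \<le> I"
    by (simp_all add: I_def)
  then have "I \<le> K" using K unfolding e by simp
  have "((\<lambda>\<tau>. ?g \<tau> * indicator S \<tau>) has_integral I) UNIV"
    by (rule nn_integral_has_integral[OF weighted_square_measurable[OF assms(1-3)] _ I]) simp
  moreover have "(\<lambda>\<tau>. ?g \<tau> * indicator S \<tau>) = (\<lambda>\<tau>. if \<tau> \<in> S then ?g \<tau> else 0)" by auto
  ultimately have "(?g has_integral I) S" by (simp add: has_integral_restrict_UNIV)
  then show "?g integrable_on S" "integral S ?g \<le> K" using \<open>I \<le> K\<close> by (auto simp: integral_unique)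
qed

lemma L_Phi_le:
  assumes r: "0 < r" and \<Phi>: "continuous_on (ball a r) \<Phi>" and f: "f holomorphic_on ball a r" "f a = 1"
    and K: "(\<integral>\<^sup>+\<tau>. ennreal ((cmod (f \<tau>))\<^sup>2 * exp (- \<Phi> \<tau>)) * indicator (ball a r) \<tau> \<partial>lborel)
       \<le> ennreal (K * (pi * r\<^sup>2 * exp (- \<Phi> a)))" "0 \<le> K"
  shows "L_Phi \<Phi> a r \<le> K"
proof -
  let ?N = "pi * r\<^sup>2 * exp (- \<Phi> a)"
  have N: "0 < ?N" using r by simp
  note wi = weighted_square_has_integral[OF open_ball \<Phi> f(1) K(1)]
  have "L_Phi \<Phi> a r \<le> integral (ball a r) (\<lambda>\<tau>. (cmod (f \<tau>))\<^sup>2 * exp (- \<Phi> \<tau>)) / ?N"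
    unfolding L_Phi_def
  proof (rule cInf_lower)
    show "bdd_below {integral (ball a r) (\<lambda>\<tau>. (cmod (f \<tau>))\<^sup>2 * exp (- \<Phi> \<tau>)) / ?N | f.
        f holomorphic_on ball a r \<and> (\<lambda>\<tau>. (cmod (f \<tau>))\<^sup>2 * exp (- \<Phi> \<tau>)) integrable_on ball a r \<and> f a = 1}"
      by (rule bdd_belowI[of _ 0]) (auto intro!: divide_nonneg_nonneg Henstock_Kurzweil_Integration.integral_nonneg)
  qed (use f wi N K in auto)
  also have "\<dots> \<le> K"
    using wi(2) N K(2) by (simp add: pos_divide_le_eq)
  finally show ?thesis .
qed

text \<open>Rescales the disc to the unit disc and pulls exp F back. The double radius in the
  smoothness hypothesis is the room for the cut-off, and the factor r^2 in the upper bound comes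
  from scaling the Laplacian.\<close>

lemma L_Phi_le_1:
  fixes \<Phi> :: "complex \<Rightarrow> real"
  assumes r: "0 < r" and \<Phi>: "Ck_on 2 \<Phi> (ball a (2 * r))"
    and lap: "\<And>\<tau>. \<tau> \<in> ball a r \<Longrightarrow> 0 \<le> ddbar_coeff \<Phi> \<tau>" "\<And>\<tau>. \<tau> \<in> ball a r \<Longrightarrow> r\<^sup>2 * ddbar_coeff \<Phi> \<tau> \<le> 1 / 2"
  shows "L_Phi \<Phi> a r \<le> 1"
proof -
  define u where "u = (\<lambda>z. \<Phi> (a + of_real r * z))"
  have mem: "a + of_real r * z \<in> ball a (s * r) \<longleftrightarrow> cmod z < s" for z s
    using r by (simp add: dist_norm norm_mult mult.commute[of r])
  have bl: "bounded_linear ((*) (complex_of_real r))" by (rule bounded_linear_mult_right)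
  have "Ck_on 2 u {z. a + of_real r * z \<in> ball a (2 * r)}"
    unfolding u_def by (rule Ck_on_affine_compose[OF bl \<Phi>])
  moreover have "{z. a + of_real r * z \<in> ball a (2 * r)} = ball 0 2" using mem by auto
  ultimately have uC: "Ck_on 2 u (ball 0 2)" by simp
  have ddu: "ddbar_coeff u z = r\<^sup>2 * ddbar_coeff \<Phi> (a + of_real r * z)" if "cmod z < 1" for z
    unfolding u_def by (rule ddbar_coeff_scale[OF open_ball \<Phi>]) (use mem[of z 2] that in simp)
  obtain F where F: "F holomorphic_on ball 0 1" "F 0 = 0"
    "(\<integral>\<^sup>+z. ennreal (exp (2 * Re (F z) - u z + u 0)) * indicator (ball 0 1) z \<partial>lborel) \<le> ennreal pi"
  proof (rule disc_subharmonic_extension_Ck[OF uC])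
    fix z assume z: "cmod z < 1"
    then have "a + of_real r * z \<in> ball a r" using mem[of z 1] by simp
    from lap[OF this] show "0 \<le> ddbar_coeff u z" "ddbar_coeff u z \<le> 1 / 2" unfolding ddu[OF z] by auto
  qed (rule that)
  define f where "f = (\<lambda>\<tau>. exp (F ((\<tau> - a) / of_real r)))"
  have hf: "f holomorphic_on ball a r"
  proof -
    have "(F \<circ> (\<lambda>\<tau>. (\<tau> - a) / of_real r)) holomorphic_on ball a r"
    proof (rule holomorphic_on_compose_gen[OF _ F(1)])
      show "(\<lambda>\<tau>. (\<tau> - a) / of_real r) ` ball a r \<subseteq> ball 0 1"
        using r by (auto simp: dist_norm norm_divide norm_minus_commute)
    qed (intro holomorphic_intros, use r in simp)
    then have "(\<lambda>\<tau>. F ((\<tau> - a) / of_real r)) holomorphic_on ball a r" by (simp add: o_def)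
    then show ?thesis unfolding f_def by (intro holomorphic_intros)
  qed
  have cont: "continuous_on (ball a r) \<Phi>"
    by (rule continuous_on_subset[OF Ck_on_continuous_on[OF \<Phi>]]) (use r in \<open>intro subset_ball, simp\<close>)
  show ?thesis
  proof (rule L_Phi_le[OF r cont hf])
    show "f a = 1" by (simp add: f_def F)
    let ?h = "\<lambda>\<tau>. ennreal ((cmod (f \<tau>))\<^sup>2 * exp (- \<Phi> \<tau>) * indicator (ball a r) \<tau>)"
    have "(\<integral>\<^sup>+\<tau>. ennreal ((cmod (f \<tau>))\<^sup>2 * exp (- \<Phi> \<tau>)) * indicator (ball a r) \<tau> \<partial>lborel) = (\<integral>\<^sup>+\<tau>. ?h \<tau> \<partial>lborel)"
      by (intro nn_integral_cong) (auto simp: indicator_def)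
    also have "\<dots> = ennreal (r\<^sup>2) * (\<integral>\<^sup>+z. ?h (a + of_real r * z) \<partial>lborel)"
      using weighted_square_measurable[OF open_ball cont hf] by (intro nn_integral_complex_affine r) simp
    also have "(\<integral>\<^sup>+z. ?h (a + of_real r * z) \<partial>lborel)
       = (\<integral>\<^sup>+z. ennreal (exp (- \<Phi> a)) * (ennreal (exp (2 * Re (F z) - u z + u 0)) * indicator (ball 0 1) z) \<partial>lborel)"
    proof (rule nn_integral_cong)
      fix z
      show "?h (a + of_real r * z) = ennreal (exp (- \<Phi> a)) * (ennreal (exp (2 * Re (F z) - u z + u 0)) * indicator (ball 0 1) z)"
      proof (cases "cmod z < 1")
        case True
        have "(cmod (f (a + of_real r * z)))\<^sup>2 * exp (- \<Phi> (a + of_real r * z)) = exp (- \<Phi> a) * exp (2 * Re (F z) - u z + u 0)"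
          using r by (simp add: f_def u_def exp_add[symmetric] power2_eq_square)
        moreover have "a + of_real r * z \<in> ball a r" using mem[of z 1] True by simp
        ultimately show ?thesis using True by (simp add: ennreal_mult'[symmetric])
      next
        case False
        then have "a + of_real r * z \<notin> ball a r" using mem[of z 1] by simp
        then show ?thesis using False by simp
      qed
    qed
    also have "ennreal (r\<^sup>2) * \<dots> \<le> ennreal (r\<^sup>2) * (ennreal (exp (- \<Phi> a)) * ennreal pi)"
    proof (rule mult_left_mono, subst nn_integral_cmult)
      have "continuous_on (ball 0 1) (\<lambda>z. exp (2 * Re (F z) - u z + u 0))"
        by (intro continuous_intros holomorphic_on_imp_continuous_on[OF F(1)] continuous_on_subset[OF Ck_on_continuous_on[OF uC]])
          (intro subset_ball, simp)
      from borel_measurable_continuous_on_indicator[OF _ this]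
      have "(\<lambda>z. indicator (ball 0 1) z *\<^sub>R exp (2 * Re (F z) - u z + u 0)) \<in> borel_measurable borel" by simp
      then have m: "(\<lambda>z. ennreal (indicator (ball 0 1) z *\<^sub>R exp (2 * Re (F z) - u z + u 0))) \<in> borel_measurable lborel" by simp
      have eq: "(\<lambda>z. ennreal (indicator (ball 0 1) z *\<^sub>R exp (2 * Re (F z) - u z + u 0)))
         = (\<lambda>z. ennreal (exp (2 * Re (F z) - u z + u 0)) * indicator (ball 0 1) z)"
        by (auto simp: indicator_def)
      show "(\<lambda>z. ennreal (exp (2 * Re (F z) - u z + u 0)) * indicator (ball 0 1) z) \<in> borel_measurable lborel"
        using m unfolding eq .
    qed (intro mult_left_mono F(3), simp_all)
    finally show "(\<integral>\<^sup>+\<tau>. ennreal ((cmod (f \<tau>))\<^sup>2 * exp (- \<Phi> \<tau>)) * indicator (ball a r) \<tau> \<partial>lborel)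
       \<le> ennreal (1 * (pi * r\<^sup>2 * exp (- \<Phi> a)))"
      by (simp add: ennreal_mult'[symmetric] mult_ac)
  qed simp
qed

section \<open>Second-order asymptotics of the extremal quantity\<close>

text \<open>A real quadratic form on the plane is the sum of a harmonic form Re (B h^2) and a
  multiple of |h|^2, the multiple being half the mean of its two diagonal entries when the form is
  one half of the Hessian.\<close>

lemma taylor_holomorphic_quadratic:
  fixes \<Phi> :: "complex \<Rightarrow> real"
  assumes U: "open U" "a \<in> U" and \<Phi>: "Ck_on 2 \<Phi> U" and \<eta>: "0 < \<eta>"
  obtains \<rho> A B where "0 < \<rho>" "ball a \<rho> \<subseteq> U"
    "\<And>h. cmod h < \<rho> \<Longrightarrow> \<bar>\<Phi> (a + h) - \<Phi> a - Re (A * h + B * h\<^sup>2) - ddbar_coeff \<Phi> a * (cmod h)\<^sup>2\<bar> \<le> \<eta> * (cmod h)\<^sup>2"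
proof -
  obtain D D1 D2 where D: "\<And>z. z \<in> U \<Longrightarrow> (\<Phi> has_derivative D z) (at z)"
    and D1: "\<And>z. z \<in> U \<Longrightarrow> ((\<lambda>z. D z 1) has_derivative D1 z) (at z)"
    and D2: "\<And>z. z \<in> U \<Longrightarrow> ((\<lambda>z. D z \<i>) has_derivative D2 z) (at z)"
    and dd: "\<And>z. z \<in> U \<Longrightarrow> ddbar_coeff \<Phi> z = (D1 z 1 + D2 z \<i>) / 4"
    by (rule Ck_on_2_partials[OF U(1) \<Phi>]) (rule that)
  have lin: "L h = Re h * L 1 + Im h * L \<i>" if "linear L" for L :: "complex \<Rightarrow> real" and h
  proof -
    have "h = Re h *\<^sub>R 1 + Im h *\<^sub>R \<i>" by (simp add: complex_eq_iff)
    then have "L h = L (Re h *\<^sub>R 1 + Im h *\<^sub>R \<i>)" by simp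
    then show ?thesis using that by (simp add: linear_add linear_cmul)
  qed
  note linD = lin[OF has_derivative_linear[OF D]]
  note linD1 = has_derivative_linear[OF D1[OF U(2)]] and linD2 = has_derivative_linear[OF D2[OF U(2)]]
  obtain d0 where d0: "0 < d0" "ball a d0 \<subseteq> U" using U by (meson open_contains_ball)
  have eta2: "0 < \<eta> / 2" using \<eta> by simp
  obtain d1 where d1: "0 < d1" "\<And>y. norm (y - a) < d1 \<Longrightarrow> norm (D y 1 - D a 1 - D1 a (y - a)) \<le> \<eta> / 2 * norm (y - a)"
    using D1[OF U(2)] eta2 unfolding has_derivative_at_alt by blast
  obtain d2 where d2: "0 < d2" "\<And>y. norm (y - a) < d2 \<Longrightarrow> norm (D y \<i> - D a \<i> - D2 a (y - a)) \<le> \<eta> / 2 * norm (y - a)"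
    using D2[OF U(2)] eta2 unfolding has_derivative_at_alt by blast
  define \<rho> where "\<rho> = min d0 (min d1 d2)"
  \<comment> \<open>In Wirtinger notation A is twice the first z-derivative of \<Phi> at a, and B is
    the second z-derivative. \<open>D1 a \<i>\<close> and \<open>D2 a 1\<close> are the two mixed
    partials, of which B takes the mean.\<close>
  define A where "A = Complex (D a 1) (- D a \<i>)"
  define B where "B = Complex ((D1 a 1 - D2 a \<i>) / 4) (- (D1 a \<i> + D2 a 1) / 4)"
  define Q where "Q = (\<lambda>h. Re h * D1 a h + Im h * D2 a h)"
  show thesis
  proof (rule that[of \<rho> A B])
    show "0 < \<rho>" using d0 d1 d2 by (simp add: \<rho>_def)
    show "ball a \<rho> \<subseteq> U" using d0 by (auto simp: \<rho>_def)
    fix h assume h: "cmod h < \<rho>"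
    have hU: "a + s *\<^sub>R h \<in> U" if "0 \<le> s" "s \<le> 1" for s
    proof -
      have "cmod (s *\<^sub>R h) \<le> cmod h" using that by (simp add: mult_left_le_one_le)
      then have "a + s *\<^sub>R h \<in> ball a d0" using h by (simp add: dist_norm \<rho>_def)
      then show ?thesis using d0 by blast
    qed
    \<comment> \<open>\<Phi> along the segment minus its predicted second-order part. The derivative
      of \<phi> is the error in linearising the gradient, so the mean value theorem reduces the
      claim to differentiability of the two partials at a, each with error \<eta>/2.\<close>
    define \<phi> where "\<phi> = (\<lambda>s. \<Phi> (a + s *\<^sub>R h) - s * D a h - s\<^sup>2 / 2 * Q h)"
    have der: "(\<phi> has_real_derivative (D (a + s *\<^sub>R h) h - D a h - s * Q h)) (at s)" if "0 \<le> s" "s \<le> 1" for s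
    proof -
      have "((\<lambda>s. a + s *\<^sub>R h) has_derivative (\<lambda>s. s *\<^sub>R h)) (at s)"
        by (auto intro!: derivative_eq_intros)
      moreover have "(\<Phi> has_derivative D (a + s *\<^sub>R h)) (at (a + s *\<^sub>R h))" by (rule D[OF hU[OF that]])
      ultimately have "((\<lambda>s. \<Phi> (a + s *\<^sub>R h)) has_derivative (\<lambda>t. D (a + s *\<^sub>R h) (t *\<^sub>R h))) (at s)"
        by (rule has_derivative_compose)
      moreover have "(\<lambda>t. D (a + s *\<^sub>R h) (t *\<^sub>R h)) = (*) (D (a + s *\<^sub>R h) h)"
        using linear_cmul[OF has_derivative_linear[OF D[OF hU[OF that]]]] by (auto simp: mult.commute)
      ultimately have 1: "((\<lambda>s. \<Phi> (a + s *\<^sub>R h)) has_real_derivative D (a + s *\<^sub>R h) h) (at s)"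
        by (simp add: has_field_derivative_def)
      have 2: "((\<lambda>s. s * D a h) has_real_derivative D a h) (at s)"
        by (auto intro!: derivative_eq_intros)
      have 3: "((\<lambda>s. s\<^sup>2 / 2 * Q h) has_real_derivative s * Q h) (at s)"
        by (auto intro!: derivative_eq_intros)
      show ?thesis unfolding \<phi>_def by (rule DERIV_diff[OF DERIV_diff[OF 1 2] 3])
    qed
    obtain s where s: "0 < s" "s < 1" "\<phi> 1 - \<phi> 0 = (1 - 0) * (D (a + s *\<^sub>R h) h - D a h - s * Q h)"
      using MVT2[of 0 1 \<phi> "\<lambda>s. D (a + s *\<^sub>R h) h - D a h - s * Q h"] der by auto
    let ?y = "a + s *\<^sub>R h"
    have yU: "?y \<in> U" using hU s by simp
    have ny: "norm (?y - a) \<le> cmod h" using s by (simp add: mult_left_le_one_le)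
    have b1: "\<bar>D ?y 1 - D a 1 - s * D1 a h\<bar> \<le> \<eta> / 2 * cmod h"
    proof -
      have "norm (D ?y 1 - D a 1 - D1 a (?y - a)) \<le> \<eta> / 2 * norm (?y - a)"
        using ny h by (intro d1) (simp add: \<rho>_def)
      also have "\<dots> \<le> \<eta> / 2 * cmod h" using ny \<eta> by (intro mult_left_mono) auto
      finally show ?thesis using linear_cmul[OF linD1] by simp
    qed
    have b2: "\<bar>D ?y \<i> - D a \<i> - s * D2 a h\<bar> \<le> \<eta> / 2 * cmod h"
    proof -
      have "norm (D ?y \<i> - D a \<i> - D2 a (?y - a)) \<le> \<eta> / 2 * norm (?y - a)"
        using ny h by (intro d2) (simp add: \<rho>_def)
      also have "\<dots> \<le> \<eta> / 2 * cmod h" using ny \<eta> by (intro mult_left_mono) auto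
      finally show ?thesis using linear_cmul[OF linD2] by simp
    qed
    have "D ?y h - D a h - s * Q h = Re h * (D ?y 1 - D a 1 - s * D1 a h) + Im h * (D ?y \<i> - D a \<i> - s * D2 a h)"
      unfolding linD[OF yU, of h] linD[OF U(2), of h] Q_def by (simp add: algebra_simps)
    also have "\<bar>\<dots>\<bar> \<le> \<bar>Re h\<bar> * \<bar>D ?y 1 - D a 1 - s * D1 a h\<bar> + \<bar>Im h\<bar> * \<bar>D ?y \<i> - D a \<i> - s * D2 a h\<bar>"
      by (metis abs_mult abs_triangle_ineq)
    also have "\<dots> \<le> cmod h * (\<eta> / 2 * cmod h) + cmod h * (\<eta> / 2 * cmod h)"
      by (intro add_mono mult_mono b1 b2) (auto simp: abs_Re_le_cmod abs_Im_le_cmod)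
    also have "\<dots> = \<eta> * (cmod h)\<^sup>2" by (simp add: power2_eq_square)
    finally have "\<bar>\<phi> 1 - \<phi> 0\<bar> \<le> \<eta> * (cmod h)\<^sup>2" using s(3) by simp
    moreover have "\<phi> 1 - \<phi> 0 = \<Phi> (a + h) - \<Phi> a - Re (A * h + B * h\<^sup>2) - ddbar_coeff \<Phi> a * (cmod h)\<^sup>2"
    proof -
      have "D a h = Re (A * h)" unfolding linD[OF U(2), of h] by (simp add: A_def)
      moreover have "1 / 2 * Q h = Re (B * h\<^sup>2) + ddbar_coeff \<Phi> a * (cmod h)\<^sup>2"
        unfolding Q_def lin[OF linD1, of h] lin[OF linD2, of h] dd[OF U(2)] B_def cmod_power2
        by (simp add: power2_eq_square field_simps)
      moreover have "\<phi> 1 - \<phi> 0 = \<Phi> (a + h) - \<Phi> a - D a h - 1 / 2 * Q h" by (simp add: \<phi>_def)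
      moreover have "Re (A * h + B * h\<^sup>2) = Re (A * h) + Re (B * h\<^sup>2)" by (rule plus_complex.sel(1))
      ultimately show ?thesis by linarith
    qed
    ultimately show "\<bar>\<Phi> (a + h) - \<Phi> a - Re (A * h + B * h\<^sup>2) - ddbar_coeff \<Phi> a * (cmod h)\<^sup>2\<bar> \<le> \<eta> * (cmod h)\<^sup>2"
      by simp
  qed
qed

lemma has_bochner_integral_disc_power:
  assumes "0 \<le> r"
  shows "has_bochner_integral lborel (\<lambda>z::complex. indicator (ball 0 r) z * cmod z ^ n) (2 * pi * r ^ (n + 2) / (n + 2))"
proof (rule has_bochner_integral_nn_integral)
  have "(\<integral>\<^sup>+z. ennreal (indicator (ball 0 r) z * cmod z ^ n) \<partial>lborel) = (\<integral>\<^sup>+z. ennreal (cmod z ^ (n + 1) / cmod z) * indicator (ball 0 r) z \<partial>lborel)"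
  proof (rule nn_integral_cong_AE)
    show "AE z in lborel. ennreal (indicator (ball 0 r) z * cmod z ^ n) = ennreal (cmod z ^ (n + 1) / cmod z) * indicator (ball 0 r) z"
      using AE_lborel_singleton[of 0] by eventually_elim (auto simp: indicator_def)
  qed
  also have "\<dots> = ennreal (2 * pi * r ^ (n + 2) / (n + 2))"
    using nn_integral_disc_power[OF assms, of "n + 1"] by (simp add: add.commute)
  finally show "(\<integral>\<^sup>+z. ennreal (indicator (ball 0 r) z * cmod z ^ n) \<partial>lborel) = ennreal (2 * pi * r ^ (n + 2) / (n + 2))" .
  show "(\<lambda>z::complex. indicator (ball 0 r) z * cmod z ^ n) \<in> borel_measurable lborel"
    by (intro borel_measurable_times borel_measurable_indicator) auto
qed (use assms in auto)

lemma has_bochner_integral_disc_quartic: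
  assumes "0 \<le> r"
  shows "has_bochner_integral lborel (\<lambda>z::complex. indicator (ball 0 r) z * (\<alpha> + \<beta> * (cmod z)\<^sup>2 + \<gamma> * cmod z ^ 4))
    (pi * r\<^sup>2 * (\<alpha> + \<beta> * r\<^sup>2 / 2 + \<gamma> * r ^ 4 / 3))"
proof -
  have "has_bochner_integral lborel (\<lambda>z::complex. \<alpha> * (indicator (ball 0 r) z * cmod z ^ 0) 
      + \<beta> * (indicator (ball 0 r) z * cmod z ^ 2) + \<gamma> * (indicator (ball 0 r) z * cmod z ^ 4))
    (\<alpha> * (2 * pi * r ^ (0 + 2) / (0 + 2)) + \<beta> * (2 * pi * r ^ (2 + 2) / (2 + 2)) + \<gamma> * (2 * pi * r ^ (4 + 2) / (4 + 2)))"
    using has_bochner_integral_disc_power[OF assms, of 0] has_bochner_integral_disc_power[OF assms, of 2]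
      has_bochner_integral_disc_power[OF assms, of 4]
    by (intro has_bochner_integral_add has_bochner_integral_mult_right) simp_all
  moreover have "\<alpha> * (2 * pi * r ^ (0 + 2) / (0 + 2)) + \<beta> * (2 * pi * r ^ (2 + 2) / (2 + 2)) + \<gamma> * (2 * pi * r ^ (4 + 2) / (4 + 2))
    = pi * r\<^sup>2 * (\<alpha> + \<beta> * r\<^sup>2 / 2 + \<gamma> * r ^ 4 / 3)"
    by (simp add: power_numeral_reduce field_simps)
  moreover have "(\<lambda>z::complex. \<alpha> * (indicator (ball 0 r) z * cmod z ^ 0) 
      + \<beta> * (indicator (ball 0 r) z * cmod z ^ 2) + \<gamma> * (indicator (ball 0 r) z * cmod z ^ 4))
     = (\<lambda>z. indicator (ball 0 r) z * (\<alpha> + \<beta> * (cmod z)\<^sup>2 + \<gamma> * cmod z ^ 4))"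
    by (auto simp: algebra_simps)
  ultimately show ?thesis by simp
qed

text \<open>In the power series of F, each monomial of positive degree integrates to 0 against a
  radial weight, so only F(0) remains. The smaller radius \<rho> keeps F bounded on the region of
  integration.\<close>

lemma radial_mean_value:
  fixes w :: "real \<Rightarrow> real"
  assumes F: "F holomorphic_on ball 0 r" and \<rho>: "0 < \<rho>" "\<rho> < r" 
    and w: "continuous_on UNIV w"
  shows "integrable lborel (\<lambda>z. (indicator (ball 0 \<rho>) z * w (cmod z)) *\<^sub>R F z)"
    and "(\<integral>z. (indicator (ball 0 \<rho>) z * w (cmod z)) *\<^sub>R F z \<partial>lborel) = (\<integral>z. indicator (ball 0 \<rho>) z * w (cmod z) \<partial>lborel) *\<^sub>R F 0"
    and "integrable lborel (\<lambda>z::complex. indicator (ball 0 \<rho>) z * w (cmod z))"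
proof -
  define a where "a = (\<lambda>n. (deriv ^^ n) F 0 / fact n)"
  have sums: "(\<lambda>n. a n * z ^ n) sums F z" if "z \<in> ball 0 r" for z
    using holomorphic_power_series[OF F that] by (simp add: a_def)
  have [measurable]: "w \<in> borel_measurable borel" using w by (rule borel_measurable_continuous_onI)
  have [measurable]: "ball (0::complex) \<rho> \<in> sets borel" by simp
  have wi: "integrable lborel (\<lambda>z::complex. indicator (cball 0 \<rho>) z *\<^sub>R w (cmod z))"
    by (rule borel_integrable_compact) (auto intro!: continuous_on_compose2[OF w] continuous_intros)
  show wI: "integrable lborel (\<lambda>z::complex. indicator (ball 0 \<rho>) z * w (cmod z))"
    by (rule Bochner_Integration.integrable_bound[OF wi]) (auto simp: indicator_def)
  let ?W = "\<lambda>z::complex. indicator (ball 0 \<rho>) z * w (cmod z)"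
  \<comment> \<open>Convergence at the midpoint of \<rho> and r implies absolute convergence at
    \<rho>, which bounds all partial sums uniformly on the smaller disc.\<close>
  have abs: "summable (\<lambda>n. norm (a n * of_real \<rho> ^ n))"
  proof (rule powser_insidea)
    show "summable (\<lambda>n. a n * of_real ((\<rho> + r) / 2) ^ n)"
    proof (rule sums_summable[OF sums])
      have "cmod (of_real ((\<rho> + r) / 2)) < r" using \<rho> by (simp only: norm_of_real) simp
      then show "of_real ((\<rho> + r) / 2) \<in> ball (0::complex) r" by (simp only: mem_ball_0)
    qed
    show "norm (of_real \<rho> :: complex) < norm (of_real ((\<rho> + r) / 2) :: complex)"
      using \<rho> by (simp only: norm_of_real) simp
  qed
  define K where "K = (\<Sum>n. norm (a n * of_real \<rho> ^ n))"
  define S where "S = (\<lambda>N z. \<Sum>n<N. a n * z ^ n)"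
  have SK: "norm (S N z) \<le> K" if "z \<in> ball 0 \<rho>" for N z
  proof -
    have "norm (S N z) \<le> (\<Sum>n<N. norm (a n * z ^ n))" unfolding S_def by (rule norm_sum)
    also have "\<dots> \<le> (\<Sum>n<N. norm (a n * of_real \<rho> ^ n))"
      using that \<rho> by (intro sum_mono) (auto simp: norm_mult norm_power intro!: mult_left_mono power_mono)
    also have "\<dots> \<le> K" unfolding K_def by (rule sum_le_suminf[OF abs]) auto
    finally show ?thesis .
  qed
  have K: "0 \<le> K" using SK[of 0 0] \<rho> by (simp add: S_def)
  have Sc: "continuous_on UNIV (S N)" for N unfolding S_def by (intro continuous_intros)
  have [measurable]: "S N \<in> borel_measurable borel" for N using Sc by (rule borel_measurable_continuous_onI)
  have lim: "(\<lambda>N. ?W z *\<^sub>R S N z) \<longlonglongrightarrow> ?W z *\<^sub>R F z" for z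
  proof (cases "z \<in> ball 0 \<rho>")
    case True
    then have "z \<in> ball 0 r" using \<rho> by auto
    then show ?thesis using sums by (intro tendsto_intros) (auto simp: S_def sums_def)
  qed simp
  have Fm: "(\<lambda>z. ?W z *\<^sub>R F z) \<in> borel_measurable lborel"
    by (rule borel_measurable_LIMSEQ_metric[OF _ lim]) measurable
  have bnd: "norm (?W z *\<^sub>R S N z) \<le> K * \<bar>?W z\<bar>" for N z
  proof (cases "z \<in> ball 0 \<rho>")
    case True
    then show ?thesis using mult_left_mono[OF SK[OF True] abs_ge_zero[of "w (cmod z)"], of N]
      by (simp add: mult.commute)
  qed (use K in simp)
  have dom: "integrable lborel (\<lambda>z. K * \<bar>?W z\<bar>)" using wI by simp
  have Sm: "(\<lambda>z. ?W z *\<^sub>R S N z) \<in> borel_measurable lborel" for N by measurable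
  show "integrable lborel (\<lambda>z. ?W z *\<^sub>R F z)"
    by (rule integrable_dominated_convergence[where s = "\<lambda>N z. ?W z *\<^sub>R S N z" and w = "\<lambda>z. K * \<bar>?W z\<bar>"])
      (rule Fm dom Sm AE_I2 lim bnd)+
  have lim2: "(\<lambda>N. \<integral>z. ?W z *\<^sub>R S N z \<partial>lborel) \<longlonglongrightarrow> (\<integral>z. ?W z *\<^sub>R F z \<partial>lborel)"
    by (rule integral_dominated_convergence[where s = "\<lambda>N z. ?W z *\<^sub>R S N z" and w = "\<lambda>z. K * \<bar>?W z\<bar>"])
      (rule Fm dom Sm AE_I2 lim bnd)+
  have a0: "a 0 = F 0" by (simp add: a_def)
  have summand: "integrable lborel (\<lambda>z. ?W z *\<^sub>R (a n * z ^ n))" for n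
  proof (rule Bochner_Integration.integrable_bound)
    show "integrable lborel (\<lambda>z. (norm (a n) * \<rho> ^ n) * \<bar>?W z\<bar>)" using wI by simp
    show "AE z in lborel. norm (?W z *\<^sub>R (a n * z ^ n)) \<le> norm ((norm (a n) * \<rho> ^ n) * \<bar>?W z\<bar>)"
    proof (rule AE_I2)
      fix z
      have "z \<in> ball 0 \<rho> \<Longrightarrow> norm (a n * z ^ n) * \<bar>w (cmod z)\<bar> \<le> (norm (a n) * \<rho> ^ n) * \<bar>w (cmod z)\<bar>"
        by (intro mult_right_mono) (auto simp: norm_mult norm_power intro!: mult_left_mono power_mono)
      then show "norm (?W z *\<^sub>R (a n * z ^ n)) \<le> norm ((norm (a n) * \<rho> ^ n) * \<bar>?W z\<bar>)"
        using \<rho> by (cases "z \<in> ball 0 \<rho>") (auto simp: abs_mult mult.commute)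
    qed
  qed measurable
  have mono: "(\<integral>z. ?W z *\<^sub>R (a n * z ^ n) \<partial>lborel) = 0" if "0 < n" for n
  proof -
    have "(\<integral>z. of_real ((\<lambda>t. indicator {..<\<rho>} t * w t) (cmod z)) * (z ^ n * cnj z ^ 0) \<partial>lborel) = 0"
      by (rule integral_radial_monomial[OF _ that]) measurable
    also have "(\<integral>z. of_real ((\<lambda>t. indicator {..<\<rho>} t * w t) (cmod z)) * (z ^ n * cnj z ^ 0) \<partial>lborel) = (\<integral>z. ?W z *\<^sub>R z ^ n \<partial>lborel)"
      by (intro Bochner_Integration.integral_cong) (auto simp: indicator_def scaleR_conv_of_real)
    finally have "(\<integral>z. ?W z *\<^sub>R z ^ n \<partial>lborel) = 0" .
    moreover have "(\<integral>z. ?W z *\<^sub>R (a n * z ^ n) \<partial>lborel) = (\<integral>z. a n * (?W z *\<^sub>R z ^ n) \<partial>lborel)"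
      by (intro Bochner_Integration.integral_cong) auto
    ultimately show ?thesis by (simp only: integral_mult_right_zero mult_zero_right)
  qed
  \<comment> \<open>\<open>Suc N\<close> ensures that the constant term is present in the partial
    sum.\<close>
  have "(\<integral>z. ?W z *\<^sub>R S (Suc N) z \<partial>lborel) = (\<integral>z. ?W z \<partial>lborel) *\<^sub>R F 0" for N
  proof -
    have "(\<integral>z. ?W z *\<^sub>R S (Suc N) z \<partial>lborel) = (\<integral>z. (\<Sum>n<Suc N. ?W z *\<^sub>R (a n * z ^ n)) \<partial>lborel)"
      unfolding S_def scaleR_sum_right ..
    also have "\<dots> = (\<Sum>n<Suc N. \<integral>z. ?W z *\<^sub>R (a n * z ^ n) \<partial>lborel)"
      by (rule Bochner_Integration.integral_sum) (rule summand)
    also have "\<dots> = (\<integral>z. ?W z *\<^sub>R (a 0 * z ^ 0) \<partial>lborel)"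
      by (subst sum.lessThan_Suc_shift) (simp only: mono[OF zero_less_Suc] sum.neutral_const add_0_right)
    also have "\<dots> = (\<integral>z. ?W z \<partial>lborel) *\<^sub>R F 0"
      using wI by (simp add: a0)
    finally show ?thesis .
  qed
  then have "(\<lambda>N. \<integral>z. ?W z *\<^sub>R S (Suc N) z \<partial>lborel) \<longlonglongrightarrow> (\<integral>z. ?W z \<partial>lborel) *\<^sub>R F 0" by simp
  then show "(\<integral>z. ?W z *\<^sub>R F z \<partial>lborel) = (\<integral>z. ?W z \<partial>lborel) *\<^sub>R F 0"
    using LIMSEQ_unique[OF LIMSEQ_Suc[OF lim2]] by simp
qed

text \<open>(1 - x + x^2/2)(1 + x + x^2/2) = 1 + x^4/4 \<ge> 1, and the second factor is at most exp
  x.\<close>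

lemma exp_minus_le_quadratic:
  fixes x :: real
  assumes "0 \<le> x"
  shows "exp (- x) \<le> 1 - x + x\<^sup>2 / 2"
proof -
  have "1 + x + x\<^sup>2 / 2 \<le> exp x" using exp_lower_Taylor_quadratic[OF assms] by simp
  moreover have "(1 - x + x\<^sup>2 / 2) * (1 + x + x\<^sup>2 / 2) = 1 + x ^ 4 / 4"
    by (simp add: power_numeral_reduce field_simps)
  moreover have "0 < 1 - x + x\<^sup>2 / 2"
  proof -
    have "0 < (1 - x)\<^sup>2 + 1" by (simp add: add_nonneg_pos)
    then show ?thesis by (simp add: power2_eq_square algebra_simps)
  qed
  ultimately have "1 \<le> (1 - x + x\<^sup>2 / 2) * exp x"
    by (smt (verit) mult_left_mono zero_le_even_power even_numeral zero_le_power2 zero_le_divide_iff)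
  then show ?thesis by (simp add: exp_minus divide_simps)
qed

text \<open>With the test function exp(P/2) only the factor exp(-\<kappa> |h|^2) remains. Averaging
  its quadratic upper bound over the disc gives 1 - \<kappa> r^2/2 + \<kappa>^2 r^4/6, and the gap
  between \<gamma> and \<kappa> pays for the quartic term.\<close>

lemma L_Phi_le_exp:
  fixes \<Phi> :: "complex \<Rightarrow> real"
  assumes U: "open U" "a \<in> U" and \<Phi>: "Ck_on 2 \<Phi> U" and \<gamma>: "0 < \<gamma>" "\<gamma> < ddbar_coeff \<Phi> a"
  obtains \<rho> where "0 < \<rho>" "\<And>r. 0 < r \<Longrightarrow> r < \<rho> \<Longrightarrow> L_Phi \<Phi> a r \<le> exp (- (\<gamma> / 2) * r\<^sup>2)"
proof -
  define c where "c = ddbar_coeff \<Phi> a"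
  \<comment> \<open>The midpoint leaves a gap on both sides: c - \<kappa> absorbs the Taylor error,
    \<kappa> - \<gamma> the quartic term.\<close>
  define \<kappa> where "\<kappa> = (c + \<gamma>) / 2"
  have \<kappa>: "\<gamma> < \<kappa>" "0 < \<kappa>" using \<gamma> by (auto simp: \<kappa>_def c_def)
  have "0 < c - \<kappa>" using \<gamma> by (simp add: \<kappa>_def c_def)
  then obtain \<rho> A B where \<rho>: "0 < \<rho>" "ball a \<rho> \<subseteq> U"
    and T: "\<And>h. cmod h < \<rho> \<Longrightarrow> \<bar>\<Phi> (a + h) - \<Phi> a - Re (A * h + B * h\<^sup>2) - c * (cmod h)\<^sup>2\<bar> \<le> (c - \<kappa>) * (cmod h)\<^sup>2"
    using taylor_holomorphic_quadratic[OF U \<Phi>, of "c - \<kappa>"] unfolding c_def by metis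
  \<comment> \<open>For r below the root, \<kappa>^2 r^2 \<le> \<kappa> - \<gamma>, so that
    \<kappa>^2 r^4/6 is at most (\<kappa> - \<gamma>) r^2/2.\<close>
  define \<rho>' where "\<rho>' = min \<rho> (sqrt ((\<kappa> - \<gamma>) / \<kappa>\<^sup>2))"
  have \<rho>': "0 < \<rho>'" using \<rho> \<kappa> by (simp add: \<rho>'_def)
  show thesis
  proof (rule that[OF \<rho>'])
    fix r :: real assume r: "0 < r" "r < \<rho>'"
    have sub: "ball a r \<subseteq> U" using r \<rho>(2) by (auto simp: \<rho>'_def)
    have cont: "continuous_on (ball a r) \<Phi>"
      by (rule continuous_on_subset[OF Ck_on_continuous_on[OF \<Phi>] sub])
    define f where "f = (\<lambda>\<tau>. exp ((A * (\<tau> - a) + B * (\<tau> - a)\<^sup>2) / 2))"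
    have hf: "f holomorphic_on ball a r" unfolding f_def by (intro holomorphic_intros) auto
    have r2: "r\<^sup>2 \<le> (\<kappa> - \<gamma>) / \<kappa>\<^sup>2"
    proof -
      have "r \<le> sqrt ((\<kappa> - \<gamma>) / \<kappa>\<^sup>2)" using r by (simp add: \<rho>'_def)
      then have "r\<^sup>2 \<le> (sqrt ((\<kappa> - \<gamma>) / \<kappa>\<^sup>2))\<^sup>2" using r by (intro power_mono) auto
      then show ?thesis using \<kappa> by simp
    qed
    have pos: "0 \<le> 1 + (- \<kappa>) * t + \<kappa>\<^sup>2 / 2 * t\<^sup>2" for t
    proof -
      have "0 \<le> (1 - \<kappa> * t)\<^sup>2 + 1" by simp
      then show ?thesis by (simp add: power2_eq_square algebra_simps)
    qed
    show "L_Phi \<Phi> a r \<le> exp (- (\<gamma> / 2) * r\<^sup>2)"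
    proof (rule L_Phi_le[OF r(1) cont hf])
      show "f a = 1" by (simp add: f_def)
      let ?q = "\<lambda>z::complex. 1 + (- \<kappa>) * (cmod z)\<^sup>2 + \<kappa>\<^sup>2 / 2 * cmod z ^ 4"
      let ?h = "\<lambda>\<tau>. ennreal ((cmod (f \<tau>))\<^sup>2 * exp (- \<Phi> \<tau>) * indicator (ball a r) \<tau>)"
      have q0: "0 \<le> ?q z" for z using pos[of "(cmod z)\<^sup>2"] by (simp add: power_mult[symmetric])
      have "(\<integral>\<^sup>+\<tau>. ennreal ((cmod (f \<tau>))\<^sup>2 * exp (- \<Phi> \<tau>)) * indicator (ball a r) \<tau> \<partial>lborel) = (\<integral>\<^sup>+\<tau>. ?h \<tau> \<partial>lborel)"
        by (intro nn_integral_cong) (auto simp: indicator_def)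
      also have "\<dots> = ennreal (1\<^sup>2) * (\<integral>\<^sup>+z. ?h (a + of_real 1 * z) \<partial>lborel)"
        using weighted_square_measurable[OF open_ball cont hf] by (intro nn_integral_complex_affine) simp_all
      also have "\<dots> = (\<integral>\<^sup>+z. ?h (a + z) \<partial>lborel)" by simp
      also have "\<dots> \<le> (\<integral>\<^sup>+z. ennreal (exp (- \<Phi> a)) * ennreal (indicator (ball 0 r) z * ?q z) \<partial>lborel)"
      proof (rule nn_integral_mono)
        fix z :: complex
        show "?h (a + z) \<le> ennreal (exp (- \<Phi> a)) * ennreal (indicator (ball 0 r) z * ?q z)"
        proof (cases "cmod z < r")
          case True
          then have "\<bar>\<Phi> (a + z) - \<Phi> a - Re (A * z + B * z\<^sup>2) - c * (cmod z)\<^sup>2\<bar> \<le> (c - \<kappa>) * (cmod z)\<^sup>2"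
            using r by (intro T) (simp add: \<rho>'_def)
          then have "Re (A * z + B * z\<^sup>2) - \<Phi> (a + z) \<le> - \<Phi> a - \<kappa> * (cmod z)\<^sup>2" by (simp add: abs_le_iff algebra_simps)
          then have "exp (Re (A * z + B * z\<^sup>2) - \<Phi> (a + z)) \<le> exp (- \<Phi> a - \<kappa> * (cmod z)\<^sup>2)" by simp
          also have "\<dots> = exp (- \<Phi> a) * exp (- (\<kappa> * (cmod z)\<^sup>2))" by (simp add: exp_add[symmetric])
          also have "\<dots> \<le> exp (- \<Phi> a) * (1 - \<kappa> * (cmod z)\<^sup>2 + (\<kappa> * (cmod z)\<^sup>2)\<^sup>2 / 2)"
            using \<kappa> by (intro mult_left_mono exp_minus_le_quadratic) auto
          also have "\<dots> = exp (- \<Phi> a) * ?q z" by (simp add: power_mult_distrib power_mult[symmetric])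
          finally have "exp (Re (A * z + B * z\<^sup>2) - \<Phi> (a + z)) \<le> exp (- \<Phi> a) * ?q z" .
          moreover have "(cmod (f (a + z)))\<^sup>2 * exp (- \<Phi> (a + z)) = exp (Re (A * z + B * z\<^sup>2) - \<Phi> (a + z))"
          proof -
            have "(cmod (f (a + z)))\<^sup>2 = exp (2 * Re ((A * z + B * z\<^sup>2) / 2))"
              by (simp only: f_def add_diff_cancel_left' norm_exp_eq_Re exp_double)
            also have "2 * Re ((A * z + B * z\<^sup>2) / 2) = Re (A * z + B * z\<^sup>2)" by simp
            finally show ?thesis by (simp add: exp_diff exp_minus divide_inverse)
          qed
          ultimately show ?thesis using True by (simp add: ennreal_mult'[symmetric] dist_norm ennreal_leI)
        qed (simp add: dist_norm)
      qed
      also have "\<dots> = ennreal (exp (- \<Phi> a)) * (\<integral>\<^sup>+z. ennreal (indicator (ball 0 r) z * ?q z) \<partial>lborel)"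
        using has_bochner_integral_disc_quartic[of r 1 "- \<kappa>" "\<kappa>\<^sup>2 / 2"] r
        by (intro nn_integral_cmult) (auto dest!: has_bochner_integral_integrable borel_measurable_integrable simp: has_bochner_integral_iff)
      also have "(\<integral>\<^sup>+z. ennreal (indicator (ball 0 r) z * ?q z) \<partial>lborel) = ennreal (pi * r\<^sup>2 * (1 + (- \<kappa>) * r\<^sup>2 / 2 + (\<kappa>\<^sup>2 / 2) * r ^ 4 / 3))"
        using has_bochner_integral_disc_quartic[of r 1 "- \<kappa>" "\<kappa>\<^sup>2 / 2"] r q0
        by (subst nn_integral_eq_integral) (auto simp: has_bochner_integral_iff)
      also have "ennreal (exp (- \<Phi> a)) * \<dots> \<le> ennreal (exp (- \<Phi> a)) * ennreal (pi * r\<^sup>2 * exp (- (\<gamma> / 2) * r\<^sup>2))"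
      proof (rule mult_left_mono, rule ennreal_leI)
        have "\<kappa>\<^sup>2 * r\<^sup>2 \<le> \<kappa> - \<gamma>" using r2 \<kappa> by (simp add: field_simps)
        then have "(\<kappa>\<^sup>2 * r\<^sup>2) * r\<^sup>2 \<le> (\<kappa> - \<gamma>) * r\<^sup>2" by (intro mult_right_mono) auto
        moreover have "r ^ 4 = r\<^sup>2 * r\<^sup>2" by (simp add: power_numeral_reduce)
        moreover have "0 \<le> (\<kappa> - \<gamma>) * r\<^sup>2" using \<kappa> by simp
        moreover have "1 + (- \<kappa>) * t / 2 + (\<kappa>\<^sup>2 / 2) * v / 3 \<le> 1 + (- (\<gamma> / 2) * t)"
          if "(\<kappa>\<^sup>2 * t) * t \<le> (\<kappa> - \<gamma>) * t" "v = t * t" "0 \<le> (\<kappa> - \<gamma>) * t" for t v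
        proof -
          have "(\<kappa>\<^sup>2 / 2) * v / 3 = ((\<kappa>\<^sup>2 * t) * t) / 6" unfolding that(2) by simp
          moreover have "(\<kappa> - \<gamma>) * t = \<kappa> * t - \<gamma> * t" by (rule left_diff_distrib)
          ultimately show ?thesis using that(1,3) by argo
        qed
        ultimately have "1 + (- \<kappa>) * r\<^sup>2 / 2 + (\<kappa>\<^sup>2 / 2) * r ^ 4 / 3 \<le> 1 + (- (\<gamma> / 2) * r\<^sup>2)"
          by blast
        also have "\<dots> \<le> exp (- (\<gamma> / 2) * r\<^sup>2)" by (rule exp_ge_add_one_self)
        finally show "pi * r\<^sup>2 * (1 + (- \<kappa>) * r\<^sup>2 / 2 + (\<kappa>\<^sup>2 / 2) * r ^ 4 / 3) \<le> pi * r\<^sup>2 * exp (- (\<gamma> / 2) * r\<^sup>2)"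
          by (intro mult_left_mono) auto
      qed simp
      also have "\<dots> = ennreal (exp (- (\<gamma> / 2) * r\<^sup>2) * (pi * r\<^sup>2 * exp (- \<Phi> a)))"
        by (simp add: ennreal_mult'[symmetric] mult_ac)
      finally show "(\<integral>\<^sup>+\<tau>. ennreal ((cmod (f \<tau>))\<^sup>2 * exp (- \<Phi> \<tau>)) * indicator (ball a r) \<tau> \<partial>lborel)
         \<le> ennreal (exp (- (\<gamma> / 2) * r\<^sup>2) * (pi * r\<^sup>2 * exp (- \<Phi> a)))" .
    qed simp
  qed
qed

text \<open>Dividing a competitor by exp(P/2) makes the weight nearly radial: it is at least
  exp(-\<kappa> |h|^2) up to a constant. The mean value property and exp(-x) \<ge> 1 - x, valid for
  either sign of \<kappa>, then bound the integral below.\<close>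

lemma L_Phi_ge:
  fixes \<Phi> :: "complex \<Rightarrow> real"
  assumes U: "open U" "a \<in> U" and \<Phi>: "Ck_on 2 \<Phi> U" and \<kappa>: "ddbar_coeff \<Phi> a < \<kappa>"
  obtains \<rho> where "0 < \<rho>" "\<And>r. 0 < r \<Longrightarrow> r < \<rho> \<Longrightarrow> 1 - \<kappa> / 2 * r\<^sup>2 \<le> L_Phi \<Phi> a r"
proof -
  define c where "c = ddbar_coeff \<Phi> a"
  have "0 < \<kappa> - c" using \<kappa> by (simp add: c_def)
  then obtain \<rho> A B where \<rho>: "0 < \<rho>" "ball a \<rho> \<subseteq> U"
    and T: "\<And>h. cmod h < \<rho> \<Longrightarrow> \<bar>\<Phi> (a + h) - \<Phi> a - Re (A * h + B * h\<^sup>2) - c * (cmod h)\<^sup>2\<bar> \<le> (\<kappa> - c) * (cmod h)\<^sup>2"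
    using taylor_holomorphic_quadratic[OF U \<Phi>, of "\<kappa> - c"] unfolding c_def by metis
  show thesis
  proof (rule that[OF \<rho>(1)])
    fix r :: real assume r: "0 < r" "r < \<rho>"
    let ?N = "pi * r\<^sup>2 * exp (- \<Phi> a)"
    have N: "0 < ?N" using r by simp
    have cont: "continuous_on (cball a r) \<Phi>"
      by (rule continuous_on_subset[OF Ck_on_continuous_on[OF \<Phi>]]) (use r \<rho>(2) in auto)
    show "1 - \<kappa> / 2 * r\<^sup>2 \<le> L_Phi \<Phi> a r"
      unfolding L_Phi_def
    proof (rule cInf_greatest)
      \<comment> \<open>The constant 1 is a competitor: an infimum over the empty set would carry no
        information.\<close>
      have "(\<lambda>\<tau>. (cmod 1)\<^sup>2 * exp (- \<Phi> \<tau>)) integrable_on ball a r"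
      proof -
        have "bounded ((\<lambda>\<tau>. exp (- \<Phi> \<tau>)) ` cball a r)"
          by (intro compact_imp_bounded compact_continuous_image continuous_intros cont compact_cball)
        then obtain M where M: "\<forall>\<tau>\<in>cball a r. norm (exp (- \<Phi> \<tau>)) \<le> M" unfolding bounded_iff by blast
        have M0: "0 \<le> M" using bspec[OF M, of a] r by (auto intro: order_trans[OF exp_ge_zero])
        show ?thesis
        proof (rule weighted_square_has_integral(1)[OF open_ball])
          show "continuous_on (ball a r) \<Phi>" by (rule continuous_on_subset[OF cont]) auto
          show "(\<lambda>_. 1) holomorphic_on ball a r" by (rule holomorphic_on_const)
          have "(\<integral>\<^sup>+\<tau>. ennreal ((cmod 1)\<^sup>2 * exp (- \<Phi> \<tau>)) * indicator (ball a r) \<tau> \<partial>lborel)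
            \<le> (\<integral>\<^sup>+\<tau>. ennreal M * indicator (ball a r) \<tau> \<partial>lborel)"
            using M by (intro nn_integral_mono) (auto simp: indicator_def intro!: ennreal_leI)
          also have "\<dots> = ennreal (M * (pi * r\<^sup>2))"
            using M0 r by (simp add: nn_integral_cmult_indicator emeasure_ball unit_ball_vol_2 ennreal_mult')
          finally show "(\<integral>\<^sup>+\<tau>. ennreal ((cmod 1)\<^sup>2 * exp (- \<Phi> \<tau>)) * indicator (ball a r) \<tau> \<partial>lborel) \<le> ennreal (M * (pi * r\<^sup>2))" .
        qed (use M0 in simp)
      qed
      then show "{integral (ball a r) (\<lambda>\<tau>. (cmod (f \<tau>))\<^sup>2 * exp (- \<Phi> \<tau>)) / ?N | f.
        f holomorphic_on ball a r \<and> (\<lambda>\<tau>. (cmod (f \<tau>))\<^sup>2 * exp (- \<Phi> \<tau>)) integrable_on ball a r \<and> f a = 1} \<noteq> {}"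
        by (auto intro!: exI[of _ "\<lambda>_. 1"])
      fix x assume "x \<in> {integral (ball a r) (\<lambda>\<tau>. (cmod (f \<tau>))\<^sup>2 * exp (- \<Phi> \<tau>)) / ?N | f.
        f holomorphic_on ball a r \<and> (\<lambda>\<tau>. (cmod (f \<tau>))\<^sup>2 * exp (- \<Phi> \<tau>)) integrable_on ball a r \<and> f a = 1}"
      then obtain f where x: "x = integral (ball a r) (\<lambda>\<tau>. (cmod (f \<tau>))\<^sup>2 * exp (- \<Phi> \<tau>)) / ?N"
        and f: "f holomorphic_on ball a r" "(\<lambda>\<tau>. (cmod (f \<tau>))\<^sup>2 * exp (- \<Phi> \<tau>)) integrable_on ball a r" "f a = 1" by blast
      \<comment> \<open>The competitor stripped of the pluriharmonic part of the weight; its value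
        at the centre is still 1.\<close>
      define F where "F = (\<lambda>z. f (a + z) * exp (- ((A * z + B * z\<^sup>2) / 2)))"
      have F: "F holomorphic_on ball 0 r"
      proof -
        have "(f \<circ> (\<lambda>z. a + z)) holomorphic_on ball 0 r"
          by (rule holomorphic_on_compose_gen[OF _ f(1)]) (auto intro!: holomorphic_intros simp: dist_norm)
        then show ?thesis unfolding F_def by (intro holomorphic_intros) (auto simp: o_def)
      qed
      have F0: "F 0 = 1" by (simp add: F_def f)
      \<comment> \<open>A competitor may be unbounded near the boundary, so the mean value property
        is used on discs of radius s < r, and s tends to r at the end.\<close>
      have low: "pi * s\<^sup>2 * (1 - \<kappa> * s\<^sup>2 / 2) * exp (- \<Phi> a) \<le> integral (ball a r) (\<lambda>\<tau>. (cmod (f \<tau>))\<^sup>2 * exp (- \<Phi> \<tau>))"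
        if s: "0 < s" "s < r" for s
      proof -
        define w where "w = (\<lambda>t::real. exp (- (\<kappa> * t\<^sup>2)))"
        have wc: "continuous_on UNIV w" unfolding w_def by (intro continuous_intros)
        let ?W = "\<lambda>z::complex. indicator (ball 0 s) z * w (cmod z)"
        note mv = radial_mean_value[OF F s wc]
        let ?J = "\<integral>z. ?W z * (2 * Re (F z) - 1) \<partial>lborel"
        have iRe: "integrable lborel (\<lambda>z. 2 * Re (?W z *\<^sub>R F z))"
          by (intro integrable_mult_right integrable_Re mv(1))
        have eqW: "?W z * (2 * Re (F z) - 1) = 2 * Re (?W z *\<^sub>R F z) - ?W z" for z by (simp add: algebra_simps)
        have iJ: "integrable lborel (\<lambda>z. ?W z * (2 * Re (F z) - 1))"
          unfolding eqW by (rule Bochner_Integration.integrable_diff[OF iRe mv(3)])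
        have J: "?J = (\<integral>z. ?W z \<partial>lborel)"
          unfolding eqW Bochner_Integration.integral_diff[OF iRe mv(3)] integral_mult_right_zero integral_Re[OF mv(1)] mv(2) F0 by simp
        have "pi * s\<^sup>2 * (1 + (- \<kappa>) * s\<^sup>2 / 2 + 0 * s ^ 4 / 3) \<le> (\<integral>z. ?W z \<partial>lborel)"
        proof -
          have q: "has_bochner_integral lborel (\<lambda>z::complex. indicator (ball 0 s) z * (1 + (- \<kappa>) * (cmod z)\<^sup>2 + 0 * cmod z ^ 4))
              (pi * s\<^sup>2 * (1 + (- \<kappa>) * s\<^sup>2 / 2 + 0 * s ^ 4 / 3))"
            by (rule has_bochner_integral_disc_quartic) (use s in simp)
          have "(\<integral>z. indicator (ball 0 s) z * (1 + (- \<kappa>) * (cmod z)\<^sup>2 + 0 * cmod z ^ 4) \<partial>lborel) \<le> (\<integral>z. ?W z \<partial>lborel)"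
          proof (rule integral_mono)
            fix z :: complex
            have "1 + (- (\<kappa> * (cmod z)\<^sup>2)) \<le> w (cmod z)" unfolding w_def by (rule exp_ge_add_one_self)
            then show "indicator (ball 0 s) z * (1 + (- \<kappa>) * (cmod z)\<^sup>2 + 0 * cmod z ^ 4) \<le> ?W z"
              by (auto simp: indicator_def)
          qed (use q mv(3) in \<open>auto simp: has_bochner_integral_iff\<close>)
          then show ?thesis using q by (simp add: has_bochner_integral_iff)
        qed
        then have 1: "pi * s\<^sup>2 * (1 - \<kappa> * s\<^sup>2 / 2) \<le> ?J" unfolding J by simp
        let ?g = "\<lambda>\<tau>. (cmod (f \<tau>))\<^sup>2 * exp (- \<Phi> \<tau>)"
        define k where "k = (\<lambda>z. ?W z * (2 * Re (F z) - 1) * exp (- \<Phi> a))"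
        have ik: "integrable lborel k" unfolding k_def by (intro integrable_mult_left iJ)
        have Jk: "(\<integral>z. k z \<partial>lborel) = ?J * exp (- \<Phi> a)" unfolding k_def by (rule integral_mult_left_zero)
        have km: "(\<lambda>\<tau>. k (\<tau> - a)) \<in> borel_measurable borel"
          using borel_measurable_integrable[OF ik] by (intro measurable_compose[of "\<lambda>\<tau>. \<tau> - a" borel borel k]) auto
        have d: "lborel = distr lborel borel ((+) a)" by (simp add: lborel_distr_plus)
        have "integrable lborel (\<lambda>\<tau>. k (\<tau> - a))"
          by (subst d, subst integrable_distr_eq) (use km ik in simp_all)
        moreover have "(\<integral>\<tau>. k (\<tau> - a) \<partial>lborel) = ?J * exp (- \<Phi> a)"
          by (subst d, subst integral_distr) (use km Jk in simp_all)
        ultimately have hk: "((\<lambda>\<tau>. k (\<tau> - a)) has_integral ?J * exp (- \<Phi> a)) UNIV"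
          using has_integral_integral_lborel[of "\<lambda>\<tau>. k (\<tau> - a)"] by simp
        have eq: "(\<lambda>\<tau>. k (\<tau> - a)) = (\<lambda>\<tau>. if \<tau> \<in> ball a s then k (\<tau> - a) else 0)"
          by (auto simp: k_def indicator_def dist_norm norm_minus_commute)
        have hI: "((\<lambda>\<tau>. k (\<tau> - a)) has_integral ?J * exp (- \<Phi> a)) (ball a s)"
          using hk by (subst (asm) eq) (simp only: has_integral_restrict_UNIV)
        have gs: "?g integrable_on ball a s"
        proof -
          have "?g absolutely_integrable_on ball a r" using f(2) by (rule nonnegative_absolutely_integrable_1) auto
          then have "?g absolutely_integrable_on ball a s" by (rule set_integrable_subset) (use s in auto)
          then show ?thesis by (rule set_lebesgue_integral_eq_integral(1))
        qed
        have "?J * exp (- \<Phi> a) \<le> integral (ball a s) ?g"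
        proof (rule has_integral_le[OF hI integrable_integral[OF gs]])
          fix \<tau> assume \<tau>: "\<tau> \<in> ball a s"
          define z where "z = \<tau> - a"
          have z: "cmod z < s" "\<tau> = a + z" using \<tau> by (auto simp: z_def dist_norm norm_minus_commute)
          \<comment> \<open>|F - 1|^2 \<ge> 0. The minorant is linear in F and exact at F = 1, so
            the mean value property applies to it directly.\<close>
          have "2 * Re (F z) - 1 \<le> (cmod (F z))\<^sup>2"
          proof -
            have "0 \<le> (Re (F z) - 1)\<^sup>2 + (Im (F z))\<^sup>2" by simp
            then show ?thesis unfolding cmod_power2 by (simp add: power2_eq_square algebra_simps)
          qed
          then have "w (cmod z) * (2 * Re (F z) - 1) * exp (- \<Phi> a) \<le> w (cmod z) * (cmod (F z))\<^sup>2 * exp (- \<Phi> a)"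
            by (intro mult_right_mono mult_left_mono) (auto simp: w_def)
          also have "\<dots> = (cmod (f \<tau>))\<^sup>2 * exp (- (\<kappa> * (cmod z)\<^sup>2) - Re (A * z + B * z\<^sup>2) - \<Phi> a)"
          proof -
            have "(cmod (F z))\<^sup>2 = (cmod (f \<tau>))\<^sup>2 * exp (2 * Re (- ((A * z + B * z\<^sup>2) / 2)))"
              unfolding F_def z(2) norm_mult power_mult_distrib norm_exp_eq_Re exp_double ..
            also have "2 * Re (- ((A * z + B * z\<^sup>2) / 2)) = - Re (A * z + B * z\<^sup>2)"
            proof -
              have "2 * Re (- (X / 2)) = - Re X" for X by simp
              then show ?thesis .
            qed
            finally have "(cmod (F z))\<^sup>2 = (cmod (f \<tau>))\<^sup>2 * exp (- Re (A * z + B * z\<^sup>2))" .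
            moreover have "exp (- x) * (u * exp (- R)) * exp (- p) = u * exp (- x - R - p)" for x u R p :: real
              by (simp add: exp_diff exp_minus divide_inverse mult_ac)
            ultimately show ?thesis unfolding w_def by metis
          qed
          also have "\<dots> \<le> (cmod (f \<tau>))\<^sup>2 * exp (- \<Phi> \<tau>)"
          proof -
            have "\<bar>\<Phi> (a + z) - \<Phi> a - Re (A * z + B * z\<^sup>2) - c * (cmod z)\<^sup>2\<bar> \<le> (\<kappa> - c) * (cmod z)\<^sup>2"
              using z s r by (intro T) simp
            then have "- (\<kappa> * (cmod z)\<^sup>2) - Re (A * z + B * z\<^sup>2) - \<Phi> a \<le> - \<Phi> \<tau>"
              unfolding z(2) by (simp add: abs_le_iff algebra_simps)
            then show ?thesis by (intro mult_left_mono) auto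
          qed
          finally show "k (\<tau> - a) \<le> ?g \<tau>"
            using z(1) unfolding z_def k_def by simp
        qed
        also have "\<dots> \<le> integral (ball a r) ?g"
          by (rule integral_subset_le[OF _ gs f(2)]) (use s in auto)
        finally have 2: "?J * exp (- \<Phi> a) \<le> integral (ball a r) ?g" .
        have "pi * s\<^sup>2 * (1 - \<kappa> * s\<^sup>2 / 2) * exp (- \<Phi> a) \<le> ?J * exp (- \<Phi> a)"
          using 1 by (intro mult_right_mono) auto
        then show ?thesis using 2 by linarith
      qed
      have "pi * r\<^sup>2 * (1 - \<kappa> * r\<^sup>2 / 2) * exp (- \<Phi> a) \<le> integral (ball a r) (\<lambda>\<tau>. (cmod (f \<tau>))\<^sup>2 * exp (- \<Phi> \<tau>))"
      proof (rule tendsto_upperbound)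
        show "((\<lambda>s. pi * s\<^sup>2 * (1 - \<kappa> * s\<^sup>2 / 2) * exp (- \<Phi> a)) \<longlongrightarrow> pi * r\<^sup>2 * (1 - \<kappa> * r\<^sup>2 / 2) * exp (- \<Phi> a)) (at_left r)"
          by (intro tendsto_intros) auto
        show "\<forall>\<^sub>F s in at_left r. pi * s\<^sup>2 * (1 - \<kappa> * s\<^sup>2 / 2) * exp (- \<Phi> a) \<le> integral (ball a r) (\<lambda>\<tau>. (cmod (f \<tau>))\<^sup>2 * exp (- \<Phi> \<tau>))"
          using eventually_at_left_real[OF r(1)] by eventually_elim (auto intro!: low)
      qed simp
      then have "(1 - \<kappa> / 2 * r\<^sup>2) * ?N \<le> integral (ball a r) (\<lambda>\<tau>. (cmod (f \<tau>))\<^sup>2 * exp (- \<Phi> \<tau>))"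
        by (simp add: mult_ac)
      then show "1 - \<kappa> / 2 * r\<^sup>2 \<le> x" unfolding x using N by (simp add: pos_le_divide_eq)
    qed
  qed
qed

section \<open>The equivalence\<close>

text \<open>Smoothness up to the closure supplies an extension of \<phi> to a neighbourhood of it,
  where the parameter-integral lemma applies to exp(-\<psi>). Integrability also identifies the
  gauge integral in the hypothesis with the Bochner integral.\<close>

lemma Ck_on_neg_ln_integral_exp:
  fixes U :: "complex set" and \<Omega> :: "'v::euclidean_space set" and \<phi> :: "complex \<times> 'v \<Rightarrow> real"
  assumes U: "open U" "bounded U" and \<Omega>: "open \<Omega>" "bounded \<Omega>"
    and \<phi>: "smooth_on_closure \<phi> (U \<times> \<Omega>)"
    and \<Phi>: "\<forall>\<tau>\<in>U. exp (- \<Phi> \<tau>) = integral \<Omega> (\<lambda>z. exp (- \<phi> (\<tau>, z)))"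
  shows "Ck_on k \<Phi> U"
proof -
  obtain W \<psi> where W: "closure (U \<times> \<Omega>) \<subseteq> W" and \<psi>: "smooth_on \<psi> W" "\<forall>x\<in>U \<times> \<Omega>. \<psi> x = \<phi> x"
    using \<phi> unfolding smooth_on_closure_def by blast
  define H where "H = (\<lambda>x. exp ((- 1) * \<psi> x))"
  define I where "I = (\<lambda>\<tau>. \<integral>z. H (\<tau>, z) \<partial>restrict_space lborel \<Omega>)"
  have "Ck_on k \<psi> W" using \<psi>(1) by (simp add: smooth_on_def)
  then have "Ck_on k (\<lambda>x. (- 1) * \<psi> x) W" by (rule Ck_on_mult[OF Ck_on_const])
  then have H: "Ck_on k H W" unfolding H_def by (rule Ck_on_compose[OF _ Ck_on_exp[of _ UNIV]]) simp
  have \<Omega>b: "\<Omega> \<in> sets borel" using \<Omega>(1) by simp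
  have I: "Ck_on k I U" unfolding I_def
    by (rule Ck_on_integral_parameter(1)[OF U(1) \<Omega>b U(2) \<Omega>(2) W H])
  have Ieq: "I \<tau> = exp (- \<Phi> \<tau>)" if \<tau>: "\<tau> \<in> U" for \<tau>
  proof -
    have "integrable (restrict_space lborel \<Omega>) (\<lambda>z. H (\<tau>, z))"
      by (rule Ck_on_integral_parameter(2)[OF U(1) \<Omega>b U(2) \<Omega>(2) W H \<tau>])
    then have si: "set_integrable lborel \<Omega> (\<lambda>z. H (\<tau>, z))"
      using \<Omega>b by (simp add: integrable_restrict_space set_integrable_def)
    have "I \<tau> = (LINT z:\<Omega>|lborel. H (\<tau>, z))"
      using \<Omega>b by (simp add: I_def integral_restrict_space set_lebesgue_integral_def)
    also have "\<dots> = integral \<Omega> (\<lambda>z. H (\<tau>, z))" by (rule set_borel_integral_eq_integral(2)[OF si])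
    also have "\<dots> = integral \<Omega> (\<lambda>z. exp (- \<phi> (\<tau>, z)))"
      using \<psi>(2) \<tau> by (intro Henstock_Kurzweil_Integration.integral_cong) (simp add: H_def)
    finally show ?thesis using \<Phi> \<tau> by simp
  qed
  \<comment> \<open>The positivity that \<open>ln\<close> requires is read off from
    \<open>Ieq\<close>.\<close>
  have "Ck_on k (\<lambda>\<tau>. ln (I \<tau>)) U"
    by (rule Ck_on_compose[OF I Ck_on_ln]) (auto simp: Ieq)
  then have "Ck_on k (\<lambda>\<tau>. (- 1) * ln (I \<tau>)) U" by (rule Ck_on_mult[OF Ck_on_const])
  moreover have "(- 1) * ln (I \<tau>) = \<Phi> \<tau>" if "\<tau> \<in> U" for \<tau> by (simp add: Ieq[OF that])
  ultimately show ?thesis by (rule Ck_on_cong[OF U(1), rotated])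
qed

lemma continuous_on_ddbar_coeff:
  assumes "open U" "Ck_on 2 \<Phi> U"
  shows "continuous_on U (ddbar_coeff \<Phi>)"
proof -
  obtain D D1 D2 where "\<And>z. z \<in> U \<Longrightarrow> (\<Phi> has_derivative D z) (at z)"
    "\<And>z. z \<in> U \<Longrightarrow> ((\<lambda>z. D z 1) has_derivative D1 z) (at z)"
    "\<And>z. z \<in> U \<Longrightarrow> ((\<lambda>z. D z \<i>) has_derivative D2 z) (at z)"
    "continuous_on U \<Phi>" "continuous_on U (\<lambda>z. D z 1)" "continuous_on U (\<lambda>z. D z \<i>)"
    and cont: "continuous_on U (\<lambda>z. D1 z 1)" "continuous_on U (\<lambda>z. D2 z \<i>)"
    and dd: "\<And>z. z \<in> U \<Longrightarrow> ddbar_coeff \<Phi> z = (D1 z 1 + D2 z \<i>) / 4"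
    by (rule Ck_on_2_partials[OF assms]) (rule that)
  have "continuous_on U (\<lambda>z. (D1 z 1 + D2 z \<i>) / 4)" by (intro continuous_intros cont) simp
  then show ?thesis by (rule continuous_on_eq) (simp add: dd)
qed

text \<open>Boundedness of U bounds the admissible radii above, so that the real supremum dominates
  each of them.\<close>

lemma le_delta:
  assumes "bounded U" "0 < d" "ball a d \<subseteq> U"
  shows "d \<le> delta U a"
  unfolding delta_def
proof (rule cSup_upper)
  obtain M where "\<forall>y\<in>U. dist a y \<le> M" using assms(1) bounded_any_center[of U a] by blast
  then have M: "U \<subseteq> cball a M" by auto
  show "bdd_above {r. 0 < r \<and> ball a r \<subseteq> U}"
  proof (rule bdd_aboveI)
    fix r assume "r \<in> {r. 0 < r \<and> ball a r \<subseteq> U}"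
    then have "ball a r \<subseteq> cball a M" "0 < r" using M by auto
    then show "r \<le> M" by (simp add: ball_subset_cball_iff)
  qed
qed (use assms in simp)

theorem theorem3p4:
  fixes U :: "complex set" and \<Omega> :: "(complex ^ 'n) set"
    and \<phi> :: "complex \<times> (complex ^ 'n) \<Rightarrow> real"
    and \<Phi> :: "complex \<Rightarrow> real" and g :: "complex \<Rightarrow> real"
  assumes U_dom: "open U" "connected U" "U \<noteq> {}" "bounded U"
    and \<Omega>_dom: "open \<Omega>" "connected \<Omega>" "\<Omega> \<noteq> {}" "bounded \<Omega>"
    and \<phi>_smooth: "smooth_on_closure \<phi> (U \<times> \<Omega>)"
    and \<Phi>_def: "\<forall>\<tau>\<in>U. exp (- \<Phi> \<tau>) = integral \<Omega> (\<lambda>z. exp (- \<phi> (\<tau>, z)))"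
    and g_nonneg: "\<forall>\<tau>\<in>U. g \<tau> \<ge> 0"
  shows "(\<forall>\<tau>\<in>U. ddbar_coeff \<Phi> \<tau> \<ge> g \<tau>) \<longleftrightarrow>
         (\<forall>a\<in>U. \<forall>\<epsilon>>0. \<exists>r\<^sub>\<epsilon>. 0 < r\<^sub>\<epsilon> \<and> r\<^sub>\<epsilon> < delta U a \<and>
             (\<forall>r. 0 < r \<and> r < r\<^sub>\<epsilon> \<longrightarrow>
                L_Phi \<Phi> a r \<le> exp (- max ((g a - \<epsilon>) / 2) 0 * r\<^sup>2)))"
proof -
  have \<Phi>: "Ck_on 2 \<Phi> U"
    using U_dom(1,4) \<Omega>_dom(1,4) \<phi>_smooth \<Phi>_def by (rule Ck_on_neg_ln_integral_exp)
  show ?thesis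
  proof (intro iffI ballI allI impI)
    fix a and \<epsilon> :: real
    assume ge: "\<forall>\<tau>\<in>U. g \<tau> \<le> ddbar_coeff \<Phi> \<tau>" and a: "a \<in> U" and \<epsilon>: "0 < \<epsilon>"
    obtain d where d: "0 < d" "ball a d \<subseteq> U" using U_dom(1) a by (meson open_contains_ball)
    have d\<delta>: "d \<le> delta U a" by (rule le_delta[OF U_dom(4) d])
    obtain \<rho> where \<rho>: "0 < \<rho>" "\<And>r. 0 < r \<Longrightarrow> r < \<rho> \<Longrightarrow> r < d / 2 \<Longrightarrow> L_Phi \<Phi> a r \<le> exp (- max ((g a - \<epsilon>) / 2) 0 * r\<^sup>2)"
    \<comment> \<open>In the positive case g a - \<epsilon> lies strictly below the Laplacian
      coefficient, which leaves room for the Taylor error. In the other case the exponent is clamped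
      to 0 and the exact bound by 1 is required.\<close>
    proof (cases "0 < g a - \<epsilon>")
      case True
      have "g a - \<epsilon> < ddbar_coeff \<Phi> a" using bspec[OF ge a] \<epsilon> by linarith
      from L_Phi_le_exp[OF U_dom(1) a \<Phi> True this] obtain \<rho>
        where \<rho>: "0 < \<rho>" "\<And>r. 0 < r \<Longrightarrow> r < \<rho> \<Longrightarrow> L_Phi \<Phi> a r \<le> exp (- ((g a - \<epsilon>) / 2) * r\<^sup>2)" by blast
      have "max ((g a - \<epsilon>) / 2) 0 = (g a - \<epsilon>) / 2" using True by simp
      then show thesis using that[OF \<rho>(1)] \<rho>(2) by simp
    next
      case False
      have lap0: "0 \<le> ddbar_coeff \<Phi> \<tau>" if "\<tau> \<in> U" for \<tau> using ge g_nonneg that by fastforce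
      \<comment> \<open>A strict upper bound at a, hence near a by continuity; it is positive
        because the coefficient is nonnegative on U.\<close>
      define C where "C = ddbar_coeff \<Phi> a + 1"
      have C: "0 < C" using lap0[OF a] by (simp add: C_def)
      have "isCont (ddbar_coeff \<Phi>) a"
        using continuous_on_ddbar_coeff[OF U_dom(1) \<Phi>] U_dom(1) a by (simp add: continuous_on_eq_continuous_at)
      then have "\<forall>\<^sub>F \<tau> in nhds a. ddbar_coeff \<Phi> \<tau> < C"
        by (intro order_tendstoD(2)[of "ddbar_coeff \<Phi>" "ddbar_coeff \<Phi> a"])
          (simp_all add: C_def isCont_def tendsto_nhds_iff)
      then obtain d1 where d1: "0 < d1" "\<And>\<tau>. dist \<tau> a < d1 \<Longrightarrow> ddbar_coeff \<Phi> \<tau> < C"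
        unfolding eventually_nhds_metric by blast
      \<comment> \<open>r \<le> 1 gives r^2 \<le> r < 1/(2C), hence r^2 C \<le> 1/2, the mass
        condition. The further bound r < d/2 keeps the doubled disc inside U.\<close>
      define \<rho> where "\<rho> = min d1 (min 1 (1 / (2 * C)))"
      have "0 < \<rho>" using d1 C by (simp add: \<rho>_def)
      then show thesis
      proof (rule that)
        fix r assume r: "0 < r" "r < \<rho>" "r < d / 2"
        have "ball a (2 * r) \<subseteq> U" using r d(2) by auto
        then have \<Phi>r: "Ck_on 2 \<Phi> (ball a (2 * r))" by (rule Ck_on_subset[OF \<Phi>])
        have "L_Phi \<Phi> a r \<le> 1"
        proof (rule L_Phi_le_1[OF r(1) \<Phi>r])
          fix \<tau> assume \<tau>: "\<tau> \<in> ball a r"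
          then have \<tau>U: "\<tau> \<in> U" using r d(2) by auto
          then show "0 \<le> ddbar_coeff \<Phi> \<tau>" by (rule lap0)
          have "ddbar_coeff \<Phi> \<tau> \<le> C" using \<tau> r by (intro less_imp_le d1) (simp add: \<rho>_def dist_commute)
          moreover have "r\<^sup>2 \<le> 1 / (2 * C)"
          proof -
            have "r * r \<le> r * 1" using r by (intro mult_left_mono) (auto simp: \<rho>_def)
            then have "r\<^sup>2 \<le> r" by (simp add: power2_eq_square)
            moreover have "r < 1 / (2 * C)" using r by (simp add: \<rho>_def)
            ultimately show ?thesis by linarith
          qed
          ultimately have "r\<^sup>2 * ddbar_coeff \<Phi> \<tau> \<le> 1 / (2 * C) * C"
            using lap0[OF \<tau>U] C by (intro mult_mono) auto
          then show "r\<^sup>2 * ddbar_coeff \<Phi> \<tau> \<le> 1 / 2" using C by simp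
        qed
        moreover have "max ((g a - \<epsilon>) / 2) 0 = 0" using False by simp
        ultimately show "L_Phi \<Phi> a r \<le> exp (- max ((g a - \<epsilon>) / 2) 0 * r\<^sup>2)" by simp
      qed
    qed
    define r\<^sub>\<epsilon> where "r\<^sub>\<epsilon> = min \<rho> (d / 2)"
    have "0 < r\<^sub>\<epsilon>" "r\<^sub>\<epsilon> < delta U a" using \<rho>(1) d(1) d\<delta> by (auto simp: r\<^sub>\<epsilon>_def)
    moreover have "\<forall>r. 0 < r \<and> r < r\<^sub>\<epsilon> \<longrightarrow> L_Phi \<Phi> a r \<le> exp (- max ((g a - \<epsilon>) / 2) 0 * r\<^sup>2)"
      using \<rho>(2) by (simp add: r\<^sub>\<epsilon>_def)
    ultimately show "\<exists>r\<^sub>\<epsilon>. 0 < r\<^sub>\<epsilon> \<and> r\<^sub>\<epsilon> < delta U a \<and>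
       (\<forall>r. 0 < r \<and> r < r\<^sub>\<epsilon> \<longrightarrow> L_Phi \<Phi> a r \<le> exp (- max ((g a - \<epsilon>) / 2) 0 * r\<^sup>2))" by blast
  next
    fix a
    assume L: "\<forall>a\<in>U. \<forall>\<epsilon>>0. \<exists>r\<^sub>\<epsilon>. 0 < r\<^sub>\<epsilon> \<and> r\<^sub>\<epsilon> < delta U a \<and>
       (\<forall>r. 0 < r \<and> r < r\<^sub>\<epsilon> \<longrightarrow> L_Phi \<Phi> a r \<le> exp (- max ((g a - \<epsilon>) / 2) 0 * r\<^sup>2))"
      and a: "a \<in> U"
    show "g a \<le> ddbar_coeff \<Phi> a"
    proof (rule ccontr)
      define c where "c = ddbar_coeff \<Phi> a"
      assume "\<not> g a \<le> ddbar_coeff \<Phi> a"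
      then have \<epsilon>: "0 < (g a - c) / 2" by (simp add: c_def)
      \<comment> \<open>Taking \<epsilon> as half the gap puts g a - \<epsilon> midway between c and
        g a. Clamping at 0 can only raise it, so c < \<mu> also when c is negative, and \<mu> \<ge>
        0 makes the quadratic bound on the exponential available.\<close>
      define \<mu> where "\<mu> = max (g a - (g a - c) / 2) 0"
      have "max (x / 2) 0 = max x 0 / 2" for x :: real by (simp add: max_def)
      then have \<mu>2: "max ((g a - (g a - c) / 2) / 2) 0 = \<mu> / 2" unfolding \<mu>_def .
      obtain r1 where r1: "0 < r1" "\<forall>r. 0 < r \<and> r < r1 \<longrightarrow> L_Phi \<Phi> a r \<le> exp (- (\<mu> / 2) * r\<^sup>2)"
        using L[rule_format, OF a \<epsilon>] unfolding \<mu>2 by blast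
      have "c < g a - (g a - c) / 2" using \<epsilon> by argo
      then have "c < \<mu>" by (simp add: \<mu>_def)
      then obtain \<kappa> where \<kappa>: "c < \<kappa>" "\<kappa> < \<mu>" using dense[of c \<mu>] by blast
      obtain r2 where r2: "0 < r2" "\<And>r. 0 < r \<Longrightarrow> r < r2 \<Longrightarrow> 1 - \<kappa> / 2 * r\<^sup>2 \<le> L_Phi \<Phi> a r"
        by (rule L_Phi_ge[OF U_dom(1) a \<Phi> \<kappa>(1)[unfolded c_def]]) (rule that)
      have \<mu>0: "0 \<le> \<mu>" by (simp add: \<mu>_def)
      \<comment> \<open>Comparing 1 - \<kappa> r^2/2 \<le> L with L \<le> 1 - \<mu> r^2/2 + \<mu>^2
        r^4/8 and dividing by r^2/2. Letting r tend to 0 contradicts \<kappa> < \<mu>.\<close>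
      have ineq: "\<mu> - \<kappa> \<le> \<mu>\<^sup>2 * r\<^sup>2 / 4" if r: "0 < r" "r < r1" "r < r2" for r
      proof -
        have "1 - \<kappa> / 2 * r\<^sup>2 \<le> exp (- (\<mu> / 2 * r\<^sup>2))" using r1(2) r2(2)[OF r(1,3)] r by fastforce
        also have "\<dots> \<le> 1 - \<mu> / 2 * r\<^sup>2 + (\<mu> / 2 * r\<^sup>2)\<^sup>2 / 2" using \<mu>0 by (intro exp_minus_le_quadratic) simp
        finally have "1 - \<kappa> / 2 * r\<^sup>2 \<le> 1 - \<mu> / 2 * r\<^sup>2 + (\<mu> / 2 * r\<^sup>2)\<^sup>2 / 2" .
        moreover have "(\<mu> - \<kappa>) * t \<le> (\<mu>\<^sup>2 * t / 4) * t" if "1 - \<kappa> / 2 * t \<le> 1 - \<mu> / 2 * t + (\<mu> / 2 * t)\<^sup>2 / 2" for t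
        proof -
          have "(\<mu> / 2 * t)\<^sup>2 / 2 = ((\<mu>\<^sup>2 * t / 4) * t) / 2" by (simp add: power2_eq_square)
          moreover have "(\<mu> - \<kappa>) * t = \<mu> * t - \<kappa> * t" by (rule left_diff_distrib)
          ultimately show ?thesis using that by argo
        qed
        ultimately have "(\<mu> - \<kappa>) * r\<^sup>2 \<le> (\<mu>\<^sup>2 * r\<^sup>2 / 4) * r\<^sup>2" by blast
        then show ?thesis by (rule mult_right_le_imp_le) (use r(1) in simp)
      qed
      have "\<mu> - \<kappa> \<le> 0"
      proof (rule tendsto_lowerbound)
        have "((\<lambda>r. \<mu>\<^sup>2 * r\<^sup>2 / 4) \<longlongrightarrow> \<mu>\<^sup>2 * 0\<^sup>2 / 4) (at_right 0)" by (intro tendsto_intros) simp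
        then show "((\<lambda>r. \<mu>\<^sup>2 * r\<^sup>2 / 4) \<longlongrightarrow> 0) (at_right 0)" by simp
        have "\<forall>\<^sub>F r in at_right 0. r \<in> {0<..<min r1 r2}"
          using r1(1) r2(1) by (intro eventually_at_right_real) simp
        then show "\<forall>\<^sub>F r in at_right 0. \<mu> - \<kappa> \<le> \<mu>\<^sup>2 * r\<^sup>2 / 4"
          by eventually_elim (rule ineq, simp_all)
      qed simp
      then show False using \<kappa>(2) by linarith
    qed
  qed
qed

end
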